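(* For any non-negative integer $N$ there exists a polynomial family $\mathcal{D}^{0}_N(\lambda)\in\mathcal{U}(\mathfrak{n}_{n+1}^-)$ ($\lambda\in\mathbb{C}$) such that for all $\lambda\in\mathbb{C}$ the map $$\mathcal{U}(\mathfrak{g}_n)\otimes\mathbb{C}_{\lambda-N}\ni T\otimes 1\mapsto i(T)\,\mathcal{D}^{0}_N(\lambda)\otimes 1\in\mathcal{U}(\mathfrak{g}_{n+1})\otimes\mathbb{C}_{\lambda}$$ induces a homomorphism $\mathcal{M}_{\lambda-N}(\mathfrak{g}_n)\rightarrow\mathcal{M}_{\lambda}(\mathfrak{g}_{n+1})$ of $\mathcal{U}(\mathfrak{g}_n)$-modules. Furthermore, for any $\lambda\in\mathbb{C}$, (the homomorphism induced by) $\mathcal{D}^{0}_N(\lambda)$ spans the space of all homomorphisms $\mathcal{M}_{\lambda-N}(\mathfrak{g}_n)\rightarrow\mathcal{M}_{\lambda}(\mathfrak{g}_{n+1})$ of $\mathcal{U}(\mathfrak{g}_n)$-modules.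
   Context: Fix an integer $n\ge 4$. For $m\in\{n,n+1\}$ let $G^m=O(2,m-1)$ be the group of real $(m+1)\times(m+1)$ matrices preserving $-t_1^2-t_2^2+x_1^2+\dots+x_{m-1}^2$ (coordinates ordered $(t_1,t_2,x_1,\dots,x_{m-1})$), and $\mathfrak{g}_m=\mathfrak{o}(2,m-1)$ its Lie algebra. Let $E_{ab}$ be the elementary matrices. Put $H=E_{14}+E_{41}$, $H_2=E_{23}+E_{32}$, $Q_1^-=-E_{12}+E_{21}+E_{24}+E_{42}$, $Q_2^-=E_{13}+E_{31}+E_{34}-E_{43}$, and for $1\le i,j\le m-3$: $Y_j^-=E_{4+j,1}+E_{4+j,4}+E_{1,4+j}-E_{4,4+j}$, $Z_j^+=E_{2,4+j}+E_{3,4+j}+E_{4+j,2}-E_{4+j,3}$, $M_{ij}=E_{4+i,4+j}-E_{4+j,4+i}$. Let $Q_i^+=(Q_i^-)^t$, $Y_j^+=(Y_j^-)^t$, $Z_j^-=(Z_j^+)^t$. Define the real subalgebras $\mathfrak{a}=\mathbb{R}H$, $\mathfrak{m}_m=\mathrm{span}(H_2,Z_j^\pm,M_{ij})\cong\mathfrak{so}(1,m-2)$, $\mathfrak{n}_m^\pm=\mathrm{span}(Q_1^\pm,Q_2^\pm,Y_j^\pm:1\le j\le m-3)$ (the $\pm1$-eigenspaces of $\mathrm{ad}(H)$, which are abelian), and the maximal parabolic subalgebra $\mathfrak{p}_m=\mathfrak{m}_m\oplus\mathfrak{a}\oplus\mathfrak{n}_m^+$. $\mathcal{U}(\cdot)$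 denotes the (complex) universal enveloping algebra. The inclusion $\mathfrak{g}_n\subset\mathfrak{g}_{n+1}$, $X\mapsto\begin{pmatrix}X&0\\0&0\end{pmatrix}$, induces $i:\mathcal{U}(\mathfrak{g}_n)\to\mathcal{U}(\mathfrak{g}_{n+1})$. For $\lambda\in\mathbb{C}$, $\mathbb{C}_\lambda=\mathbb{C}$ is the $\mathcal{U}(\mathfrak{p}_m)$-module on which $tH$ acts by $t\lambda$ and $\mathfrak{m}_m\oplus\mathfrak{n}_m^+$ acts by $0$. The generalized Verma module is $\mathcal{M}_\lambda(\mathfrak{g}_m)=\mathcal{U}(\mathfrak{g}_m)\otimes_{\mathcal{U}(\mathfrak{p}_m)}\mathbb{C}_\lambda$, i.e. the quotient of the left module $\mathcal{U}(\mathfrak{g}_m)\otimes\mathbb{C}_\lambda$ by the left submodule generated by the elements $X\otimes w-1\otimes X\cdot w$, $X\in\mathfrak{p}_m$, $w\in\mathbb{C}_\lambda$. $\mathcal{M}_\lambda(\mathfrak{g}_{n+1})$ is a $\mathcal{U}(\mathfrak{g}_n)$-module via $i$. A polynomial family in $\mathcal{U}(\mathfrak{n}_{n+1}^-)$ is a finite combination of elements of $\mathcal{U}(\mathfrak{n}_{n+1}^-)$ with coefficients polynomial in $\lambda$. *)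

theory Defs
  imports
    Complex_Main
    "HOL-Library.Poly_Mapping"
    "HOL-Library.FuncSet"
    "HOL-Algebra.QuotRing"
    "HOL-Algebra.Module"
    "HOL-Computational_Algebra.Polynomial"
    "Jordan_Normal_Form.Matrix"
begin

section \<open>Complex enveloping algebras of real matrix Lie algebras\<close>

text \<open>Words under concatenation, written additively so that the finitely supported functions
  on words form the free associative algebra (via the convolution product of
  \<^theory>\<open>HOL-Library.Poly_Mapping\<close>).\<close>

datatype 'a word = Word (letters: "'a list")

instantiation word :: (type) monoid_add
begin

definition zero_word :: "'a word" where
  "0 = Word []"

definition plus_word :: "'a word \<Rightarrow> 'a word \<Rightarrow> 'a word" where
  "v + w = Word (letters v @ letters w)"

instance
  by standard (auto simp: zero_word_def plus_word_def)

end

type_synonym free_algebra = "real mat word \<Rightarrow>\<^sub>0 complex"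

type_synonym env = "free_algebra set"

definition gen :: "real mat \<Rightarrow> free_algebra" where
  "gen X = Poly_Mapping.single (Word [X]) 1"

definition scal :: "complex \<Rightarrow> free_algebra" where
  "scal c = Poly_Mapping.single 0 c"

definition free_alg :: "real mat set \<Rightarrow> free_algebra ring" where
  "free_alg L =
    \<lparr>carrier = {p. \<forall>w \<in> Poly_Mapping.keys p. set_word w \<subseteq> L},
     monoid.mult = (*), one = 1, zero = 0, add = (+)\<rparr>"

text \<open>The parameter \<open>L\<close> is a real Lie algebra of square matrices under the commutator. Since the
  coefficients are complex while the linearity relations are imposed for real scalars, the
  quotient below is the tensor algebra of the complexification of \<open>L\<close> modulo the commutator
  relations.\<close>

definition env_relations :: "real mat set \<Rightarrow> free_algebra set" where
  "env_relations L =
     {gen (X + Y) - gen X - gen Y | X Y. X \<in> L \<and> Y \<in> L}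
   \<union> {gen (c \<cdot>\<^sub>m X) - scal (complex_of_real c) * gen X | c X. X \<in> L}
   \<union> {gen X * gen Y - gen Y * gen X - gen (X * Y - Y * X) | X Y. X \<in> L \<and> Y \<in> L}"

definition env_ideal :: "real mat set \<Rightarrow> free_algebra set" where
  "env_ideal L = Idl\<^bsub>free_alg L\<^esub> (env_relations L)"

definition UEA :: "real mat set \<Rightarrow> env ring" where
  "UEA L = free_alg L Quot env_ideal L"

definition U_gen :: "real mat set \<Rightarrow> real mat \<Rightarrow> env" where
  "U_gen L X = env_ideal L +>\<^bsub>free_alg L\<^esub> gen X"

definition U_scalar :: "real mat set \<Rightarrow> complex \<Rightarrow> env" where
  "U_scalar L c = env_ideal L +>\<^bsub>free_alg L\<^esub> scal c"

definition free_map :: "(real mat \<Rightarrow> real mat) \<Rightarrow> free_algebra \<Rightarrow> free_algebra" where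
  "free_map \<phi> p =
    (\<Sum>w \<in> Poly_Mapping.keys p. Poly_Mapping.single (map_word \<phi> w) (Poly_Mapping.lookup p w))"

text \<open>The algebra homomorphism \<open>UEA L \<rightarrow> UEA L'\<close> induced by a Lie algebra homomorphism
  \<open>\<phi> : L \<rightarrow> L'\<close>; for such \<open>\<phi>\<close> the sets in the union coincide.\<close>

definition U_map ::
  "real mat set \<Rightarrow> (real mat \<Rightarrow> real mat) \<Rightarrow> env \<Rightarrow> env" where
  "U_map L' \<phi> C = (\<Union>x \<in> C. env_ideal L' +>\<^bsub>free_alg L'\<^esub> free_map \<phi> x)"

definition polynomial_family :: "real mat set \<Rightarrow> (complex \<Rightarrow> env) \<Rightarrow> bool" where
  "polynomial_family L D \<longleftrightarrow>
    (\<exists>(r::nat) (p :: nat \<Rightarrow> complex poly) (u :: nat \<Rightarrow> env).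
       (\<forall>k<r. u k \<in> carrier (UEA L)) \<and>
       (\<forall>lam. D lam = (\<Oplus>\<^bsub>UEA L\<^esub>k\<in>{..<r}. U_scalar L (poly (p k) lam) \<otimes>\<^bsub>UEA L\<^esub> u k)))"


section \<open>Left modules over a not necessarily commutative ring\<close>

text \<open>The record type of \<^theory>\<open>HOL-Algebra.Module\<close> is used without its locale, which
  requires a commutative ring. The multiplicative fields carry no information.\<close>

definition generated_submodule ::
  "('r, 'c) ring_scheme \<Rightarrow> ('r, 'm) module \<Rightarrow> 'm set \<Rightarrow> 'm set" where
  "generated_submodule R M S = \<Inter>{N. submodule N R M \<and> S \<subseteq> N}"

definition quotient_module :: "('r, 'm) module \<Rightarrow> 'm set \<Rightarrow> ('r, 'm set) module" where
  "quotient_module M N =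
    \<lparr>carrier = a_rcosets\<^bsub>M\<^esub> N, monoid.mult = undefined, one = undefined,
     zero = N, add = set_add M,
     smult = (\<lambda>a C. \<Union>x \<in> C. N +>\<^bsub>M\<^esub> (a \<odot>\<^bsub>M\<^esub> x))\<rparr>"

definition restrict_scalars :: "('s \<Rightarrow> 'r) \<Rightarrow> ('r, 'm) module \<Rightarrow> ('s, 'm) module" where
  "restrict_scalars \<phi> M =
    \<lparr>carrier = carrier M, monoid.mult = undefined, one = undefined,
     zero = \<zero>\<^bsub>M\<^esub>, add = (\<oplus>\<^bsub>M\<^esub>),
     smult = (\<lambda>a x. \<phi> a \<odot>\<^bsub>M\<^esub> x)\<rparr>"

definition left_module_hom ::
  "('r, 'c) ring_scheme \<Rightarrow> ('r, 'm) module \<Rightarrow> ('r, 'n) module \<Rightarrow> ('m \<Rightarrow> 'n) set" where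
  "left_module_hom R M N =
    {f \<in> carrier M \<rightarrow>\<^sub>E carrier N.
       (\<forall>x \<in> carrier M. \<forall>y \<in> carrier M. f (x \<oplus>\<^bsub>M\<^esub> y) = f x \<oplus>\<^bsub>N\<^esub> f y) \<and>
       (\<forall>a \<in> carrier R. \<forall>x \<in> carrier M. f (a \<odot>\<^bsub>M\<^esub> x) = a \<odot>\<^bsub>N\<^esub> f x)}"


section \<open>The Lie algebras\<close>

text \<open>Matrix units with indices starting at 1, whereas \<^const>\<open>index_mat\<close> counts from 0.
  Throughout, \<open>m\<close> stands for the Lie algebra of type \<open>o(2, m - 1)\<close>, so the matrices have
  size \<open>m + 1\<close>.\<close>

definition Emat :: "nat \<Rightarrow> nat \<Rightarrow> nat \<Rightarrow> real mat" where
  "Emat m a b = mat (m + 1) (m + 1) (\<lambda>(i, j). if i + 1 = a \<and> j + 1 = b then 1 else 0)"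

definition form :: "nat \<Rightarrow> real mat" where
  "form m = mat (m + 1) (m + 1) (\<lambda>(i, j). if i = j then (if i < 2 then - 1 else 1) else 0)"

definition lie_g :: "nat \<Rightarrow> real mat set" where
  "lie_g m = {X \<in> carrier_mat (m + 1) (m + 1).
            transpose_mat X * form m + form m * X = 0\<^sub>m (m + 1) (m + 1)}"

inductive_set real_span :: "nat \<Rightarrow> real mat set \<Rightarrow> real mat set" for m S where
  zero: "0\<^sub>m (m + 1) (m + 1) \<in> real_span m S"
| add: "X \<in> S \<Longrightarrow> Y \<in> real_span m S \<Longrightarrow> c \<cdot>\<^sub>m X + Y \<in> real_span m S"

definition Hmat :: "nat \<Rightarrow> real mat" where
  "Hmat m = Emat m 1 4 + Emat m 4 1"

definition H2 :: "nat \<Rightarrow> real mat" where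
  "H2 m = Emat m 2 3 + Emat m 3 2"

definition Q1_minus :: "nat \<Rightarrow> real mat" where
  "Q1_minus m = - Emat m 1 2 + Emat m 2 1 + Emat m 2 4 + Emat m 4 2"

definition Q2_minus :: "nat \<Rightarrow> real mat" where
  "Q2_minus m = Emat m 1 3 + Emat m 3 1 + Emat m 3 4 - Emat m 4 3"

definition Y_minus :: "nat \<Rightarrow> nat \<Rightarrow> real mat" where
  "Y_minus m j = Emat m (4 + j) 1 + Emat m (4 + j) 4 + Emat m 1 (4 + j) - Emat m 4 (4 + j)"

definition Z_plus :: "nat \<Rightarrow> nat \<Rightarrow> real mat" where
  "Z_plus m j = Emat m 2 (4 + j) + Emat m 3 (4 + j) + Emat m (4 + j) 2 - Emat m (4 + j) 3"

definition Mmat :: "nat \<Rightarrow> nat \<Rightarrow> nat \<Rightarrow> real mat" where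
  "Mmat m i j = Emat m (4 + i) (4 + j) - Emat m (4 + j) (4 + i)"

definition Q1_plus :: "nat \<Rightarrow> real mat" where
  "Q1_plus m = transpose_mat (Q1_minus m)"

definition Q2_plus :: "nat \<Rightarrow> real mat" where
  "Q2_plus m = transpose_mat (Q2_minus m)"

definition Y_plus :: "nat \<Rightarrow> nat \<Rightarrow> real mat" where
  "Y_plus m j = transpose_mat (Y_minus m j)"

definition Z_minus :: "nat \<Rightarrow> nat \<Rightarrow> real mat" where
  "Z_minus m j = transpose_mat (Z_plus m j)"

definition lie_m :: "nat \<Rightarrow> real mat set" where
  "lie_m m = real_span m
     ({H2 m} \<union> Z_plus m ` {1..m - 3} \<union> Z_minus m ` {1..m - 3}
      \<union> (\<lambda>(i, j). Mmat m i j) ` ({1..m - 3} \<times> {1..m - 3}))"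

definition n_minus :: "nat \<Rightarrow> real mat set" where
  "n_minus m = real_span m ({Q1_minus m, Q2_minus m} \<union> Y_minus m ` {1..m - 3})"

definition n_plus :: "nat \<Rightarrow> real mat set" where
  "n_plus m = real_span m ({Q1_plus m, Q2_plus m} \<union> Y_plus m ` {1..m - 3})"

definition parabolic :: "nat \<Rightarrow> real mat set" where
  "parabolic m = {A + t \<cdot>\<^sub>m Hmat m + B | A t B. A \<in> lie_m m \<and> B \<in> n_plus m}"

definition pad :: "nat \<Rightarrow> real mat \<Rightarrow> real mat" where
  "pad n X = four_block_mat X (0\<^sub>m (n + 1) 1) (0\<^sub>m 1 (n + 1)) (0\<^sub>m 1 1)"

definition incl :: "nat \<Rightarrow> env \<Rightarrow> env" where
  "incl n = U_map (lie_g (n + 1)) (pad n)"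

definition n_minus_incl :: "nat \<Rightarrow> env \<Rightarrow> env" where
  "n_minus_incl m = U_map (lie_g m) id"


section \<open>Generalized Verma modules\<close>

definition char_act :: "nat \<Rightarrow> complex \<Rightarrow> real mat \<Rightarrow> complex \<Rightarrow> complex" where
  "char_act m lam X w =
    complex_of_real (THE t. \<exists>A \<in> lie_m m. \<exists>B \<in> n_plus m. X = A + t \<cdot>\<^sub>m Hmat m + B) * lam * w"

text \<open>The description in \<^const>\<open>char_act\<close> is unambiguous: the coefficient of \<open>H\<close> is the
  matrix entry in the first row and fourth column.\<close>

lemma real_span_carrier_entry:
  assumes "X \<in> real_span m S"
    and "\<And>Y. Y \<in> S \<Longrightarrow> Y \<in> carrier_mat (m + 1) (m + 1) \<and> Y $$ (0, 3) = 0"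
    and "m \<ge> 4"
  shows "X \<in> carrier_mat (m + 1) (m + 1) \<and> X $$ (0, 3) = 0"
  using assms(1)
proof induction
  case zero
  then show ?case using assms(3) by auto
next
  case (add X Y c)
  then show ?case using assms(2)[OF add(1)] assms(3) by auto
qed

lemma char_act_eq:
  assumes "m \<ge> 4" "A \<in> lie_m m" "B \<in> n_plus m"
  shows "char_act m lam (A + t \<cdot>\<^sub>m Hmat m + B) w = complex_of_real t * lam * w"
proof -
  have lie_m: "X \<in> carrier_mat (m + 1) (m + 1) \<and> X $$ (0, 3) = 0" if "X \<in> lie_m m" for X
    using that unfolding lie_m_def
    by (rule real_span_carrier_entry)
      (use assms(1) in \<open>auto simp: H2_def Z_plus_def Z_minus_def Mmat_def Emat_def\<close>)
  have n_plus: "X \<in> carrier_mat (m + 1) (m + 1) \<and> X $$ (0, 3) = 0" if "X \<in> n_plus m" for X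
    using that unfolding n_plus_def
    by (rule real_span_carrier_entry)
      (use assms(1) in \<open>auto simp: Q1_plus_def Q2_plus_def Y_plus_def
          Q1_minus_def Q2_minus_def Y_minus_def Emat_def\<close>)
  have entry: "(A' + s \<cdot>\<^sub>m Hmat m + B') $$ (0, 3) = s" if "A' \<in> lie_m m" "B' \<in> n_plus m" for A' B' s
    using lie_m[OF that(1)] n_plus[OF that(2)] assms(1) by (auto simp: Hmat_def Emat_def)
  have "(THE s. \<exists>A' \<in> lie_m m. \<exists>B' \<in> n_plus m. A + t \<cdot>\<^sub>m Hmat m + B = A' + s \<cdot>\<^sub>m Hmat m + B') = t"
  proof (rule the_equality)
    show "\<exists>A' \<in> lie_m m. \<exists>B' \<in> n_plus m. A + t \<cdot>\<^sub>m Hmat m + B = A' + t \<cdot>\<^sub>m Hmat m + B'"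
      using assms by blast
  next
    fix s
    assume "\<exists>A' \<in> lie_m m. \<exists>B' \<in> n_plus m. A + t \<cdot>\<^sub>m Hmat m + B = A' + s \<cdot>\<^sub>m Hmat m + B'"
    then show "s = t" using entry assms(2,3) by metis
  qed
  then show ?thesis by (simp add: char_act_def)
qed

text \<open>The left module \<open>U(g\<^sub>m) \<otimes> C\<^sub>\<lambda>\<close> (tensor product over the complex numbers), with
  \<open>U(g\<^sub>m)\<close> acting on the first factor. As \<open>C\<^sub>\<lambda>\<close> is the complex line, its underlying space is
  identified with \<open>U(g\<^sub>m)\<close> so that \<open>u \<otimes> w\<close> becomes the multiple of \<open>u\<close> by \<open>w\<close>.\<close>

definition tensor_line :: "nat \<Rightarrow> (env, env) module" where
  "tensor_line m =
    \<lparr>carrier = carrier (UEA (lie_g m)), monoid.mult = undefined, one = undefined,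
     zero = \<zero>\<^bsub>UEA (lie_g m)\<^esub>, add = (\<oplus>\<^bsub>UEA (lie_g m)\<^esub>),
     smult = (\<otimes>\<^bsub>UEA (lie_g m)\<^esub>)\<rparr>"

definition tensor :: "nat \<Rightarrow> env \<Rightarrow> complex \<Rightarrow> env" where
  "tensor m u w = u \<otimes>\<^bsub>UEA (lie_g m)\<^esub> U_scalar (lie_g m) w"

definition verma_relations :: "nat \<Rightarrow> complex \<Rightarrow> env set" where
  "verma_relations m lam =
    generated_submodule (UEA (lie_g m)) (tensor_line m)
      {tensor m (U_gen (lie_g m) X) w
         \<ominus>\<^bsub>tensor_line m\<^esub> tensor m \<one>\<^bsub>UEA (lie_g m)\<^esub> (char_act m lam X w)
       | X w. X \<in> parabolic m}"

definition verma :: "nat \<Rightarrow> complex \<Rightarrow> (env, env set) module" where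
  "verma m lam = quotient_module (tensor_line m) (verma_relations m lam)"

definition verma_class :: "nat \<Rightarrow> complex \<Rightarrow> env \<Rightarrow> env set" where
  "verma_class m lam x = verma_relations m lam +>\<^bsub>tensor_line m\<^esub> x"

definition verma_homs :: "nat \<Rightarrow> complex \<Rightarrow> complex \<Rightarrow> (env set \<Rightarrow> env set) set" where
  "verma_homs n \<mu> lam =
    left_module_hom (UEA (lie_g n)) (verma n \<mu>) (restrict_scalars (incl n) (verma (n + 1) lam))"

text \<open>The complex vector space structure on homomorphisms comes from the scalars inside the
  enveloping algebra, which \<^const>\<open>incl\<close> preserves; hence homomorphisms are automatically
  complex linear.\<close>

definition hom_scale :: "nat \<Rightarrow> complex \<Rightarrow> complex \<Rightarrow> complex \<Rightarrow>
    (env set \<Rightarrow> env set) \<Rightarrow> env set \<Rightarrow> env set" where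
  "hom_scale n \<mu> lam c \<Phi> =
    (\<lambda>v \<in> carrier (verma n \<mu>). U_scalar (lie_g (n + 1)) c \<odot>\<^bsub>verma (n + 1) lam\<^esub> \<Phi> v)"

end

theory Submission
  imports Defs
begin

text \<open>
  A homomorphism out of \<open>M\<^sub>\<mu>(g\<^sub>n)\<close> is determined by the image \<open>v\<close> of the generator \<open>1 \<otimes> 1\<close>, and \<open>v\<close>
  can be any element on which \<open>p\<^sub>n\<close> acts by the character \<open>\<mu>\<close>, a singular vector
  (\<open>hom_of_in_verma_homs\<close>, \<open>verma_hom_is_hom_of\<close>). So the theorem says that for every \<open>\<lambda>\<close> the
  singular vectors of weight \<open>\<lambda> - N\<close> in \<open>M\<^sub>\<lambda>(g\<^sub>n\<^sub>+\<^sub>1)\<close> form a line, spanned by a vector that depends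
  polynomially on \<open>\<lambda>\<close>.

  Singular vectors can be computed in coordinates. The nilradical \<open>n\<^sup>-\<close> of \<open>g\<^sub>n\<^sub>+\<^sub>1\<close> is abelian with a
  basis \<open>N\<^sub>a\<close>, and \<open>M\<^sub>\<lambda>(g\<^sub>n\<^sub>+\<^sub>1)\<close> is the polynomial ring in variables \<open>\<xi>\<^sub>a\<close>: the element \<open>N\<^sub>a\<close> acts as
  multiplication by \<open>\<xi>\<^sub>a\<close>, \<open>H\<close> as \<open>\<lambda> - E\<close> with the Euler operator \<open>E\<close>, \<open>m\<close> by rotations, and \<open>n\<^sup>+\<close> by the
  second order operators \<open>\<xi>\<^sub>a \<Delta> + 2 \<eta>\<^sub>a (\<lambda> - E) \<partial>\<^sub>a\<close>. That these operators define a representation is a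
  computation in the Weyl algebra (\<open>rho_bracket\<close>). It replaces the theorem of Poincare, Birkhoff and
  Witt: the representation shows that ordered monomials in the \<open>N\<^sub>a\<close> are independent modulo the
  relations of the Verma module, and moving the elements of \<open>p\<close> to the right shows that they span
  (\<open>verma_ideal_iff\<close>).

  Let \<open>t\<close> be the one variable that does not come from \<open>g\<^sub>n\<close> and \<open>r = \<Sum> \<eta>\<^sub>a \<xi>\<^sub>a\<^sup>2\<close> the quadratic form in
  the others. Invariance under rotations and the weight force a singular vector to have the shape
  \<open>\<Sum>\<^sub>j a\<^sub>j r\<^sup>j t\<^sup>N\<^sup>-\<^sup>2\<^sup>j\<close>, and annihilation by \<open>n\<^sup>+\<close> is the two term recursion
  \<open>2 (j + 1) (n - 1 + 2 \<lambda> - 2 N + 2 (j + 1)) a\<^sub>j\<^sub>+\<^sub>1 + (N - 2 j) (N - 2 j - 1) a\<^sub>j = 0\<close>. The factor of \<open>a\<^sub>j\<close> never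
  vanishes for \<open>2 j + 2 \<le> N\<close>, whereas that of \<open>a\<^sub>j\<^sub>+\<^sub>1\<close> vanishes for special \<open>\<lambda>\<close>. Solving downwards from
  \<open>a\<^sub>j = 1\<close> at \<open>j = N div 2\<close> therefore never divides by a function of \<open>\<lambda>\<close>: the solution is
  polynomial in \<open>\<lambda>\<close> and does not vanish for any \<open>\<lambda>\<close>, and a solution with top coefficient \<open>0\<close> is \<open>0\<close>.
\<close>


section \<open>The free algebra and its universal property\<close>

text \<open>The map \<open>s\<close> embeds the complex scalars into the target. Both the action of words by operators and
  the substitution of letters by letters are linear extensions in this sense.\<close>

definition lin_ext :: "(complex \<Rightarrow> 'r) \<Rightarrow> ('a word \<Rightarrow> 'r) \<Rightarrow> ('a word \<Rightarrow>\<^sub>0 complex) \<Rightarrow> 'r::ring_1" where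
  "lin_ext s \<psi> p = (\<Sum>w\<in>Poly_Mapping.keys p. s (Poly_Mapping.lookup p w) * \<psi> w)"

text \<open>Restricting the keys to a set \<open>K\<close> makes the rule usable for the subalgebra of words over a given
  Lie algebra.\<close>

lemma poly_mapping_add_induct:
  assumes "Poly_Mapping.keys p \<subseteq> K"
    and "P 0"
    and "\<And>w c q. w \<in> K \<Longrightarrow> Poly_Mapping.keys q \<subseteq> K \<Longrightarrow> P q \<Longrightarrow> P (Poly_Mapping.single w c + q)"
  shows "P (p :: 'a \<Rightarrow>\<^sub>0 'b::ab_group_add)"
  using assms(1)
proof (induction "card (Poly_Mapping.keys p)" arbitrary: p)
  case 0
  then show ?case using assms(2) by simp
next
  case (Suc k)
  then obtain w where w: "w \<in> Poly_Mapping.keys p" by fastforce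
  define q where "q = p - Poly_Mapping.single w (Poly_Mapping.lookup p w)"
  have keys: "Poly_Mapping.keys q = Poly_Mapping.keys p - {w}"
    unfolding q_def by (auto simp: in_keys_iff lookup_minus lookup_single when_def split: if_splits)
  have "k = card (Poly_Mapping.keys q)"
    using Suc.hyps(2) w by (simp add: keys)
  then have "P q"
    using Suc.hyps(1)[of q] Suc.prems keys by blast
  then have "P (Poly_Mapping.single w (Poly_Mapping.lookup p w) + q)"
    using assms(3) Suc.prems w keys by blast
  then show ?case by (simp add: q_def)
qed

text \<open>The universal property of the free algebra: central scalars and multiplicativity on words suffice
  for the linear extension to be a ring homomorphism.\<close>

locale word_representation =
  fixes s :: "complex \<Rightarrow> 'r::ring_1" and \<psi> :: "'a word \<Rightarrow> 'r"
  assumes s_one: "s 1 = 1" and s_add: "s (a + b) = s a + s b" and s_mult: "s (a * b) = s a * s b"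
    and s_comm: "s a * \<psi> w = \<psi> w * s a"
    and \<psi>_zero: "\<psi> 0 = 1" and \<psi>_add: "\<psi> (v + w) = \<psi> v * \<psi> w"
begin

lemma s_zero [simp]: "s 0 = 0"
  using s_add[of 0 0] by simp

lemma lin_ext_superset:
  assumes "finite A" "Poly_Mapping.keys p \<subseteq> A"
  shows "lin_ext s \<psi> p = (\<Sum>w\<in>A. s (Poly_Mapping.lookup p w) * \<psi> w)"
  unfolding lin_ext_def using assms
  by (intro sum.mono_neutral_left) (auto simp: in_keys_iff)

lemma lin_ext_add: "lin_ext s \<psi> (p + q) = lin_ext s \<psi> p + lin_ext s \<psi> q"
proof -
  let ?A = "Poly_Mapping.keys p \<union> Poly_Mapping.keys q"
  have "lin_ext s \<psi> (p + q) = (\<Sum>w\<in>?A. s (Poly_Mapping.lookup (p + q) w) * \<psi> w)"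
    by (rule lin_ext_superset) (auto simp: keys_add)
  also have "\<dots> = (\<Sum>w\<in>?A. s (Poly_Mapping.lookup p w) * \<psi> w)
      + (\<Sum>w\<in>?A. s (Poly_Mapping.lookup q w) * \<psi> w)"
    by (simp add: lookup_add s_add distrib_right sum.distrib)
  also have "\<dots> = lin_ext s \<psi> p + lin_ext s \<psi> q"
    by (subst (1 2) lin_ext_superset[of ?A]) auto
  finally show ?thesis .
qed

lemma lin_ext_zero [simp]: "lin_ext s \<psi> 0 = 0"
  by (simp add: lin_ext_def)

lemma lin_ext_uminus: "lin_ext s \<psi> (- p) = - lin_ext s \<psi> p"
  using lin_ext_add[of p "- p"] by (simp add: eq_neg_iff_add_eq_0 add.commute)

lemma lin_ext_diff: "lin_ext s \<psi> (p - q) = lin_ext s \<psi> p - lin_ext s \<psi> q"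
  using lin_ext_add[of p "- q"] by (simp add: lin_ext_uminus)

lemma lin_ext_single [simp]: "lin_ext s \<psi> (Poly_Mapping.single w c) = s c * \<psi> w"
  by (subst lin_ext_superset[of "{w}"]) auto

lemma lin_ext_one [simp]: "lin_ext s \<psi> 1 = 1"
  using lin_ext_single[of 0 1] by (simp add: s_one \<psi>_zero del: lin_ext_single)

lemma lin_ext_mult: "lin_ext s \<psi> (p * q) = lin_ext s \<psi> p * lin_ext s \<psi> q"
proof (induction p rule: poly_mapping_add_induct[where K = UNIV])
  case (3 w c p)
  have single: "lin_ext s \<psi> (Poly_Mapping.single w c * q) = s c * \<psi> w * lin_ext s \<psi> q"
  proof (induction q rule: poly_mapping_add_induct[where K = UNIV])
    case (3 v d q)
    have "s c * \<psi> w * (s d * \<psi> v) = s (c * d) * \<psi> (w + v)"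
      by (simp add: s_mult \<psi>_add mult.assoc) (simp flip: mult.assoc s_comm)
    then show ?case using 3
      by (simp add: distrib_left lin_ext_add mult_single)
  qed auto
  show ?case using 3 single by (simp add: distrib_right lin_ext_add)
qed auto

lemma lin_ext_power: "lin_ext s \<psi> (p ^ k) = lin_ext s \<psi> p ^ k"
  by (induction k) (simp_all add: lin_ext_mult)

lemma lin_ext_sum: "lin_ext s \<psi> (sum f A) = (\<Sum>i\<in>A. lin_ext s \<psi> (f i))"
  by (induction A rule: infinite_finite_induct) (simp_all add: lin_ext_add)

end

lemma scal_simps:
  "scal 0 = 0" "scal 1 = 1" "scal (a + b) = scal a + scal b" "scal (a * b) = scal a * scal b"
  "scal (- a) = - scal a" "scal (a - b) = scal a - scal b"
  by (simp_all add: scal_def single_add mult_single single_uminus single_diff)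

lemma scal_commute: "scal c * p = p * scal c"
proof (induction p rule: poly_mapping_add_induct[where K = UNIV])
  case (3 w d q)
  then show ?case by (simp add: scal_def distrib_left distrib_right mult_single mult.commute)
qed auto

lemma map_word_hom:
  "map_word f 0 = 0" "map_word f (v + w) = map_word f v + map_word f w"
  by (simp add: zero_word_def) (cases v; cases w; simp add: plus_word_def)

lemma word_representation_map:
  "word_representation scal (\<lambda>w. Poly_Mapping.single (map_word \<phi> w) 1)"
  by standard (rule scal_commute | simp add: scal_simps map_word_hom mult_single)+

lemma free_map_lin_ext: "free_map \<phi> = lin_ext scal (\<lambda>w. Poly_Mapping.single (map_word \<phi> w) 1)"
  by (rule ext) (simp add: free_map_def lin_ext_def scal_def mult_single)

lemma free_map_hom:
  "free_map \<phi> 0 = 0" "free_map \<phi> 1 = 1" "free_map \<phi> (p + q) = free_map \<phi> p + free_map \<phi> q"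
  "free_map \<phi> (- p) = - free_map \<phi> p" "free_map \<phi> (p - q) = free_map \<phi> p - free_map \<phi> q"
  "free_map \<phi> (p * q) = free_map \<phi> p * free_map \<phi> q"
  unfolding free_map_lin_ext
  by (rule word_representation_map[THEN word_representation.lin_ext_zero]
      word_representation_map[THEN word_representation.lin_ext_one]
      word_representation_map[THEN word_representation.lin_ext_add]
      word_representation_map[THEN word_representation.lin_ext_uminus]
      word_representation_map[THEN word_representation.lin_ext_diff]
      word_representation_map[THEN word_representation.lin_ext_mult])+

lemma free_map_single: "free_map \<phi> (Poly_Mapping.single w c) = Poly_Mapping.single (map_word \<phi> w) c"
  unfolding free_map_lin_ext word_representation.lin_ext_single[OF word_representation_map]
  by (simp add: scal_def mult_single)

lemma free_map_gen: "free_map \<phi> (gen X) = gen (\<phi> X)"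
  by (simp add: gen_def free_map_single)

lemma free_map_scal: "free_map \<phi> (scal c) = scal c"
  by (simp add: scal_def free_map_single map_word_hom)

lemma free_map_id: "free_map id p = p"
  by (induction p rule: poly_mapping_add_induct[where K = UNIV])
    (simp_all add: free_map_hom free_map_single word.map_ident)

lemma single_Cons:
  "Poly_Mapping.single (Word (X # xs)) c = gen X * Poly_Mapping.single (Word xs) c"
  by (simp add: gen_def mult_single plus_word_def)

lemma single_Nil: "Poly_Mapping.single (Word []) c = scal c"
  by (simp add: scal_def zero_word_def)


section \<open>Enveloping algebras in terms of representatives\<close>

abbreviation words_over :: "real mat set \<Rightarrow> free_algebra set" where
  "words_over L \<equiv> carrier (free_alg L)"

lemma free_alg_simps [simp]:
  "monoid.mult (free_alg L) = (*)" "one (free_alg L) = 1" "zero (free_alg L) = 0"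
  "add (free_alg L) = (+)"
  by (simp_all add: free_alg_def)

lemma words_over_iff:
  "p \<in> words_over L \<longleftrightarrow> Poly_Mapping.keys p \<subseteq> {w. set_word w \<subseteq> L}"
  by (auto simp: free_alg_def)

lemma set_word_add: "set_word (v + w) = set_word v \<union> set_word w"
  by (cases v; cases w; simp add: plus_word_def)

lemma words_over_closed [simp, intro]:
  "0 \<in> words_over L" "1 \<in> words_over L" "scal c \<in> words_over L"
  "p \<in> words_over L \<Longrightarrow> q \<in> words_over L \<Longrightarrow> p + q \<in> words_over L"
  "p \<in> words_over L \<Longrightarrow> - p \<in> words_over L"
  "p \<in> words_over L \<Longrightarrow> q \<in> words_over L \<Longrightarrow> p - q \<in> words_over L"
  "p \<in> words_over L \<Longrightarrow> q \<in> words_over L \<Longrightarrow> p * q \<in> words_over L"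
proof -
  show "0 \<in> words_over L" "1 \<in> words_over L" "scal c \<in> words_over L"
    by (auto simp: words_over_iff scal_def zero_word_def split: if_splits)
next
  assume "p \<in> words_over L" "q \<in> words_over L"
  then show "p + q \<in> words_over L" using keys_add[of p q] by (auto simp: words_over_iff)
  show "p - q \<in> words_over L"
    using \<open>p \<in> words_over L\<close> \<open>q \<in> words_over L\<close> keys_diff[of p q] by (auto simp: words_over_iff)
  show "p * q \<in> words_over L"
    using \<open>p \<in> words_over L\<close> \<open>q \<in> words_over L\<close> keys_mult[of p q]
    by (fastforce simp: words_over_iff set_word_add)
next
  assume "p \<in> words_over L"
  then show "- p \<in> words_over L" by (auto simp: words_over_iff in_keys_iff)
qed

lemma gen_in_words_over [simp, intro]: "X \<in> L \<Longrightarrow> gen X \<in> words_over L"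
  by (simp add: words_over_iff gen_def)

lemma power_in_words_over [intro]: "p \<in> words_over L \<Longrightarrow> p ^ k \<in> words_over L"
  by (induction k) auto

lemma sum_in_words_over [intro]: "(\<And>i. i \<in> A \<Longrightarrow> f i \<in> words_over L) \<Longrightarrow> sum f A \<in> words_over L"
  by (induction A rule: infinite_finite_induct) auto

lemma words_over_mono: "L \<subseteq> L' \<Longrightarrow> p \<in> words_over L \<Longrightarrow> p \<in> words_over L'"
  by (auto simp: words_over_iff)

text \<open>A word acts from the left one letter at a time, so this rule is the form in which statements about
  left ideals of the enveloping algebra are proved.\<close>

lemma words_over_induct [consumes 1, case_names zero one scal gen add]:
  assumes "p \<in> words_over L"
    and "P 0" and one: "P 1"
    and scal: "\<And>c q. q \<in> words_over L \<Longrightarrow> P q \<Longrightarrow> P (scal c * q)"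
    and gen: "\<And>X q. X \<in> L \<Longrightarrow> q \<in> words_over L \<Longrightarrow> P q \<Longrightarrow> P (gen X * q)"
    and add: "\<And>q r. q \<in> words_over L \<Longrightarrow> r \<in> words_over L \<Longrightarrow> P q \<Longrightarrow> P r \<Longrightarrow> P (q + r)"
  shows "P p"
  using assms(1)[unfolded words_over_iff]
proof (induction p rule: poly_mapping_add_induct[where K = "{w. set_word w \<subseteq> L}"])
  case (3 w c q)
  obtain xs where xs: "w = Word xs" by (cases w)
  have "P (Poly_Mapping.single (Word xs) c) \<and> Poly_Mapping.single (Word xs) c \<in> words_over L"
    using 3(1) unfolding xs
  proof (induction xs)
    case Nil
    show ?case using scal[OF _ one, of c] by (simp add: single_Nil)
  next
    case (Cons X xs)
    then show ?case using gen by (auto simp: single_Cons)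
  qed
  then show ?case using 3 add xs by (auto simp: words_over_iff)
qed (use assms(2) assms(1)[unfolded words_over_iff] in auto)

lemma free_map_in_words_over:
  assumes "\<And>X. X \<in> L \<Longrightarrow> \<phi> X \<in> L'" "p \<in> words_over L"
  shows "free_map \<phi> p \<in> words_over L'"
  using assms(2)
  by (induction rule: words_over_induct)
    (auto simp: free_map_hom free_map_scal free_map_gen assms(1))

lemma ring_free_alg: "ring (free_alg L)"
proof (rule ringI)
  show "abelian_group (free_alg L)"
    by (rule abelian_groupI) (auto simp: add.assoc add.commute intro: exI[of _ "- _"] bexI[of _ "- _"])
  show "Group.monoid (free_alg L)"
    by (rule monoidI) (auto simp: mult.assoc)
qed (auto simp: distrib_left distrib_right)

lemma free_alg_a_inv [simp]: "p \<in> words_over L \<Longrightarrow> \<ominus>\<^bsub>free_alg L\<^esub> p = - p"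
  by (rule abelian_group.minus_equality[OF ring.is_abelian_group[OF ring_free_alg]]) auto

lemma free_alg_minus [simp]:
  "p \<in> words_over L \<Longrightarrow> q \<in> words_over L \<Longrightarrow> p \<ominus>\<^bsub>free_alg L\<^esub> q = p - q"
  by (simp add: a_minus_def)

text \<open>The closure properties that keep the defining relations inside the subalgebra of words over \<open>L\<close>.\<close>

definition lie_closed :: "real mat set \<Rightarrow> bool" where
  "lie_closed L \<longleftrightarrow> (\<forall>X\<in>L. \<forall>Y\<in>L. X + Y \<in> L \<and> X * Y - Y * X \<in> L) \<and> (\<forall>X\<in>L. \<forall>c. c \<cdot>\<^sub>m X \<in> L)"

lemma ideal_env_ideal:
  assumes "lie_closed L"
  shows "ideal (env_ideal L) (free_alg L)"
  unfolding env_ideal_def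
proof (rule ring.genideal_ideal[OF ring_free_alg])
  show "env_relations L \<subseteq> words_over L"
    using assms by (auto simp: env_relations_def lie_closed_def)
qed

lemma env_ideal_least:
  assumes "K \<subseteq> words_over L" "0 \<in> K" "\<And>p q. p \<in> K \<Longrightarrow> q \<in> K \<Longrightarrow> p + q \<in> K"
    and "\<And>a p. a \<in> words_over L \<Longrightarrow> p \<in> K \<Longrightarrow> a * p \<in> K"
    and "\<And>a p. a \<in> words_over L \<Longrightarrow> p \<in> K \<Longrightarrow> p * a \<in> K"
    and "env_relations L \<subseteq> K"
  shows "env_ideal L \<subseteq> K"
  unfolding env_ideal_def
proof (rule ring.genideal_minimal[OF ring_free_alg])
  have um: "- p \<in> K" if "p \<in> K" for p
    using assms(4)[of "scal (- 1)" p] that by (simp add: scal_simps)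
  have "subgroup K (add_monoid (free_alg L))"
  proof (rule subgroup.intro)
    show "inv\<^bsub>add_monoid (free_alg L)\<^esub> p \<in> K" if "p \<in> K" for p
      using free_alg_a_inv[of p L] um[OF that] assms(1) that by (auto simp: a_inv_def)
  qed (use assms in auto)
  then show "ideal K (free_alg L)"
    by (rule idealI[OF ring_free_alg]) (use assms in auto)
qed (use assms in auto)

context
  fixes L assumes L: "lie_closed L"
begin

lemma env_ideal_subset: "env_ideal L \<subseteq> words_over L"
  using additive_subgroup.a_subset[OF ideal.axioms(1)[OF ideal_env_ideal[OF L]]] .

lemma env_ideal_closed:
  "0 \<in> env_ideal L"
  "p \<in> env_ideal L \<Longrightarrow> q \<in> env_ideal L \<Longrightarrow> p + q \<in> env_ideal L"
  "a \<in> words_over L \<Longrightarrow> p \<in> env_ideal L \<Longrightarrow> a * p \<in> env_ideal L"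
  "a \<in> words_over L \<Longrightarrow> p \<in> env_ideal L \<Longrightarrow> p * a \<in> env_ideal L"
proof -
  interpret ideal "env_ideal L" "free_alg L" by (rule ideal_env_ideal[OF L])
  show "0 \<in> env_ideal L" using additive_subgroup.zero_closed[OF is_additive_subgroup] by simp
  show "p \<in> env_ideal L \<Longrightarrow> q \<in> env_ideal L \<Longrightarrow> p + q \<in> env_ideal L"
    using additive_subgroup.a_closed[OF is_additive_subgroup] by simp
  show "a \<in> words_over L \<Longrightarrow> p \<in> env_ideal L \<Longrightarrow> a * p \<in> env_ideal L" using I_l_closed by simp
  show "a \<in> words_over L \<Longrightarrow> p \<in> env_ideal L \<Longrightarrow> p * a \<in> env_ideal L" using I_r_closed by simp
qed

lemma env_ideal_relations:
  "X \<in> L \<Longrightarrow> Y \<in> L \<Longrightarrow> gen (X + Y) - gen X - gen Y \<in> env_ideal L"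
  "X \<in> L \<Longrightarrow> gen (c \<cdot>\<^sub>m X) - scal (complex_of_real c) * gen X \<in> env_ideal L"
  "X \<in> L \<Longrightarrow> Y \<in> L \<Longrightarrow> gen X * gen Y - gen Y * gen X - gen (X * Y - Y * X) \<in> env_ideal L"
proof -
  have "env_relations L \<subseteq> env_ideal L"
    unfolding env_ideal_def using L
    by (intro ring.genideal_self[OF ring_free_alg]) (auto simp: env_relations_def lie_closed_def)
  then show "X \<in> L \<Longrightarrow> Y \<in> L \<Longrightarrow> gen (X + Y) - gen X - gen Y \<in> env_ideal L"
    "X \<in> L \<Longrightarrow> gen (c \<cdot>\<^sub>m X) - scal (complex_of_real c) * gen X \<in> env_ideal L"
    "X \<in> L \<Longrightarrow> Y \<in> L \<Longrightarrow> gen X * gen Y - gen Y * gen X - gen (X * Y - Y * X) \<in> env_ideal L"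
    unfolding env_relations_def by blast+
qed

end

text \<open>Computations in the enveloping algebra are carried out with representatives in the free algebra;
  this is the passage to the quotient.\<close>

definition ucls :: "real mat set \<Rightarrow> free_algebra \<Rightarrow> env" where
  "ucls L p = env_ideal L +>\<^bsub>free_alg L\<^esub> p"

lemma ucls_mem: "p \<in> ucls L q \<longleftrightarrow> (\<exists>i\<in>env_ideal L. p = i + q)"
  by (auto simp: ucls_def a_r_coset_def')

lemma carrier_UEA: "carrier (UEA L) = ucls L ` words_over L"
  by (auto simp: UEA_def FactRing_def A_RCOSETS_def' ucls_def)

context
  fixes L assumes L: "lie_closed L"
begin

lemma ring_UEA: "ring (UEA L)"
  unfolding UEA_def by (rule ideal.quotient_is_ring[OF ideal_env_ideal[OF L]])

lemma ucls_eq_iff: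
  assumes "p \<in> words_over L" "q \<in> words_over L"
  shows "ucls L p = ucls L q \<longleftrightarrow> p - q \<in> env_ideal L"
proof -
  interpret ideal "env_ideal L" "free_alg L" by (rule ideal_env_ideal[OF L])
  show ?thesis unfolding ucls_def
    using quotient_eq_iff_same_a_r_cos[OF ideal_env_ideal[OF L], of p q] assms by auto
qed

lemma UEA_ops:
  assumes "p \<in> words_over L" "q \<in> words_over L"
  shows "ucls L p \<oplus>\<^bsub>UEA L\<^esub> ucls L q = ucls L (p + q)"
    and "ucls L p \<otimes>\<^bsub>UEA L\<^esub> ucls L q = ucls L (p * q)"
    and "\<ominus>\<^bsub>UEA L\<^esub> ucls L p = ucls L (- p)"
proof -
  interpret I: ideal "env_ideal L" "free_alg L" by (rule ideal_env_ideal[OF L])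
  interpret h: ring_hom_ring "free_alg L" "UEA L" "ucls L"
    unfolding UEA_def ucls_def[abs_def] by (rule I.rcos_ring_hom_ring)
  show "ucls L p \<oplus>\<^bsub>UEA L\<^esub> ucls L q = ucls L (p + q)"
    using h.hom_add assms by simp
  show "ucls L p \<otimes>\<^bsub>UEA L\<^esub> ucls L q = ucls L (p * q)"
    using h.hom_mult assms by simp
  show "\<ominus>\<^bsub>UEA L\<^esub> ucls L p = ucls L (- p)"
    using h.hom_a_inv[of p] assms by simp
qed

lemma UEA_zero_one: "\<zero>\<^bsub>UEA L\<^esub> = ucls L 0" "\<one>\<^bsub>UEA L\<^esub> = ucls L 1"
proof -
  interpret I: ideal "env_ideal L" "free_alg L" by (rule ideal_env_ideal[OF L])
  interpret h: ring_hom_ring "free_alg L" "UEA L" "ucls L"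
    unfolding UEA_def ucls_def[abs_def] by (rule I.rcos_ring_hom_ring)
  show "\<zero>\<^bsub>UEA L\<^esub> = ucls L 0" "\<one>\<^bsub>UEA L\<^esub> = ucls L 1"
    using h.hom_zero h.hom_one by simp_all
qed

lemma U_gen_ucls: "U_gen L X = ucls L (gen X)" and U_scalar_ucls: "U_scalar L c = ucls L (scal c)"
  by (simp_all add: U_gen_def U_scalar_def ucls_def)

lemma UEA_finsum:
  assumes "finite A" "\<And>i. i \<in> A \<Longrightarrow> f i \<in> words_over L"
  shows "(\<Oplus>\<^bsub>UEA L\<^esub>i\<in>A. ucls L (f i)) = ucls L (sum f A)"
  using assms
proof (induction A rule: finite_induct)
  case empty
  interpret ring "UEA L" by (rule ring_UEA)
  show ?case by (simp add: UEA_zero_one)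
next
  case (insert i A)
  interpret ring "UEA L" by (rule ring_UEA)
  have "(\<Oplus>\<^bsub>UEA L\<^esub>i\<in>insert i A. ucls L (f i)) = ucls L (f i) \<oplus>\<^bsub>UEA L\<^esub> (\<Oplus>\<^bsub>UEA L\<^esub>i\<in>A. ucls L (f i))"
    using insert by (intro finsum_insert) (auto simp: carrier_UEA)
  then show ?case using insert by (simp add: UEA_ops sum_in_words_over)
qed

end

lemma free_map_env_ideal:
  assumes L: "lie_closed L" and L': "lie_closed L'"
    and \<phi>: "\<And>X. X \<in> L \<Longrightarrow> \<phi> X \<in> L'"
      "\<And>X Y. X \<in> L \<Longrightarrow> Y \<in> L \<Longrightarrow> \<phi> (X + Y) = \<phi> X + \<phi> Y"
      "\<And>X c. X \<in> L \<Longrightarrow> \<phi> (c \<cdot>\<^sub>m X) = c \<cdot>\<^sub>m \<phi> X"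
      "\<And>X Y. X \<in> L \<Longrightarrow> Y \<in> L \<Longrightarrow> \<phi> (X * Y - Y * X) = \<phi> X * \<phi> Y - \<phi> Y * \<phi> X"
    and "p \<in> env_ideal L"
  shows "free_map \<phi> p \<in> env_ideal L'"
proof -
  have "env_ideal L \<subseteq> {p \<in> words_over L. free_map \<phi> p \<in> env_ideal L'}"
  proof (rule env_ideal_least)
    show "env_relations L \<subseteq> {p \<in> words_over L. free_map \<phi> p \<in> env_ideal L'}"
      using L env_ideal_relations[OF L'] \<phi>
      by (auto simp: env_relations_def lie_closed_def free_map_hom free_map_gen free_map_scal)
  qed (use env_ideal_closed[OF L'] free_map_in_words_over[of L \<phi> L', OF \<phi>(1)] in
        \<open>auto simp: free_map_hom\<close>)
  then show ?thesis using assms by blast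
qed

text \<open>All representatives of a class have images that differ by elements of the ideal, so the union that
  defines \<^const>\<open>U_map\<close> is a union of copies of one class.\<close>

lemma U_map_ucls:
  assumes L: "lie_closed L" and L': "lie_closed L'"
    and \<phi>: "\<And>X. X \<in> L \<Longrightarrow> \<phi> X \<in> L'"
      "\<And>X Y. X \<in> L \<Longrightarrow> Y \<in> L \<Longrightarrow> \<phi> (X + Y) = \<phi> X + \<phi> Y"
      "\<And>X c. X \<in> L \<Longrightarrow> \<phi> (c \<cdot>\<^sub>m X) = c \<cdot>\<^sub>m \<phi> X"
      "\<And>X Y. X \<in> L \<Longrightarrow> Y \<in> L \<Longrightarrow> \<phi> (X * Y - Y * X) = \<phi> X * \<phi> Y - \<phi> Y * \<phi> X"
    and p: "p \<in> words_over L"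
  shows "U_map L' \<phi> (ucls L p) = ucls L' (free_map \<phi> p)"
proof -
  have "ucls L' (free_map \<phi> x) = ucls L' (free_map \<phi> p)" if x: "x \<in> ucls L p" for x
  proof -
    obtain i where i: "i \<in> env_ideal L" "x = i + p" using x unfolding ucls_mem by blast
    have "free_map \<phi> i \<in> env_ideal L'" using free_map_env_ideal[OF L L' \<phi> i(1)] by simp
    then show ?thesis
      using i p env_ideal_subset[OF L] free_map_in_words_over[of L \<phi> L', OF \<phi>(1)]
      by (subst ucls_eq_iff[OF L']) (auto simp: free_map_hom)
  qed
  moreover have "p \<in> ucls L p"
    using env_ideal_closed(1)[OF L] by (auto simp: ucls_mem)
  moreover have "U_map L' \<phi> (ucls L p) = (\<Union>x\<in>ucls L p. ucls L' (free_map \<phi> x))"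
    by (simp add: U_map_def ucls_def)
  ultimately show ?thesis by blast
qed

section \<open>A uniform basis of the Lie algebras\<close>

text \<open>The matrices of the Lie algebra are \<open>B \<eta>\<close> with \<open>B\<close> antisymmetric and \<open>\<eta>\<close> the matrix of the form, and
  the antisymmetric matrix units \<open>B\<close> give a basis \<open>L\<^sub>A\<^sub>B\<close> on which all commutators have the same form.
  Matrix indices count from 0, so \<open>H\<close> is \<open>L\<^sub>0\<^sub>3\<close>. The other indices label bases of the two
  nilradicals: \<open>N\<^sub>a = L\<^sub>0\<^sub>a + L\<^sub>a\<^sub>3\<close> for \<open>n\<^sup>-\<close>, and \<open>P\<^sub>a = L\<^sub>0\<^sub>a - L\<^sub>a\<^sub>3\<close> for \<open>n\<^sup>+\<close>, the latter being
  \<open>\<eta>\<^sub>a\<close> times the transpose of \<open>N\<^sub>a\<close>.\<close>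

definition eta :: "nat \<Rightarrow> real" where
  "eta i = (if i < 2 then - 1 else 1)"

definition vidx :: "nat \<Rightarrow> nat set" where
  "vidx m = {1, 2} \<union> {4..m}"

definition Lmat :: "nat \<Rightarrow> nat \<Rightarrow> nat \<Rightarrow> real mat" where
  "Lmat m A B = mat (m + 1) (m + 1)
     (\<lambda>(i, j). (if i = A \<and> j = B then eta B else 0) - (if i = B \<and> j = A then eta A else 0))"

definition Nmat :: "nat \<Rightarrow> nat \<Rightarrow> real mat" where
  "Nmat m a = Lmat m 0 a + Lmat m a 3"

definition Pmat :: "nat \<Rightarrow> nat \<Rightarrow> real mat" where
  "Pmat m a = Lmat m 0 a - Lmat m a 3"

lemma eta_square [simp]: "eta i * eta i = 1" "eta i * (eta i * x) = x"
  by (simp_all add: eta_def)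

lemma finite_vidx [simp]: "finite (vidx m)"
  by (simp add: vidx_def)

lemma vidx_props: "a \<in> vidx m \<Longrightarrow> a \<noteq> 0 \<and> a \<noteq> 3 \<and> a \<noteq> Suc (Suc (Suc 0))"
  by (auto simp: vidx_def)

lemma vidx_le: "m \<ge> 4 \<Longrightarrow> a \<in> vidx m \<Longrightarrow> a \<le> m"
  by (auto simp: vidx_def)

lemma index_cases: "A \<le> m \<Longrightarrow> A = 0 \<or> A = 3 \<or> A \<in> vidx m"
  by (auto simp: vidx_def)

lemma carriers [simp, intro]:
  "Lmat m A B \<in> carrier_mat (m + 1) (m + 1)" "Lmat m A B \<in> carrier_mat (Suc m) (Suc m)"
  "Nmat m a \<in> carrier_mat (m + 1) (m + 1)" "Nmat m a \<in> carrier_mat (Suc m) (Suc m)"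
  "Pmat m a \<in> carrier_mat (m + 1) (m + 1)" "Pmat m a \<in> carrier_mat (Suc m) (Suc m)"
  by (auto simp: Lmat_def Nmat_def Pmat_def)

lemma dim_simps [simp]:
  "dim_row (Emat m a b) = Suc m" "dim_col (Emat m a b) = Suc m"
  "dim_row (Lmat m A B) = Suc m" "dim_col (Lmat m A B) = Suc m"
  "dim_row (Nmat m a) = Suc m" "dim_col (Nmat m a) = Suc m"
  "dim_row (Pmat m a) = Suc m" "dim_col (Pmat m a) = Suc m"
  by (simp_all add: Emat_def Lmat_def Nmat_def Pmat_def)

lemma Lmat_entry:
  "i \<le> m \<Longrightarrow> j \<le> m \<Longrightarrow> Lmat m A B $$ (i, j) =
    (if i = A \<and> j = B then eta B else 0) - (if i = B \<and> j = A then eta A else 0)"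
  by (simp add: Lmat_def)

lemma Nmat_entry:
  "a \<in> vidx m \<Longrightarrow> i \<le> m \<Longrightarrow> j \<le> m \<Longrightarrow> Nmat m a $$ (i, j) =
    (if i = a \<and> (j = 0 \<or> j = 3) then 1 else 0)
    + (if j = a \<and> i = 0 then eta a else 0) - (if j = a \<and> i = 3 then eta a else 0)"
  by (auto simp: Nmat_def Lmat_def eta_def dest: vidx_props)

lemma mat_mult_entry:
  fixes X Y :: "real mat"
  assumes "X \<in> carrier_mat k k" "Y \<in> carrier_mat k k" "i < k" "j < k"
  shows "(X * Y) $$ (i, j) = (\<Sum>l<k. X $$ (i, l) * Y $$ (l, j))"
  using assms by (auto simp: scalar_prod_def atLeast0LessThan intro!: sum.cong)

lemma lie_g_iff:
  "X \<in> lie_g m \<longleftrightarrow> X \<in> carrier_mat (m + 1) (m + 1)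
     \<and> (\<forall>i\<le>m. \<forall>j\<le>m. eta i * X $$ (i, j) + eta j * X $$ (j, i) = 0)"
proof -
  have "transpose_mat X * form m + form m * X = 0\<^sub>m (m + 1) (m + 1) \<longleftrightarrow>
     (\<forall>i\<le>m. \<forall>j\<le>m. eta i * X $$ (i, j) + eta j * X $$ (j, i) = 0)"
    if X: "X \<in> carrier_mat (m + 1) (m + 1)"
  proof -
    have f: "form m \<in> carrier_mat (m + 1) (m + 1)" by (simp add: form_def)
    have "(transpose_mat X * form m + form m * X) $$ (i, j)
        = eta i * X $$ (i, j) + eta j * X $$ (j, i)" if ij: "i \<le> m" "j \<le> m" for i j
    proof -
      have "(transpose_mat X * form m) $$ (i, j)
          = (\<Sum>l<m + 1. transpose_mat X $$ (i, l) * form m $$ (l, j))"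
        using X f ij by (intro mat_mult_entry) auto
      also have "\<dots> = (\<Sum>l<m + 1. if l = j then X $$ (j, i) * eta j else 0)"
        using X ij by (intro sum.cong) (auto simp: form_def eta_def)
      also have "\<dots> = eta j * X $$ (j, i)" using ij by (simp add: mult.commute)
      finally have 1: "(transpose_mat X * form m) $$ (i, j) = eta j * X $$ (j, i)" .
      have "(form m * X) $$ (i, j) = (\<Sum>l<m + 1. form m $$ (i, l) * X $$ (l, j))"
        using X f ij by (intro mat_mult_entry) auto
      also have "\<dots> = (\<Sum>l<m + 1. if l = i then eta i * X $$ (i, j) else 0)"
        using X ij by (intro sum.cong) (auto simp: form_def eta_def)
      also have "\<dots> = eta i * X $$ (i, j)" using ij by simp
      finally have 2: "(form m * X) $$ (i, j) = eta i * X $$ (i, j)" .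
      have "(transpose_mat X * form m + form m * X) $$ (i, j)
          = (transpose_mat X * form m) $$ (i, j) + (form m * X) $$ (i, j)"
        using X f ij by (intro index_add_mat) auto
      then show ?thesis using 1 2 by simp
    qed
    then show ?thesis using X f by (auto simp: mat_eq_iff form_def)
  qed
  then show ?thesis by (auto simp: lie_g_def)
qed

lemma lie_g_carrier: "X \<in> lie_g m \<Longrightarrow> X \<in> carrier_mat (m + 1) (m + 1)"
  by (simp add: lie_g_iff)

lemma lie_g_flip: "X \<in> lie_g m \<Longrightarrow> i \<le> m \<Longrightarrow> j \<le> m \<Longrightarrow> eta i * X $$ (i, j) = - (eta j * X $$ (j, i))"
  by (simp add: lie_g_iff eq_neg_iff_add_eq_0)

text \<open>With respect to the form the adjoint of \<open>X\<close> is \<open>- X\<close>, so the adjoint of \<open>X Y\<close> is \<open>Y X\<close>.\<close>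

lemma lie_g_product_flip:
  assumes X: "X \<in> lie_g m" and Y: "Y \<in> lie_g m" and ij: "i \<le> m" "j \<le> m"
  shows "eta i * (X * Y) $$ (i, j) = eta j * (Y * X) $$ (j, i)"
proof -
  have c: "X \<in> carrier_mat (m + 1) (m + 1)" "Y \<in> carrier_mat (m + 1) (m + 1)"
    using X Y by (simp_all add: lie_g_iff)
  have "eta i * (X $$ (i, l) * Y $$ (l, j)) = eta j * (Y $$ (j, l) * X $$ (l, i))" if "l \<le> m" for l
  proof -
    have "eta i * (X $$ (i, l) * Y $$ (l, j)) = eta i * X $$ (i, l) * (eta l * (eta l * Y $$ (l, j)))"
      by simp
    also have "\<dots> = eta l * X $$ (l, i) * (eta l * (eta j * Y $$ (j, l)))"
      using lie_g_flip[OF X ij(1) that] lie_g_flip[OF Y that ij(2)] by simp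
    also have "\<dots> = (eta l * eta l) * (eta j * (Y $$ (j, l) * X $$ (l, i)))" by (simp only: mult_ac)
    finally show ?thesis by simp
  qed
  moreover have "(X * Y) $$ (i, j) = (\<Sum>l<m + 1. X $$ (i, l) * Y $$ (l, j))"
    "(Y * X) $$ (j, i) = (\<Sum>l<m + 1. Y $$ (j, l) * X $$ (l, i))"
    by (rule mat_mult_entry; use c ij in simp)+
  ultimately show ?thesis
    by (simp only: sum_distrib_left) (auto intro: sum.cong)
qed

lemma lie_closed_lie_g: "lie_closed (lie_g m)"
  unfolding lie_closed_def
proof (intro conjI ballI allI)
  fix X Y assume X: "X \<in> lie_g m" and Y: "Y \<in> lie_g m"
  have c: "X \<in> carrier_mat (m + 1) (m + 1)" "Y \<in> carrier_mat (m + 1) (m + 1)"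
    using X Y by (simp_all add: lie_g_iff)
  have "eta i * (X $$ (i, j) + Y $$ (i, j)) + eta j * (X $$ (j, i) + Y $$ (j, i)) = 0"
    if "i \<le> m" "j \<le> m" for i j
    using lie_g_flip[OF X that] lie_g_flip[OF Y that] by (simp only: distrib_left)
  then show "X + Y \<in> lie_g m"
    unfolding lie_g_iff using c by auto
  have "eta i * (X * Y - Y * X) $$ (i, j) + eta j * (X * Y - Y * X) $$ (j, i) = 0"
    if ij: "i \<le> m" "j \<le> m" for i j
    using c ij lie_g_product_flip[OF X Y ij] lie_g_product_flip[OF Y X ij]
    by (simp add: right_diff_distrib)
  then show "X * Y - Y * X \<in> lie_g m"
    unfolding lie_g_iff using c by auto
next
  fix X and c :: real assume X: "X \<in> lie_g m"
  have "eta i * (c * X $$ (i, j)) + eta j * (c * X $$ (j, i)) = 0" if "i \<le> m" "j \<le> m" for i j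
    using lie_g_flip[OF X that] by (simp only: mult.left_commute[of _ c])
  then show "c \<cdot>\<^sub>m X \<in> lie_g m"
    unfolding lie_g_iff using lie_g_carrier[OF X] by auto
qed

lemma Lmat_lie_g: "Lmat m A B \<in> lie_g m"
  unfolding lie_g_iff
proof (intro conjI allI impI)
  fix i j assume "i \<le> m" "j \<le> m"
  then show "eta i * Lmat m A B $$ (i, j) + eta j * Lmat m A B $$ (j, i) = 0"
    by (cases "i = A"; cases "j = B"; cases "i = B"; cases "j = A") (simp_all add: Lmat_entry)
qed simp

lemma lie_g_add: "X \<in> lie_g m \<Longrightarrow> Y \<in> lie_g m \<Longrightarrow> X + Y \<in> lie_g m"
  and lie_g_smult: "X \<in> lie_g m \<Longrightarrow> c \<cdot>\<^sub>m X \<in> lie_g m"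
  and lie_g_bracket: "X \<in> lie_g m \<Longrightarrow> Y \<in> lie_g m \<Longrightarrow> X * Y - Y * X \<in> lie_g m"
  using lie_closed_lie_g[of m] by (auto simp: lie_closed_def)

lemma lie_g_diff: "X \<in> lie_g m \<Longrightarrow> Y \<in> lie_g m \<Longrightarrow> X - Y \<in> lie_g m"
proof -
  assume X: "X \<in> lie_g m" and Y: "Y \<in> lie_g m"
  have "X - Y = X + (- 1) \<cdot>\<^sub>m Y"
    using lie_g_carrier[OF X] lie_g_carrier[OF Y] by (intro eq_matI) auto
  then show ?thesis using lie_g_add[OF X lie_g_smult[OF Y]] by simp
qed

lemma zero_lie_g: "0\<^sub>m (m + 1) (m + 1) \<in> lie_g m"
  by (auto simp: lie_g_iff)


section \<open>Real spans\<close>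

lemma real_span_induct_closed:
  assumes "X \<in> real_span m S"
    and "P (0\<^sub>m (m + 1) (m + 1))"
    and "\<And>X Y. P X \<Longrightarrow> P Y \<Longrightarrow> P (X + Y)" "\<And>c X. P X \<Longrightarrow> P (c \<cdot>\<^sub>m X)" "\<And>X. X \<in> S \<Longrightarrow> P X"
  shows "P X"
  using assms(1) by induction (use assms in auto)

lemma real_span_carrier:
  fixes S :: "real mat set"
  assumes "X \<in> real_span m S" "S \<subseteq> carrier_mat (m + 1) (m + 1)"
  shows "X \<in> carrier_mat (m + 1) (m + 1)"
  using assms(1) by (rule real_span_induct_closed) (use assms(2) in auto)

context
  fixes m and S :: "real mat set" assumes S: "S \<subseteq> carrier_mat (m + 1) (m + 1)"
begin

lemma real_span_base: "X \<in> S \<Longrightarrow> X \<in> real_span m S"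
proof -
  assume X: "X \<in> S"
  then have "1 \<cdot>\<^sub>m X + 0\<^sub>m (m + 1) (m + 1) = X" using S by (intro eq_matI) auto
  moreover have "1 \<cdot>\<^sub>m X + 0\<^sub>m (m + 1) (m + 1) \<in> real_span m S"
    by (rule real_span.add[OF X real_span.zero])
  ultimately show ?thesis by simp
qed

lemma real_span_add: "X \<in> real_span m S \<Longrightarrow> Y \<in> real_span m S \<Longrightarrow> X + Y \<in> real_span m S"
proof (induction rule: real_span.induct)
  case zero
  then show ?case using real_span_carrier[OF zero S] by simp
next
  case (add X Z c)
  have "c \<cdot>\<^sub>m X + (Z + Y) \<in> real_span m S" using add by (blast intro: real_span.add)
  moreover have "c \<cdot>\<^sub>m X + (Z + Y) = c \<cdot>\<^sub>m X + Z + Y"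
    using add real_span_carrier[OF _ S] S by (intro assoc_add_mat[symmetric]) auto
  ultimately show ?case by simp
qed

lemma real_span_smult: "X \<in> real_span m S \<Longrightarrow> c \<cdot>\<^sub>m X \<in> real_span m S"
proof (induction rule: real_span.induct)
  case zero
  then show ?case using real_span.zero by simp
next
  case (add X Z d)
  have "(c * d) \<cdot>\<^sub>m X + c \<cdot>\<^sub>m Z \<in> real_span m S" using add by (blast intro: real_span.add)
  moreover have "c \<cdot>\<^sub>m (d \<cdot>\<^sub>m X + Z) = (c * d) \<cdot>\<^sub>m X + c \<cdot>\<^sub>m Z"
    using add(1) real_span_carrier[OF add(2) S] S
    by (intro eq_matI) (auto simp: algebra_simps)
  ultimately show ?case by simp
qed

lemma real_span_sum:
  assumes "finite F" "\<And>k. k \<in> F \<Longrightarrow> f k \<in> S"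
  shows "mat (m + 1) (m + 1) (\<lambda>(i, j). \<Sum>k\<in>F. c k * f k $$ (i, j)) \<in> real_span m S"
  using assms
proof (induction F rule: finite_induct)
  case empty
  have "mat (m + 1) (m + 1) (\<lambda>(i, j). \<Sum>k\<in>{}. c k * f k $$ (i, j)) = 0\<^sub>m (m + 1) (m + 1)"
    by auto
  then show ?case using real_span.zero by metis
next
  case (insert k F)
  have "mat (m + 1) (m + 1) (\<lambda>(i, j). \<Sum>k\<in>insert k F. c k * f k $$ (i, j))
      = c k \<cdot>\<^sub>m f k + mat (m + 1) (m + 1) (\<lambda>(i, j). \<Sum>k\<in>F. c k * f k $$ (i, j))"
    using insert(1,2) insert(4)[of k] S by (intro eq_matI) auto
  moreover have IH: "mat (m + 1) (m + 1) (\<lambda>(i, j). \<Sum>k\<in>F. c k * f k $$ (i, j)) \<in> real_span m S"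
    using insert by blast
  have "c k \<cdot>\<^sub>m f k + mat (m + 1) (m + 1) (\<lambda>(i, j). \<Sum>k\<in>F. c k * f k $$ (i, j)) \<in> real_span m S"
    by (rule real_span.add[OF _ IH]) (use insert in blast)
  ultimately show ?case by (simp only:)
qed

end

text \<open>The coefficient of \<open>L\<^sub>A\<^sub>B\<close> is half of \<open>\<eta>\<^sub>B X\<^sub>A\<^sub>B\<close> because the sum runs over ordered pairs and meets every
  basis element twice.\<close>

lemma lie_g_span: "X \<in> lie_g m \<Longrightarrow> X \<in> real_span m {Lmat m A B | A B. A \<le> m \<and> B \<le> m}"
proof -
  assume X: "X \<in> lie_g m"
  let ?F = "{..m} \<times> {..m}"
  let ?c = "\<lambda>(A, B). eta B * X $$ (A, B) / 2"
  have entry: "(\<Sum>k\<in>?F. ?c k * Lmat m (fst k) (snd k) $$ (i, j)) = X $$ (i, j)"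
    if ij: "i \<le> m" "j \<le> m" for i j
  proof -
    have "(\<Sum>k\<in>?F. ?c k * Lmat m (fst k) (snd k) $$ (i, j))
      = (\<Sum>k\<in>?F. (if k = (i, j) then X $$ (i, j) / 2 else 0)
           - (if k = (j, i) then eta i * eta j * X $$ (j, i) / 2 else 0))"
    proof (intro sum.cong refl)
      fix k assume "k \<in> ?F"
      obtain A B where k: "k = (A, B)" by (cases k)
      show "?c k * Lmat m (fst k) (snd k) $$ (i, j) = (if k = (i, j) then X $$ (i, j) / 2 else 0)
           - (if k = (j, i) then eta i * eta j * X $$ (j, i) / 2 else 0)"
        unfolding k fst_conv snd_conv prod.case Lmat_entry[OF ij] prod.inject
        unfolding right_diff_distrib by (rule arg_cong2[where f = "(-)"]) auto
    qed
    also have "\<dots> = X $$ (i, j) / 2 - eta i * eta j * X $$ (j, i) / 2"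
      using ij by (simp add: sum_subtractf)
    also have "eta i * eta j * X $$ (j, i) = eta i * (- (eta i * X $$ (i, j)))"
      using lie_g_flip[OF X ij(2) ij(1)] by (simp add: mult.assoc)
    finally show ?thesis by simp
  qed
  have "mat (m + 1) (m + 1) (\<lambda>(i, j). \<Sum>k\<in>?F. ?c k * Lmat m (fst k) (snd k) $$ (i, j)) = X"
    using lie_g_carrier[OF X] by (intro eq_matI) (auto simp: entry)
  moreover have "mat (m + 1) (m + 1) (\<lambda>(i, j). \<Sum>k\<in>?F. ?c k * Lmat m (fst k) (snd k) $$ (i, j))
      \<in> real_span m {Lmat m A B | A B. A \<le> m \<and> B \<le> m}"
  proof (rule real_span_sum)
    fix k assume "k \<in> ?F"
    then have "fst k \<le> m" "snd k \<le> m" by auto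
    then show "Lmat m (fst k) (snd k) \<in> {Lmat m A B | A B. A \<le> m \<and> B \<le> m}" by blast
  qed auto
  ultimately show ?thesis by simp
qed

section \<open>The subalgebras in terms of the uniform basis\<close>

text \<open>In terms of \<^const>\<open>of_bool\<close> the entries of all matrices below are polynomial expressions, so that
  the identities between them are ring identities and need no case distinctions.\<close>

lemma Emat_entry:
  "i \<le> m \<Longrightarrow> j \<le> m \<Longrightarrow> a \<ge> 1 \<Longrightarrow> b \<ge> 1 \<Longrightarrow>
    Emat m a b $$ (i, j) = of_bool (i = a - 1) * of_bool (j = b - 1)"
  by (auto simp: Emat_def)

lemma Lmat_entry_of_bool:
  "i \<le> m \<Longrightarrow> j \<le> m \<Longrightarrow> Lmat m A B $$ (i, j) =
    eta B * of_bool (i = A) * of_bool (j = B) - eta A * of_bool (i = B) * of_bool (j = A)"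
  unfolding Lmat_entry by (rule arg_cong2[where f = "(-)"]) auto

lemmas entry_simps = Emat_entry Lmat_entry_of_bool eta_def algebra_simps

lemma Hmat_L: "m \<ge> 4 \<Longrightarrow> Hmat m = Lmat m 0 3"
  by (rule eq_matI) (simp_all add: Hmat_def entry_simps)

lemma H2_L: "m \<ge> 4 \<Longrightarrow> H2 m = Lmat m 1 2"
  by (rule eq_matI) (simp_all add: H2_def entry_simps)

lemma Q1_minus_N: "m \<ge> 4 \<Longrightarrow> Q1_minus m = Nmat m 1"
  by (rule eq_matI) (simp_all add: Q1_minus_def Nmat_def entry_simps)

lemma Q2_minus_N: "m \<ge> 4 \<Longrightarrow> Q2_minus m = Nmat m 2"
  by (rule eq_matI) (simp_all add: Q2_minus_def Nmat_def entry_simps)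

lemma Q1_plus_P: "m \<ge> 4 \<Longrightarrow> Q1_plus m = (- 1) \<cdot>\<^sub>m Pmat m 1"
  by (rule eq_matI) (simp_all add: Q1_plus_def Q1_minus_def Pmat_def entry_simps)

lemma Q2_plus_P: "m \<ge> 4 \<Longrightarrow> Q2_plus m = Pmat m 2"
  by (rule eq_matI) (simp_all add: Q2_plus_def Q2_minus_def Pmat_def entry_simps)

lemma Y_minus_N: "m \<ge> 4 \<Longrightarrow> Y_minus m j = Nmat m (3 + j)"
  if "j \<in> {1..m - 3}"
  using that by - (rule eq_matI; simp add: Y_minus_def Nmat_def entry_simps)

lemma Y_plus_P: "m \<ge> 4 \<Longrightarrow> Y_plus m j = Pmat m (3 + j)"
  if "j \<in> {1..m - 3}"
  using that by - (rule eq_matI; simp add: Y_plus_def Y_minus_def Pmat_def entry_simps)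

lemma Z_plus_L: "m \<ge> 4 \<Longrightarrow> Z_plus m j = Lmat m 1 (3 + j) + Lmat m 2 (3 + j)"
  if "j \<in> {1..m - 3}"
  using that by - (rule eq_matI; simp add: Z_plus_def entry_simps)

lemma Z_minus_L: "m \<ge> 4 \<Longrightarrow> Z_minus m j = Lmat m 1 (3 + j) - Lmat m 2 (3 + j)"
  if "j \<in> {1..m - 3}"
  using that by - (rule eq_matI; simp add: Z_minus_def Z_plus_def entry_simps)

lemma Mmat_L: "m \<ge> 4 \<Longrightarrow> Mmat m i j = Lmat m (3 + i) (3 + j)"
  if "i \<in> {1..m - 3}" "j \<in> {1..m - 3}"
  using that by - (rule eq_matI; simp add: Mmat_def entry_simps)

lemma vidx_image: "m \<ge> 4 \<Longrightarrow> f ` vidx m = {f 1, f 2} \<union> (\<lambda>j. f (3 + j)) ` {1..m - 3}"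
proof -
  assume "m \<ge> 4"
  then have "{4..m} = (+) 3 ` {1..m - 3}"
    by (subst image_add_atLeastAtMost) simp
  then show ?thesis unfolding vidx_def by (simp only: image_Un image_image image_insert image_empty)
qed

lemma n_minus_N: "m \<ge> 4 \<Longrightarrow> n_minus m = real_span m (Nmat m ` vidx m)"
proof -
  assume m: "m \<ge> 4"
  have "Y_minus m ` {1..m - 3} = (\<lambda>j. Nmat m (3 + j)) ` {1..m - 3}"
    using Y_minus_N[OF _ m] by (intro image_cong) auto
  then show ?thesis
    unfolding n_minus_def vidx_image[OF m] Q1_minus_N[OF m] Q2_minus_N[OF m] by simp
qed

lemma vidx_cases: "m \<ge> 4 \<Longrightarrow> a \<in> vidx m \<Longrightarrow> a = 1 \<or> a = 2 \<or> (\<exists>j\<in>{1..m - 3}. a = 3 + j)"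
  unfolding vidx_def by (auto intro!: bexI[of _ "a - 3"])

lemma Lmat_flip: "Lmat m B A = (- 1) \<cdot>\<^sub>m Lmat m A B"
  by (rule eq_matI) (simp_all add: Lmat_entry_of_bool)

lemma Lmat_same: "Lmat m A A = 0\<^sub>m (m + 1) (m + 1)"
  by (rule eq_matI) (simp_all add: Lmat_entry_of_bool)

lemma n_minus_carrier: "m \<ge> 4 \<Longrightarrow> X \<in> n_minus m \<Longrightarrow> X \<in> carrier_mat (m + 1) (m + 1)"
  unfolding n_minus_N by (rule real_span_carrier) auto

context
  fixes m :: nat assumes m: "m \<ge> 4"
begin

abbreviation (input) "gens_m \<equiv> {H2 m} \<union> Z_plus m ` {1..m - 3} \<union> Z_minus m ` {1..m - 3}
      \<union> (\<lambda>(i, j). Mmat m i j) ` ({1..m - 3} \<times> {1..m - 3})"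
abbreviation (input) "gens_p \<equiv> {Q1_plus m, Q2_plus m} \<union> Y_plus m ` {1..m - 3}"

lemma gens_m_carrier: "gens_m \<subseteq> carrier_mat (m + 1) (m + 1)"
  by (auto simp: H2_def Z_plus_def Z_minus_def Mmat_def Emat_def)

lemma gens_p_carrier: "gens_p \<subseteq> carrier_mat (m + 1) (m + 1)"
  by (auto simp: Q1_plus_def Q2_plus_def Y_plus_def Q1_minus_def Q2_minus_def Y_minus_def Emat_def)

lemmas lie_m_closed =
  real_span_base[OF gens_m_carrier, folded lie_m_def]
  real_span_add[OF gens_m_carrier, folded lie_m_def]
  real_span_smult[OF gens_m_carrier, folded lie_m_def]
  real_span.zero[of m gens_m, folded lie_m_def]

lemmas n_plus_closed =
  real_span_base[OF gens_p_carrier, folded n_plus_def]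
  real_span_add[OF gens_p_carrier, folded n_plus_def]
  real_span_smult[OF gens_p_carrier, folded n_plus_def]
  real_span.zero[of m gens_p, folded n_plus_def]

lemma lie_m_carrier: "X \<in> lie_m m \<Longrightarrow> X \<in> carrier_mat (m + 1) (m + 1)"
  unfolding lie_m_def by (rule real_span_carrier[OF _ gens_m_carrier])

lemma n_plus_carrier: "X \<in> n_plus m \<Longrightarrow> X \<in> carrier_mat (m + 1) (m + 1)"
  unfolding n_plus_def by (rule real_span_carrier[OF _ gens_p_carrier])

lemma Hmat_carrier: "Hmat m \<in> carrier_mat (m + 1) (m + 1)"
  by (simp add: Hmat_def Emat_def)

lemma Pmat_n_plus: "a \<in> vidx m \<Longrightarrow> Pmat m a \<in> n_plus m"
proof -
  assume a: "a \<in> vidx m"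
  have "Pmat m 1 = (- 1) \<cdot>\<^sub>m Q1_plus m"
    unfolding Q1_plus_P[OF m] by (rule eq_matI) (auto simp: Pmat_def)
  then have "Pmat m 1 \<in> n_plus m" by (auto intro!: n_plus_closed)
  moreover have "Pmat m 2 \<in> n_plus m"
    unfolding Q2_plus_P[OF m, symmetric] by (rule n_plus_closed(1)) simp
  moreover have "Pmat m (3 + j) \<in> n_plus m" if "j \<in> {1..m - 3}" for j
    unfolding Y_plus_P[OF that m, symmetric] using that by (intro n_plus_closed(1)) blast
  ultimately show ?thesis
    using vidx_cases[OF m a] by blast
qed

lemma Lmat_lie_m: "a \<in> vidx m \<Longrightarrow> b \<in> vidx m \<Longrightarrow> Lmat m a b \<in> lie_m m"
proof -
  have flip: "Lmat m b a \<in> lie_m m" if "Lmat m a b \<in> lie_m m" for a b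
    using lie_m_closed(3)[OF that, of "- 1"] Lmat_flip[of m b a] by simp
  have Z: "Z_plus m j \<in> lie_m m" "Z_minus m j \<in> lie_m m" if "j \<in> {1..m - 3}" for j
    using that by (auto intro!: lie_m_closed(1))
  have L1: "Lmat m 1 (3 + j) \<in> lie_m m" and L2: "Lmat m 2 (3 + j) \<in> lie_m m"
    if j: "j \<in> {1..m - 3}" for j
  proof -
    have "Lmat m 1 (3 + j) = (1/2) \<cdot>\<^sub>m (Z_plus m j + Z_minus m j)"
      unfolding Z_plus_L[OF j m] Z_minus_L[OF j m] by (rule eq_matI) auto
    then show "Lmat m 1 (3 + j) \<in> lie_m m" using Z[OF j] by (auto intro!: lie_m_closed(2,3))
    have "Lmat m 2 (3 + j) = (1/2) \<cdot>\<^sub>m (Z_plus m j + (- 1) \<cdot>\<^sub>m Z_minus m j)"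
      unfolding Z_plus_L[OF j m] Z_minus_L[OF j m] by (rule eq_matI) auto
    then show "Lmat m 2 (3 + j) \<in> lie_m m" using Z[OF j] by (auto intro!: lie_m_closed(2,3))
  qed
  have M: "Lmat m (3 + i) (3 + j) \<in> lie_m m" if "i \<in> {1..m - 3}" "j \<in> {1..m - 3}" for i j
  proof -
    have "Mmat m i j \<in> gens_m" using that by (intro UnI2 image_eqI[of _ _ "(i, j)"]) auto
    then show ?thesis using lie_m_closed(1) Mmat_L[OF that m] by simp
  qed
  have H: "Lmat m 1 2 \<in> lie_m m" using lie_m_closed(1)[of "H2 m"] H2_L[OF m] by simp
  have same: "Lmat m a a \<in> lie_m m" for a using lie_m_closed(4) by (simp add: Lmat_same)
  assume "a \<in> vidx m" "b \<in> vidx m"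
  then show ?thesis
    using vidx_cases[OF m, of a] vidx_cases[OF m, of b] same H flip[OF H] L1 L2 M
      flip[OF L1] flip[OF L2] by blast
qed

lemma parabolic_closed:
  "X \<in> parabolic m \<Longrightarrow> Y \<in> parabolic m \<Longrightarrow> X + Y \<in> parabolic m"
  "X \<in> parabolic m \<Longrightarrow> c \<cdot>\<^sub>m X \<in> parabolic m"
  "X \<in> lie_m m \<Longrightarrow> X \<in> parabolic m" "X \<in> n_plus m \<Longrightarrow> X \<in> parabolic m" "Hmat m \<in> parabolic m"
  "0\<^sub>m (m + 1) (m + 1) \<in> parabolic m"
proof -
  note c = lie_m_carrier n_plus_carrier Hmat_carrier
  have I: "A + t \<cdot>\<^sub>m Hmat m + B \<in> parabolic m" if "A \<in> lie_m m" "B \<in> n_plus m" for A t B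
    using that by (auto simp: parabolic_def)
  show "X + Y \<in> parabolic m" if X: "X \<in> parabolic m" and Y: "Y \<in> parabolic m" for X Y
  proof -
    obtain A t B where 1: "X = A + t \<cdot>\<^sub>m Hmat m + B" "A \<in> lie_m m" "B \<in> n_plus m"
      using X by (auto simp: parabolic_def)
    obtain A' t' B' where 2: "Y = A' + t' \<cdot>\<^sub>m Hmat m + B'" "A' \<in> lie_m m" "B' \<in> n_plus m"
      using Y by (auto simp: parabolic_def)
    have "X + Y = (A + A') + (t + t') \<cdot>\<^sub>m Hmat m + (B + B')"
      unfolding 1 2 using c(1)[OF 1(2)] c(1)[OF 2(2)] c(2)[OF 1(3)] c(2)[OF 2(3)] c(3)
      by (intro eq_matI) (auto simp: algebra_simps)
    then show ?thesis using I 1 2 lie_m_closed n_plus_closed by simp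
  qed
  show "c \<cdot>\<^sub>m X \<in> parabolic m" if X: "X \<in> parabolic m" for c X
  proof -
    obtain A t B where 1: "X = A + t \<cdot>\<^sub>m Hmat m + B" "A \<in> lie_m m" "B \<in> n_plus m"
      using X by (auto simp: parabolic_def)
    have "c \<cdot>\<^sub>m X = c \<cdot>\<^sub>m A + (c * t) \<cdot>\<^sub>m Hmat m + c \<cdot>\<^sub>m B"
      unfolding 1 using c(1)[OF 1(2)] c(2)[OF 1(3)] c(3)
      by (intro eq_matI) (auto simp: algebra_simps)
    then show ?thesis using I 1 lie_m_closed n_plus_closed by simp
  qed
  show "X \<in> parabolic m" if "X \<in> lie_m m" for X
  proof -
    have "X = X + 0 \<cdot>\<^sub>m Hmat m + 0\<^sub>m (m + 1) (m + 1)"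
      using c(1)[OF that] c(3) by (intro eq_matI) auto
    then show ?thesis using I[OF that n_plus_closed(4)] by metis
  qed
  show "X \<in> parabolic m" if "X \<in> n_plus m" for X
  proof -
    have "X = 0\<^sub>m (m + 1) (m + 1) + 0 \<cdot>\<^sub>m Hmat m + X"
      using c(2)[OF that] c(3) by (intro eq_matI) auto
    then show ?thesis using I[OF lie_m_closed(4) that] by metis
  qed
  then show "0\<^sub>m (m + 1) (m + 1) \<in> parabolic m" using n_plus_closed(4) by blast
  have "Hmat m = 0\<^sub>m (m + 1) (m + 1) + 1 \<cdot>\<^sub>m Hmat m + 0\<^sub>m (m + 1) (m + 1)"
    using c(3) by (intro eq_matI) auto
  then show "Hmat m \<in> parabolic m" using I[OF lie_m_closed(4) n_plus_closed(4)] by metis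
qed

text \<open>The generators of \<open>m\<close> and \<open>n\<^sup>+\<close> are combinations of the matrices in the last three cases, so linear
  conditions on the parabolic subalgebra need to be checked only there.\<close>

lemma parabolic_induct [consumes 1, case_names zero add smult L H P]:
  assumes X: "X \<in> parabolic m" and zero: "Q (0\<^sub>m (m + 1) (m + 1))"
    and add: "\<And>X Y. Q X \<Longrightarrow> Q Y \<Longrightarrow> Q (X + Y)" and smult: "\<And>c X. Q X \<Longrightarrow> Q (c \<cdot>\<^sub>m X)"
    and L: "\<And>a b. a \<in> vidx m \<Longrightarrow> b \<in> vidx m \<Longrightarrow> Q (Lmat m a b)"
    and H: "Q (Lmat m 0 3)" and P: "\<And>a. a \<in> vidx m \<Longrightarrow> Q (Pmat m a)"
  shows "Q X"
proof -
  have v: "1 \<in> vidx m" "2 \<in> vidx m" "j \<in> {1..m - 3} \<Longrightarrow> 3 + j \<in> vidx m" for j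
    using m by (auto simp: vidx_def)
  have gm: "Q X" if "X \<in> gens_m" for X
  proof -
    from that consider "X = H2 m" | j where "j \<in> {1..m - 3}" "X = Z_plus m j"
      | j where "j \<in> {1..m - 3}" "X = Z_minus m j"
      | i j where "i \<in> {1..m - 3}" "j \<in> {1..m - 3}" "X = Mmat m i j" by auto
    then show ?thesis
    proof cases
      case 1 then show ?thesis using L v by (simp add: H2_L[OF m])
    next
      case 2 then show ?thesis unfolding 2(2) Z_plus_L[OF 2(1) m] by (intro add L v)
    next
      case 3
      have "Lmat m 1 (3 + j) - Lmat m 2 (3 + j) = Lmat m 1 (3 + j) + (- 1) \<cdot>\<^sub>m Lmat m 2 (3 + j)"
        by (rule eq_matI) auto
      moreover have "Q (Lmat m 1 (3 + j) + (- 1) \<cdot>\<^sub>m Lmat m 2 (3 + j))"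
        by (intro add smult L v 3)
      ultimately show ?thesis unfolding 3(2) Z_minus_L[OF 3(1) m] by simp
    next
      case 4 then show ?thesis unfolding 4(3) Mmat_L[OF 4(1,2) m] by (intro L v)
    qed
  qed
  have gp: "Q X" if "X \<in> gens_p" for X
  proof -
    from that consider "X = Q1_plus m" | "X = Q2_plus m" | j where "j \<in> {1..m - 3}" "X = Y_plus m j"
      by auto
    then show ?thesis
    proof cases
      case 1 then show ?thesis unfolding 1 Q1_plus_P[OF m] by (intro smult P v)
    next
      case 2 then show ?thesis unfolding 2 Q2_plus_P[OF m] by (intro P v)
    next
      case 3 then show ?thesis unfolding 3(2) Y_plus_P[OF 3(1) m] by (intro P v)
    qed
  qed
  have lm: "Q A" if "A \<in> lie_m m" for A
    using that unfolding lie_m_def by (rule real_span_induct_closed) (fact zero, fact add, fact smult, rule gm)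
  have np: "Q B" if "B \<in> n_plus m" for B
    using that unfolding n_plus_def by (rule real_span_induct_closed) (fact zero, fact add, fact smult, rule gp)
  obtain A t B where X: "X = A + t \<cdot>\<^sub>m Hmat m + B" "A \<in> lie_m m" "B \<in> n_plus m"
    using X by (auto simp: parabolic_def)
  show ?thesis unfolding X(1) Hmat_L[OF m] by (intro add smult H lm np X)
qed

lemma Pmat_lie_g: "Pmat m a \<in> lie_g m"
  unfolding Pmat_def by (intro lie_g_diff Lmat_lie_g)

lemma parabolic_lie_g: "X \<in> parabolic m \<Longrightarrow> X \<in> lie_g m"
  by (induction rule: parabolic_induct) (fact zero_lie_g | rule lie_g_add lie_g_smult Lmat_lie_g Pmat_lie_g; assumption?)+

lemma char_act_entry:
  assumes "X \<in> parabolic m"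
  shows "char_act m lam X w = complex_of_real (X $$ (0, 3)) * lam * w"
proof -
  obtain A t B where 1: "X = A + t \<cdot>\<^sub>m Hmat m + B" "A \<in> lie_m m" "B \<in> n_plus m"
    using assms by (auto simp: parabolic_def)
  have A: "A \<in> carrier_mat (m + 1) (m + 1) \<and> A $$ (0, 3) = 0"
    using 1(2) unfolding lie_m_def
    by (rule real_span_carrier_entry)
      (use m in \<open>auto simp: H2_def Z_plus_def Z_minus_def Mmat_def Emat_def\<close>)
  have B: "B \<in> carrier_mat (m + 1) (m + 1) \<and> B $$ (0, 3) = 0"
    using 1(3) unfolding n_plus_def
    by (rule real_span_carrier_entry)
      (use m in \<open>auto simp: Q1_plus_def Q2_plus_def Y_plus_def
          Q1_minus_def Q2_minus_def Y_minus_def Emat_def\<close>)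
  have "X $$ (0, 3) = t"
    unfolding 1(1) using A B m by (auto simp: Hmat_def Emat_def)
  then show ?thesis using char_act_eq[OF m 1(2,3)] 1(1) by simp
qed

lemma n_minus_base: "a \<in> vidx m \<Longrightarrow> Nmat m a \<in> n_minus m"
  unfolding n_minus_N[OF m] by (rule real_span_base) auto

lemma n_minus_closed:
  "X \<in> n_minus m \<Longrightarrow> Y \<in> n_minus m \<Longrightarrow> X + Y \<in> n_minus m"
  "X \<in> n_minus m \<Longrightarrow> c \<cdot>\<^sub>m X \<in> n_minus m"
  "0\<^sub>m (m + 1) (m + 1) \<in> n_minus m"
  unfolding n_minus_N[OF m]
  by (rule real_span_add real_span_smult real_span.zero; auto)+

lemma Nmat_lie_g: "Nmat m a \<in> lie_g m"
  unfolding Nmat_def by (intro lie_g_add Lmat_lie_g)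

lemma n_minus_lie_g: "X \<in> n_minus m \<Longrightarrow> X \<in> lie_g m"
  unfolding n_minus_N[OF m]
  by (erule real_span_induct_closed)
    (use zero_lie_g lie_g_add lie_g_smult Nmat_lie_g in blast)+

text \<open>The basis elements \<open>L\<^sub>0\<^sub>a\<close> and \<open>L\<^sub>a\<^sub>3\<close> are half of \<open>N\<^sub>a + P\<^sub>a\<close> and of \<open>N\<^sub>a - P\<^sub>a\<close>; all others lie in the
  parabolic subalgebra.\<close>

lemma lie_g_decomposition:
  assumes "X \<in> lie_g m"
  shows "\<exists>C\<in>n_minus m. \<exists>p\<in>parabolic m. X = C + p"
proof -
  define D where "D X \<longleftrightarrow> (\<exists>C\<in>n_minus m. \<exists>p\<in>parabolic m. X = C + p)" for X
  have pc: "p \<in> carrier_mat (m + 1) (m + 1)" if "p \<in> parabolic m" for p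
    using parabolic_lie_g[OF that] lie_g_carrier by blast
  note nc = n_minus_carrier[OF m]
  have Dadd: "D (X + Y)" if X: "D X" and Y: "D Y" for X Y
  proof -
    obtain C p where 1: "C \<in> n_minus m" "p \<in> parabolic m" "X = C + p" using X by (auto simp: D_def)
    obtain C' p' where 2: "C' \<in> n_minus m" "p' \<in> parabolic m" "Y = C' + p'" using Y by (auto simp: D_def)
    have "X + Y = (C + C') + (p + p')"
      unfolding 1 2 using nc[OF 1(1)] nc[OF 2(1)] pc[OF 1(2)] pc[OF 2(2)]
      by (intro eq_matI) auto
    then show ?thesis unfolding D_def using 1 2 n_minus_closed(1) parabolic_closed(1) by blast
  qed
  have Dsm: "D (c \<cdot>\<^sub>m X)" if X: "D X" for c X
  proof -
    obtain C p where 1: "C \<in> n_minus m" "p \<in> parabolic m" "X = C + p" using X by (auto simp: D_def)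
    have "c \<cdot>\<^sub>m X = c \<cdot>\<^sub>m C + c \<cdot>\<^sub>m p"
      unfolding 1 using nc[OF 1(1)] pc[OF 1(2)]
      by (intro eq_matI) (auto simp: algebra_simps)
    then show ?thesis unfolding D_def using 1 n_minus_closed(2) parabolic_closed(2) by blast
  qed
  have Dn: "D C" if C: "C \<in> n_minus m" for C
  proof -
    have "C = C + 0\<^sub>m (m + 1) (m + 1)" using nc[OF C] by simp
    then show ?thesis unfolding D_def using C parabolic_closed(6) by blast
  qed
  have Dp: "D p" if p: "p \<in> parabolic m" for p
  proof -
    have "p = 0\<^sub>m (m + 1) (m + 1) + p" using pc[OF p] by simp
    then show ?thesis unfolding D_def using p n_minus_closed(3) by blast
  qed
  have L0: "D (Lmat m 0 a)" and L3: "D (Lmat m a 3)" if a: "a \<in> vidx m" for a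
  proof -
    have N: "D (Nmat m a)" and P: "D (Pmat m a)"
      using Dn n_minus_base[OF a] Dp parabolic_closed(4) Pmat_n_plus[OF a] by blast+
    have "Lmat m 0 a = (1/2) \<cdot>\<^sub>m (Nmat m a + Pmat m a)"
      by (rule eq_matI) (auto simp: Nmat_def Pmat_def)
    then show "D (Lmat m 0 a)" using Dsm[OF Dadd[OF N P]] by simp
    have "Lmat m a 3 = (1/2) \<cdot>\<^sub>m (Nmat m a + (- 1) \<cdot>\<^sub>m Pmat m a)"
      by (rule eq_matI) (auto simp: Nmat_def Pmat_def)
    then show "D (Lmat m a 3)" using Dsm[OF Dadd[OF N Dsm[OF P]]] by simp
  qed
  have flip: "D (Lmat m B A)" if "D (Lmat m A B)" for A B
    using Dsm[OF that, of "- 1"] Lmat_flip[of m B A] by simp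
  have same: "D (Lmat m A A)" for A
    using Dn[OF n_minus_closed(3)] by (simp add: Lmat_same)
  have H: "D (Lmat m 0 3)" using Dp[OF parabolic_closed(5)] by (simp add: Hmat_L[OF m])
  have LL: "D (Lmat m a b)" if "a \<in> vidx m" "b \<in> vidx m" for a b
    using Dp parabolic_closed(3) Lmat_lie_m[OF that] by blast
  have "D (Lmat m A B)" if "A \<le> m" "B \<le> m" for A B
    using index_cases[OF that(1)] index_cases[OF that(2)] same H flip[OF H] L0 flip[OF L0] L3 flip[OF L3] LL
    by blast
  then have "D X"
    using lie_g_span[OF assms] Dn[OF n_minus_closed(3)]
    by - (erule real_span_induct_closed, auto intro: Dadd Dsm)
  then show ?thesis by (simp add: D_def)
qed

text \<open>The vectors \<open>(1, 1)\<close> and \<open>(1, - 1)\<close> in the coordinates 0 and 3 are orthogonal, so of the product of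
  two generators only a term with \<open>a = b\<close> survives, and that term is symmetric in them.\<close>

lemma Nmat_commute:
  assumes a: "a \<in> vidx m" and b: "b \<in> vidx m"
  shows "Nmat m a * Nmat m b = Nmat m b * Nmat m a"
proof -
  have prod: "(Nmat m a * Nmat m b) $$ (i, j)
    = (if a = b then eta a * (of_bool (i = 0) - of_bool (i = 3)) * (of_bool (j = 0) + of_bool (j = 3)) else 0)"
    if a: "a \<in> vidx m" and b: "b \<in> vidx m" and ij: "i \<le> m" "j \<le> m" for a b i j
  proof -
    have am: "a \<le> m" "a \<noteq> 0" "a \<noteq> 3" and bm: "b \<le> m" "b \<noteq> 0" "b \<noteq> 3"
      using a b vidx_le[OF m] vidx_props by auto
    have N: "Nmat m c $$ (i, j) = of_bool (i = c) * (of_bool (j = 0) + of_bool (j = 3))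
      + eta c * of_bool (j = c) * (of_bool (i = 0) - of_bool (i = 3))"
      if "c \<in> vidx m" "i \<le> m" "j \<le> m" for c i j
      using that vidx_props[of c] by (auto simp: Nmat_entry)
    have "(Nmat m a * Nmat m b) $$ (i, j) = (\<Sum>l<m + 1. Nmat m a $$ (i, l) * Nmat m b $$ (l, j))"
      using ij by (intro mat_mult_entry) auto
    also have "\<dots> = (\<Sum>l\<in>{0, 3, a}. Nmat m a $$ (i, l) * Nmat m b $$ (l, j))"
      using m am ij by (intro sum.mono_neutral_right) (auto simp: N[OF a])
    also have "\<dots> = (if a = b then eta a * (of_bool (i = 0) - of_bool (i = 3)) * (of_bool (j = 0) + of_bool (j = 3)) else 0)"
      using m am bm ij by (simp add: N[OF a] N[OF b])
    finally show ?thesis .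
  qed
  show ?thesis
    by (rule eq_matI) (auto simp: prod[OF a b] prod[OF b a] simp del: index_mult_mat(1))
qed

lemma n_minus_commute: "X \<in> n_minus m \<Longrightarrow> Y \<in> n_minus m \<Longrightarrow> X * Y = Y * X"
proof -
  let ?C = "carrier_mat (m + 1) (m + 1) :: real mat set"
  have step: "\<forall>X\<in>real_span m S. X * Y = Y * X"
    if S: "S \<subseteq> ?C" and Y: "Y \<in> ?C" and comm: "\<And>X. X \<in> S \<Longrightarrow> X * Y = Y * X" for S Y
  proof
    fix X assume "X \<in> real_span m S"
    then show "X * Y = Y * X"
    proof induction
      case zero
      then show ?case using Y by simp
    next
      case (add X Z c)
      have "X \<in> ?C" "Z \<in> ?C" using add real_span_carrier[OF _ S] S by auto
      note c = \<open>X \<in> ?C\<close> \<open>Z \<in> ?C\<close> Y smult_carrier_mat[OF \<open>X \<in> ?C\<close>, of c]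
      have "(c \<cdot>\<^sub>m X + Z) * Y = c \<cdot>\<^sub>m (X * Y) + Z * Y"
        using add_mult_distrib_mat[OF c(4,2,3)] mult_smult_assoc_mat[OF c(1,3)] by simp
      moreover have "Y * (c \<cdot>\<^sub>m X + Z) = c \<cdot>\<^sub>m (Y * X) + Y * Z"
        using mult_add_distrib_mat[OF c(3,4,2)] mult_smult_distrib[OF c(3,1)] by simp
      ultimately show ?case using add comm by simp
    qed
  qed
  have N: "Nmat m ` vidx m \<subseteq> ?C" by auto
  assume X: "X \<in> n_minus m" and Y: "Y \<in> n_minus m"
  have 1: "\<forall>X\<in>n_minus m. X * Nmat m b = Nmat m b * X" if "b \<in> vidx m" for b
    unfolding n_minus_N[OF m] using Nmat_commute that by (intro step[OF N]) auto
  have "\<forall>Y\<in>n_minus m. Y * X = X * Y"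
    unfolding n_minus_N[OF m] using 1 X by (intro step[OF N n_minus_carrier[OF m X]]) auto
  then show ?thesis using Y by simp
qed

lemma lie_closed_n_minus: "lie_closed (n_minus m)"
  unfolding lie_closed_def
proof (intro conjI ballI allI)
  fix X Y assume XY: "X \<in> n_minus m" "Y \<in> n_minus m"
  have "X * Y - Y * X = 0\<^sub>m (m + 1) (m + 1)"
    using n_minus_commute[OF XY] minus_r_inv_mat[of "Y * X" "m + 1" "m + 1"]
      n_minus_carrier[OF m XY(1)] n_minus_carrier[OF m XY(2)] by simp
  then show "X * Y - Y * X \<in> n_minus m" using n_minus_closed(3) by simp
qed (auto intro: n_minus_closed)

end

section \<open>The inclusion of the smaller Lie algebra\<close>

lemma pad_entry:
  "X \<in> carrier_mat (n + 1) (n + 1) \<Longrightarrow> i \<le> n + 1 \<Longrightarrow> j \<le> n + 1 \<Longrightarrow>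
    pad n X $$ (i, j) = (if i \<le> n \<and> j \<le> n then X $$ (i, j) else 0)"
  by (auto simp: pad_def)

lemma pad_carrier: "X \<in> carrier_mat (n + 1) (n + 1) \<Longrightarrow> pad n X \<in> carrier_mat (n + 2) (n + 2)"
  by (auto simp: pad_def)

lemma pad_lie_g: "X \<in> lie_g n \<Longrightarrow> pad n X \<in> lie_g (n + 1)"
proof -
  assume X: "X \<in> lie_g n"
  have "eta i * pad n X $$ (i, j) + eta j * pad n X $$ (j, i) = 0" if "i \<le> n + 1" "j \<le> n + 1" for i j
    using X that by (cases "i \<le> n \<and> j \<le> n") (auto simp: pad_entry lie_g_iff)
  then show ?thesis
    unfolding lie_g_iff using pad_carrier[OF lie_g_carrier[OF X]] by simp
qed

lemma pad_add:
  "X \<in> carrier_mat (n + 1) (n + 1) \<Longrightarrow> Y \<in> carrier_mat (n + 1) (n + 1) \<Longrightarrow> pad n (X + Y) = pad n X + pad n Y"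
  by (rule eq_matI) (auto simp: pad_def)

lemma pad_smult: "X \<in> carrier_mat (n + 1) (n + 1) \<Longrightarrow> pad n (c \<cdot>\<^sub>m X) = c \<cdot>\<^sub>m pad n X"
  by (rule eq_matI) (auto simp: pad_def)

lemma pad_bracket:
  assumes X: "X \<in> carrier_mat (n + 1) (n + 1)" and Y: "Y \<in> carrier_mat (n + 1) (n + 1)"
  shows "pad n (X * Y - Y * X) = pad n X * pad n Y - pad n Y * pad n X"
proof -
  have m: "(pad n X * pad n Y) $$ (i, j) = (if i \<le> n \<and> j \<le> n then (X * Y) $$ (i, j) else 0)"
    if X: "X \<in> carrier_mat (n + 1) (n + 1)" and Y: "Y \<in> carrier_mat (n + 1) (n + 1)"
      and ij: "i \<le> n + 1" "j \<le> n + 1" for X Y i j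
  proof -
    have "(pad n X * pad n Y) $$ (i, j) = (\<Sum>l<n + 2. pad n X $$ (i, l) * pad n Y $$ (l, j))"
      using pad_carrier[OF X] pad_carrier[OF Y] ij by (intro mat_mult_entry) auto
    also have "\<dots> = (\<Sum>l<n + 1. pad n X $$ (i, l) * pad n Y $$ (l, j))"
      using ij by (simp add: pad_entry[OF X])
    also have "\<dots> = (if i \<le> n \<and> j \<le> n then \<Sum>l<n + 1. X $$ (i, l) * Y $$ (l, j) else 0)"
      using ij by (auto simp: pad_entry[OF X] pad_entry[OF Y] simp del: sum.lessThan_Suc intro!: sum.cong)
    also have "\<dots> = (if i \<le> n \<and> j \<le> n then (X * Y) $$ (i, j) else 0)"
      using mat_mult_entry[OF X Y, of i j] by (simp del: index_mult_mat)
    finally show ?thesis .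
  qed
  have c: "X * Y \<in> carrier_mat (n + 1) (n + 1)" "Y * X \<in> carrier_mat (n + 1) (n + 1)"
    "X * Y - Y * X \<in> carrier_mat (n + 1) (n + 1)" using X Y by auto
  show ?thesis
  proof (rule eq_matI)
    fix i j assume "i < dim_row (pad n X * pad n Y - pad n Y * pad n X)"
      "j < dim_col (pad n X * pad n Y - pad n Y * pad n X)"
    then have ij: "i \<le> n + 1" "j \<le> n + 1" using pad_carrier[OF X] pad_carrier[OF Y] by auto
    then show "pad n (X * Y - Y * X) $$ (i, j) = (pad n X * pad n Y - pad n Y * pad n X) $$ (i, j)"
      using m[OF X Y ij] m[OF Y X ij] pad_carrier[OF X] pad_carrier[OF Y] X Y
      by (simp add: pad_entry[OF c(3)] del: index_mult_mat(1))
  qed (use X Y in \<open>auto simp: pad_def\<close>)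
qed

section \<open>Generalized Verma modules in terms of representatives\<close>

text \<open>Including the defining ideal makes these the preimages of the left ideals of the enveloping algebra.\<close>

definition left_ideal :: "real mat set \<Rightarrow> free_algebra set \<Rightarrow> bool" where
  "left_ideal L K \<longleftrightarrow> K \<subseteq> words_over L \<and> env_ideal L \<subseteq> K
     \<and> (\<forall>p\<in>K. \<forall>q\<in>K. p + q \<in> K) \<and> (\<forall>a\<in>words_over L. \<forall>p\<in>K. a * p \<in> K)"

lemma left_idealD:
  assumes "left_ideal L K"
  shows "p \<in> K \<Longrightarrow> p \<in> words_over L" "p \<in> env_ideal L \<Longrightarrow> p \<in> K"
    "p \<in> K \<Longrightarrow> q \<in> K \<Longrightarrow> p + q \<in> K" "a \<in> words_over L \<Longrightarrow> p \<in> K \<Longrightarrow> a * p \<in> K"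
    "p \<in> K \<Longrightarrow> - p \<in> K" "p \<in> K \<Longrightarrow> q \<in> K \<Longrightarrow> p - q \<in> K"
proof -
  have um: "- p \<in> K" if "p \<in> K" for p
  proof -
    have "scal (- 1) * p \<in> K" using assms that words_over_closed(3) by (simp only: left_ideal_def)
    then show ?thesis by (simp add: scal_simps)
  qed
  show "p \<in> K \<Longrightarrow> p \<in> words_over L" "p \<in> env_ideal L \<Longrightarrow> p \<in> K"
    "p \<in> K \<Longrightarrow> q \<in> K \<Longrightarrow> p + q \<in> K" "a \<in> words_over L \<Longrightarrow> p \<in> K \<Longrightarrow> a * p \<in> K"
    using assms by (auto simp: left_ideal_def)
  show "p \<in> K \<Longrightarrow> - p \<in> K" using um .
  show "p \<in> K \<Longrightarrow> q \<in> K \<Longrightarrow> p - q \<in> K"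
    using um[of q] assms unfolding left_ideal_def by (metis diff_conv_add_uminus)
qed

text \<open>The preimage in the free algebra of the submodule that is divided out; the classes \<open>vcls\<close> of two
  elements agree if and only if their difference lies in it.\<close>

definition verma_ideal :: "nat \<Rightarrow> complex \<Rightarrow> free_algebra set" where
  "verma_ideal m lam = {p \<in> words_over (lie_g m). ucls (lie_g m) p \<in> verma_relations m lam}"

definition vcls :: "nat \<Rightarrow> complex \<Rightarrow> free_algebra \<Rightarrow> env set" where
  "vcls m lam p = verma_class m lam (ucls (lie_g m) p)"

context
  fixes m :: nat and lam :: complex
  assumes m: "m \<ge> 4"
begin

abbreviation (input) "LL \<equiv> lie_g m"
abbreviation (input) "RR \<equiv> UEA (lie_g m)"
abbreviation (input) "MM \<equiv> tensor_line m"

lemma ringR: "ring RR"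
  by (rule ring_UEA[OF lie_closed_lie_g])

lemma tensor_line_simps [simp]:
  "carrier MM = carrier RR" "zero MM = zero RR" "add MM = add RR" "smult MM = monoid.mult RR"
  by (simp_all add: tensor_line_def)

lemma abelian_group_M: "abelian_group MM"
proof -
  interpret ring RR by (rule ringR)
  show ?thesis by (rule abelian_groupI) (auto simp: a_ac intro: bexI[of _ "\<ominus>\<^bsub>RR\<^esub> _"] l_neg)
qed

lemma a_inv_M [simp]: "\<ominus>\<^bsub>MM\<^esub> x = \<ominus>\<^bsub>RR\<^esub> x"
  by (simp add: a_inv_def m_inv_def)

lemma a_minus_M [simp]: "x \<ominus>\<^bsub>MM\<^esub> y = x \<ominus>\<^bsub>RR\<^esub> y"
  by (simp add: a_minus_def)

lemma submodule_iff:
  "submodule N RR MM \<longleftrightarrow> N \<subseteq> carrier RR \<and> \<zero>\<^bsub>RR\<^esub> \<in> N \<and> (\<forall>x\<in>N. \<forall>y\<in>N. x \<oplus>\<^bsub>RR\<^esub> y \<in> N)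
     \<and> (\<forall>a\<in>carrier RR. \<forall>x\<in>N. a \<otimes>\<^bsub>RR\<^esub> x \<in> N) \<and> (\<forall>x\<in>N. \<ominus>\<^bsub>RR\<^esub> x \<in> N)"
proof -
  have "subgroup N (add_monoid MM) \<longleftrightarrow> N \<subseteq> carrier RR \<and> \<zero>\<^bsub>RR\<^esub> \<in> N
     \<and> (\<forall>x\<in>N. \<forall>y\<in>N. x \<oplus>\<^bsub>RR\<^esub> y \<in> N) \<and> (\<forall>x\<in>N. \<ominus>\<^bsub>RR\<^esub> x \<in> N)"
    using a_inv_M unfolding subgroup_def a_inv_def by auto
  then show ?thesis by (auto simp: submodule_def submodule_axioms_def)
qed

lemma submodule_generated:
  assumes "S \<subseteq> carrier RR"
  shows "submodule (generated_submodule RR MM S) RR MM"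
proof -
  interpret ring RR by (rule ringR)
  have "submodule (carrier RR) RR MM" by (simp add: submodule_iff)
  then have "generated_submodule RR MM S \<subseteq> carrier RR"
    using assms by (auto simp: generated_submodule_def)
  moreover have "x \<in> generated_submodule RR MM S \<longleftrightarrow> (\<forall>N. submodule N RR MM \<longrightarrow> S \<subseteq> N \<longrightarrow> x \<in> N)" for x
    by (auto simp: generated_submodule_def)
  ultimately show ?thesis by (subst submodule_iff) (simp add: submodule_iff)
qed

lemma verma_generator:
  assumes X: "X \<in> parabolic m"
  shows "tensor m (U_gen LL X) w \<ominus>\<^bsub>MM\<^esub> tensor m \<one>\<^bsub>RR\<^esub> (char_act m lam X w)
    = ucls LL (gen X * scal w - scal (complex_of_real (X $$ (0, 3)) * lam * w))"
proof -
  have "X \<in> LL" by (rule parabolic_lie_g[OF m X])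
  then show ?thesis
    by (simp add: tensor_def U_gen_ucls[OF lie_closed_lie_g] U_scalar_ucls[OF lie_closed_lie_g] UEA_zero_one[OF lie_closed_lie_g] UEA_ops(1,2)[OF lie_closed_lie_g]
        UEA_ops(3)[OF lie_closed_lie_g _ words_over_closed(1)] a_minus_def char_act_entry[OF m X])
qed

lemma submodule_verma_relations: "submodule (verma_relations m lam) RR MM"
  unfolding verma_relations_def
proof (rule submodule_generated, safe)
  fix X w assume X: "X \<in> parabolic m"
  have "X \<in> LL" by (rule parabolic_lie_g[OF m X])
  then show "tensor m (U_gen LL X) w \<ominus>\<^bsub>MM\<^esub> tensor m \<one>\<^bsub>RR\<^esub> (char_act m lam X w) \<in> carrier RR"
    unfolding verma_generator[OF X] carrier_UEA by (intro imageI) auto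
qed

lemma left_ideal_verma_ideal: "left_ideal LL (verma_ideal m lam)"
proof -
  note S = submodule_verma_relations[unfolded submodule_iff]
  have z: "ucls LL p = ucls LL 0" if "p \<in> env_ideal LL" for p
    using that env_ideal_subset[OF lie_closed_lie_g] by (subst ucls_eq_iff[OF lie_closed_lie_g]) auto
  have "env_ideal LL \<subseteq> verma_ideal m lam"
    using S env_ideal_subset[OF lie_closed_lie_g]
    by (auto simp: verma_ideal_def z UEA_zero_one[OF lie_closed_lie_g])
  moreover have "p + q \<in> verma_ideal m lam" if "p \<in> verma_ideal m lam" "q \<in> verma_ideal m lam" for p q
    using that S by (auto simp: verma_ideal_def simp flip: UEA_ops[OF lie_closed_lie_g])
  moreover have "a * p \<in> verma_ideal m lam" if "a \<in> words_over LL" "p \<in> verma_ideal m lam" for a p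
    using that S by (auto simp: verma_ideal_def carrier_UEA simp flip: UEA_ops[OF lie_closed_lie_g])
  ultimately show ?thesis by (auto simp: left_ideal_def verma_ideal_def)
qed

lemma verma_ideal_generator:
  assumes "X \<in> parabolic m"
  shows "gen X - scal (complex_of_real (X $$ (0, 3)) * lam) \<in> verma_ideal m lam"
proof -
  let ?S = "{tensor m (U_gen LL X) w \<ominus>\<^bsub>MM\<^esub> tensor m \<one>\<^bsub>RR\<^esub> (char_act m lam X w) | X w. X \<in> parabolic m}"
  have X: "X \<in> LL" by (rule parabolic_lie_g[OF m assms])
  have "tensor m (U_gen LL X) 1 \<ominus>\<^bsub>MM\<^esub> tensor m \<one>\<^bsub>RR\<^esub> (char_act m lam X 1) \<in> verma_relations m lam"
    unfolding verma_relations_def generated_submodule_def using assms by blast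
  then have "ucls LL (gen X - scal (complex_of_real (X $$ (0, 3)) * lam)) \<in> verma_relations m lam"
    unfolding verma_generator[OF assms] by (simp add: scal_simps)
  then show ?thesis using X by (simp add: verma_ideal_def)
qed

text \<open>This is how maps out of the Verma module are shown to be well defined.\<close>

lemma verma_ideal_least:
  assumes K: "left_ideal LL K"
    and gens: "\<And>X. X \<in> parabolic m \<Longrightarrow> gen X - scal (complex_of_real (X $$ (0, 3)) * lam) \<in> K"
  shows "verma_ideal m lam \<subseteq> K"
proof -
  note L = lie_closed_lie_g[of m]
  note Kw = left_idealD(1)[OF K]
  have "submodule (ucls LL ` K) RR MM"
    unfolding submodule_iff
  proof (intro conjI ballI)
    show "ucls LL ` K \<subseteq> carrier RR" using Kw by (auto simp: carrier_UEA)
    show "\<zero>\<^bsub>RR\<^esub> \<in> ucls LL ` K"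
      using left_idealD(2)[OF K] env_ideal_closed(1)[OF L] by (simp add: UEA_zero_one[OF L])
    fix x assume "x \<in> ucls LL ` K"
    then obtain p where p: "p \<in> K" "x = ucls LL p" by auto
    show "\<ominus>\<^bsub>RR\<^esub> x \<in> ucls LL ` K"
      using left_idealD(5)[OF K p(1)] Kw[OF p(1)] by (simp add: p(2) UEA_ops(3)[OF L])
    show "x \<oplus>\<^bsub>RR\<^esub> y \<in> ucls LL ` K" if "y \<in> ucls LL ` K" for y
      using that left_idealD(3)[OF K p(1)] Kw[OF p(1)] Kw by (auto simp: p(2) UEA_ops(1)[OF L])
    show "a \<otimes>\<^bsub>RR\<^esub> x \<in> ucls LL ` K" if "a \<in> carrier RR" for a
      using that left_idealD(4)[OF K _ p(1)] Kw[OF p(1)] by (auto simp: p(2) carrier_UEA UEA_ops(2)[OF L])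
  qed
  moreover have "{tensor m (U_gen LL X) w \<ominus>\<^bsub>MM\<^esub> tensor m \<one>\<^bsub>RR\<^esub> (char_act m lam X w) | X w. X \<in> parabolic m}
      \<subseteq> ucls LL ` K"
  proof safe
    fix X w assume X: "X \<in> parabolic m"
    have "gen X * scal w - scal (complex_of_real (X $$ (0, 3)) * lam * w)
      = scal w * (gen X - scal (complex_of_real (X $$ (0, 3)) * lam))"
      by (simp add: right_diff_distrib scal_commute[of w "gen X"] mult.commute[of _ w] scal_simps(4)[of w])
    moreover have "\<dots> \<in> K" using gens[OF X] left_idealD(4)[OF K] by blast
    ultimately show "tensor m (U_gen LL X) w \<ominus>\<^bsub>MM\<^esub> tensor m \<one>\<^bsub>RR\<^esub> (char_act m lam X w) \<in> ucls LL ` K"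
      unfolding verma_generator[OF X] by simp
  qed
  ultimately have "verma_relations m lam \<subseteq> ucls LL ` K"
    unfolding verma_relations_def generated_submodule_def by blast
  show ?thesis
  proof
    fix p assume "p \<in> verma_ideal m lam"
    then have p: "p \<in> words_over LL" "ucls LL p \<in> ucls LL ` K"
      using \<open>verma_relations m lam \<subseteq> ucls LL ` K\<close> by (auto simp: verma_ideal_def)
    then obtain k where k: "k \<in> K" "ucls LL p = ucls LL k" by auto
    then have "p - k \<in> K" using p ucls_eq_iff[OF L p(1) Kw[OF k(1)]] left_idealD(2)[OF K] by blast
    then have "(p - k) + k \<in> K" using left_idealD(3)[OF K] k by blast
    then show "p \<in> K" by simp
  qed
qed

lemma abelian_subgroup_verma: "abelian_subgroup (verma_relations m lam) MM"
  by (rule abelian_subgroupI3[OF additive_subgroup.intro abelian_group_M])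
    (rule submodule.axioms(1)[OF submodule_verma_relations])

lemma carrier_verma: "carrier (verma m lam) = vcls m lam ` words_over LL"
  by (auto simp: verma_def quotient_module_def A_RCOSETS_def' carrier_UEA vcls_def verma_class_def)

lemma vcls_eq_iff:
  assumes "p \<in> words_over LL" "q \<in> words_over LL"
  shows "vcls m lam p = vcls m lam q \<longleftrightarrow> p - q \<in> verma_ideal m lam"
proof -
  note L = lie_closed_lie_g[of m]
  interpret A: abelian_subgroup "verma_relations m lam" MM by (rule abelian_subgroup_verma)
  have c: "ucls LL p \<in> carrier MM" "ucls LL q \<in> carrier MM" using assms by (auto simp: carrier_UEA)
  have "vcls m lam p = vcls m lam q \<longleftrightarrow> ucls LL p \<in> vcls m lam q"
    unfolding vcls_def verma_class_def
    using A.a_repr_independence[OF _ c(2) A.a_subgroup] A.a_rcos_self[OF c(1)] by blast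
  also have "\<dots> \<longleftrightarrow> ucls LL p \<oplus>\<^bsub>MM\<^esub> \<ominus>\<^bsub>MM\<^esub> ucls LL q \<in> verma_relations m lam"
    unfolding vcls_def verma_class_def by (rule A.a_rcos_module[OF c(2,1)])
  also have "ucls LL p \<oplus>\<^bsub>MM\<^esub> \<ominus>\<^bsub>MM\<^esub> ucls LL q = ucls LL (p - q)"
    using assms by (simp add: UEA_ops[OF L])
  finally show ?thesis using assms by (simp add: verma_ideal_def)
qed

lemma verma_add:
  assumes "p \<in> words_over LL" "q \<in> words_over LL"
  shows "vcls m lam p \<oplus>\<^bsub>verma m lam\<^esub> vcls m lam q = vcls m lam (p + q)"
proof -
  interpret A: abelian_subgroup "verma_relations m lam" MM by (rule abelian_subgroup_verma)
  have "ucls LL p \<in> carrier MM" "ucls LL q \<in> carrier MM" using assms by (auto simp: carrier_UEA)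
  from A.a_rcos_sum[OF this] show ?thesis
    using assms
    by (simp add: vcls_def verma_class_def verma_def quotient_module_def UEA_ops[OF lie_closed_lie_g])
qed

lemma verma_smult:
  assumes a: "a \<in> words_over LL" and p: "p \<in> words_over LL"
  shows "ucls LL a \<odot>\<^bsub>verma m lam\<^esub> vcls m lam p = vcls m lam (a * p)"
proof -
  note L = lie_closed_lie_g[of m]
  interpret A: abelian_subgroup "verma_relations m lam" MM by (rule abelian_subgroup_verma)
  have c: "ucls LL p \<in> carrier MM" using p by (auto simp: carrier_UEA)
  have "verma_relations m lam +>\<^bsub>MM\<^esub> (ucls LL a \<odot>\<^bsub>MM\<^esub> x) = vcls m lam (a * p)" if x: "x \<in> vcls m lam p" for x
  proof -
    have "x \<in> carrier MM" using A.a_elemrcos_carrier[OF c] x by (simp add: vcls_def verma_class_def)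
    then obtain q where q: "q \<in> words_over LL" "x = ucls LL q" by (auto simp: carrier_UEA)
    have "vcls m lam q = vcls m lam p"
      using A.a_repr_independence[OF _ c A.a_subgroup, of x] x
      by (simp add: vcls_def verma_class_def q(2))
    then have "q - p \<in> verma_ideal m lam" using vcls_eq_iff[OF q(1) p] by simp
    then have "a * (q - p) \<in> verma_ideal m lam" using left_idealD(4)[OF left_ideal_verma_ideal a] by blast
    then have "vcls m lam (a * q) = vcls m lam (a * p)"
      using a p q by (subst vcls_eq_iff) (auto simp: right_diff_distrib)
    then show ?thesis
      using a q by (simp add: vcls_def verma_class_def UEA_ops[OF L])
  qed
  moreover have "ucls LL p \<in> vcls m lam p"
    using A.a_rcos_self[OF c] by (simp add: vcls_def verma_class_def)
  ultimately show ?thesis by (auto simp: verma_def quotient_module_def)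
qed

end

section \<open>Homomorphisms and singular vectors\<close>

lemma incl_ucls:
  assumes "p \<in> words_over (lie_g n)"
  shows "incl n (ucls (lie_g n) p) = ucls (lie_g (n + 1)) (free_map (pad n) p)"
  unfolding incl_def
  by (rule U_map_ucls[OF lie_closed_lie_g lie_closed_lie_g _ _ _ _ assms])
    (auto intro!: pad_lie_g[simplified] pad_add pad_smult pad_bracket simp: lie_g_iff[of _ n])

lemma free_map_pad: "p \<in> words_over (lie_g n) \<Longrightarrow> free_map (pad n) p \<in> words_over (lie_g (n + 1))"
  by (rule free_map_in_words_over) (auto intro: pad_lie_g[simplified])

lemma free_map_pad_ideal:
  "p \<in> env_ideal (lie_g n) \<Longrightarrow> free_map (pad n) p \<in> env_ideal (lie_g (n + 1))"
  by (rule free_map_env_ideal[OF lie_closed_lie_g lie_closed_lie_g])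
    (auto intro!: pad_lie_g[simplified] pad_add pad_smult pad_bracket simp: lie_g_iff[of _ n])

text \<open>The conditions on the image of the generator under a homomorphism: the parabolic subalgebra of the
  smaller Lie algebra acts on it by the character \<open>\<mu>\<close>.\<close>

definition singular :: "nat \<Rightarrow> complex \<Rightarrow> complex \<Rightarrow> free_algebra \<Rightarrow> bool" where
  "singular n mu lam v \<longleftrightarrow> v \<in> words_over (lie_g (n + 1)) \<and>
    (\<forall>X\<in>parabolic n. (gen (pad n X) - scal (complex_of_real (X $$ (0, 3)) * mu)) * v
       \<in> verma_ideal (n + 1) lam)"

text \<open>The choice of a representative is immaterial when \<open>v\<close> is singular, by \<open>hom_of_vcls\<close> below.\<close>

definition hom_of :: "nat \<Rightarrow> complex \<Rightarrow> complex \<Rightarrow> free_algebra \<Rightarrow> env set \<Rightarrow> env set" where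
  "hom_of n mu lam v = (\<lambda>c\<in>carrier (verma n mu).
     vcls (n + 1) lam (free_map (pad n) (SOME p. p \<in> words_over (lie_g n) \<and> vcls n mu p = c) * v))"

context
  fixes n :: nat and mu lam :: complex
  assumes n: "n \<ge> 4"
begin

lemma n_plus_one: "n + 1 \<ge> 4"
  using n by simp

lemma carrier_verma1: "carrier (verma (Suc n) lam) = vcls (Suc n) lam ` words_over (lie_g (Suc n))"
  using carrier_verma[OF n_plus_one] by simp

text \<open>Two-sidedness of the defining ideal enters here: a relation of the smaller algebra stays a relation
  when it is multiplied by \<open>v\<close> from the right.\<close>

lemma left_ideal_annihilator:
  assumes v: "v \<in> words_over (lie_g (n + 1))"
  shows "left_ideal (lie_g n) {p \<in> words_over (lie_g n). free_map (pad n) p * v \<in> verma_ideal (n + 1) lam}"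
    (is "left_ideal _ ?K")
proof -
  note J = left_ideal_verma_ideal[OF n_plus_one, of lam]
  have "env_ideal (lie_g n) \<subseteq> ?K"
  proof
    fix p assume p: "p \<in> env_ideal (lie_g n)"
    have "free_map (pad n) p * v \<in> env_ideal (lie_g (n + 1))"
      using env_ideal_closed(4)[OF lie_closed_lie_g v free_map_pad_ideal[OF p]] .
    then show "p \<in> ?K"
      using left_idealD(2)[OF J] p env_ideal_subset[OF lie_closed_lie_g] by blast
  qed
  moreover have "p + q \<in> ?K" if "p \<in> ?K" "q \<in> ?K" for p q
    using that left_idealD(3)[OF J] by (auto simp: free_map_hom distrib_right)
  moreover have "a * p \<in> ?K" if "a \<in> words_over (lie_g n)" "p \<in> ?K" for a p
    using that left_idealD(4)[OF J free_map_pad[OF that(1)]] by (auto simp: free_map_hom mult.assoc)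
  ultimately show ?thesis unfolding left_ideal_def by blast
qed

lemma hom_of_vcls:
  assumes "singular n mu lam v" "p \<in> words_over (lie_g n)"
  shows "hom_of n mu lam v (vcls n mu p) = vcls (n + 1) lam (free_map (pad n) p * v)"
proof -
  have v: "v \<in> words_over (lie_g (n + 1))" using assms by (simp add: singular_def)
  define q where "q = (SOME q. q \<in> words_over (lie_g n) \<and> vcls n mu q = vcls n mu p)"
  have "q \<in> words_over (lie_g n) \<and> vcls n mu q = vcls n mu p"
    unfolding q_def by (rule someI[of _ p]) (use assms in simp)
  then have q: "q \<in> words_over (lie_g n)" "q - p \<in> verma_ideal n mu"
    using vcls_eq_iff[OF n _ assms(2)] by auto
  have "verma_ideal n mu \<subseteq> {p \<in> words_over (lie_g n). free_map (pad n) p * v \<in> verma_ideal (n + 1) lam}"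
  proof (rule verma_ideal_least[OF n left_ideal_annihilator[OF v]])
    fix X assume "X \<in> parabolic n"
    then show "gen X - scal (complex_of_real (X $$ (0, 3)) * mu)
      \<in> {p \<in> words_over (lie_g n). free_map (pad n) p * v \<in> verma_ideal (n + 1) lam}"
      using assms(1) parabolic_lie_g[OF n]
      by (auto simp: singular_def free_map_hom free_map_gen free_map_scal)
  qed
  then have "free_map (pad n) (q - p) * v \<in> verma_ideal (n + 1) lam" using q by blast
  then have "vcls (n + 1) lam (free_map (pad n) q * v) = vcls (n + 1) lam (free_map (pad n) p * v)"
    using q assms v free_map_pad
    by (subst vcls_eq_iff[OF n_plus_one]) (auto simp: free_map_hom left_diff_distrib)
  then show ?thesis using assms by (simp add: hom_of_def carrier_verma[OF n] q_def)
qed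

lemma hom_of_in_verma_homs:
  assumes v: "singular n mu lam v"
  shows "hom_of n mu lam v \<in> verma_homs n mu lam"
proof -
  have vw: "v \<in> words_over (lie_g (n + 1))" using v by (simp add: singular_def)
  show ?thesis
    unfolding verma_homs_def left_module_hom_def
  proof (intro CollectI conjI ballI)
    show "hom_of n mu lam v \<in> carrier (verma n mu) \<rightarrow>\<^sub>E carrier (restrict_scalars (incl n) (verma (n + 1) lam))"
    proof
      fix c assume "c \<in> carrier (verma n mu)"
      then obtain p where p: "p \<in> words_over (lie_g n)" "c = vcls n mu p" by (auto simp: carrier_verma[OF n])
      show "hom_of n mu lam v c \<in> carrier (restrict_scalars (incl n) (verma (n + 1) lam))"
        using hom_of_vcls[OF v p(1)] p vw free_map_pad
        by (auto simp: restrict_scalars_def carrier_verma1)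
    qed (simp add: hom_of_def)
  next
    fix c e assume "c \<in> carrier (verma n mu)" "e \<in> carrier (verma n mu)"
    then obtain p q where p: "p \<in> words_over (lie_g n)" "c = vcls n mu p"
      and q: "q \<in> words_over (lie_g n)" "e = vcls n mu q" by (auto simp: carrier_verma[OF n])
    have "hom_of n mu lam v (c \<oplus>\<^bsub>verma n mu\<^esub> e) = vcls (n + 1) lam (free_map (pad n) p * v + free_map (pad n) q * v)"
      using p q by (simp add: verma_add[OF n] hom_of_vcls[OF v] free_map_hom distrib_right)
    also have "\<dots> = hom_of n mu lam v c \<oplus>\<^bsub>verma (n + 1) lam\<^esub> hom_of n mu lam v e"
      using p q vw free_map_pad by (subst verma_add[OF n_plus_one, symmetric]) (auto simp: hom_of_vcls[OF v])
    finally show "hom_of n mu lam v (c \<oplus>\<^bsub>verma n mu\<^esub> e)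
        = hom_of n mu lam v c \<oplus>\<^bsub>restrict_scalars (incl n) (verma (n + 1) lam)\<^esub> hom_of n mu lam v e"
      by (simp add: restrict_scalars_def)
  next
    fix u c assume "u \<in> carrier (UEA (lie_g n))" "c \<in> carrier (verma n mu)"
    then obtain a p where a: "a \<in> words_over (lie_g n)" "u = ucls (lie_g n) a"
      and p: "p \<in> words_over (lie_g n)" "c = vcls n mu p"
      by (auto simp: carrier_verma[OF n] carrier_UEA)
    have "hom_of n mu lam v (u \<odot>\<^bsub>verma n mu\<^esub> c) = vcls (n + 1) lam (free_map (pad n) a * (free_map (pad n) p * v))"
      using a p by (simp add: verma_smult[OF n] hom_of_vcls[OF v] free_map_hom mult.assoc)
    also have "\<dots> = incl n u \<odot>\<^bsub>verma (n + 1) lam\<^esub> hom_of n mu lam v c"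
      using a p vw free_map_pad by (subst verma_smult[OF n_plus_one, symmetric]) (auto simp: hom_of_vcls[OF v] incl_ucls)
    finally show "hom_of n mu lam v (u \<odot>\<^bsub>verma n mu\<^esub> c)
        = u \<odot>\<^bsub>restrict_scalars (incl n) (verma (n + 1) lam)\<^esub> hom_of n mu lam v c"
      by (simp add: restrict_scalars_def)
  qed
qed

text \<open>The module is generated by the class of 1, and the relations that hold for this class are passed on
  to its image.\<close>

lemma verma_hom_is_hom_of:
  assumes \<Phi>: "\<Phi> \<in> verma_homs n mu lam"
  shows "\<exists>v. singular n mu lam v \<and> \<Phi> = hom_of n mu lam v"
proof -
  let ?R = "restrict_scalars (incl n) (verma (n + 1) lam)"
  have maps: "\<Phi> \<in> carrier (verma n mu) \<rightarrow>\<^sub>E carrier ?R"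
    and smult: "\<And>u c. u \<in> carrier (UEA (lie_g n)) \<Longrightarrow> c \<in> carrier (verma n mu) \<Longrightarrow>
      \<Phi> (u \<odot>\<^bsub>verma n mu\<^esub> c) = incl n u \<odot>\<^bsub>verma (n + 1) lam\<^esub> \<Phi> c"
    using \<Phi> by (auto simp: verma_homs_def left_module_hom_def restrict_scalars_def)
  have one: "vcls n mu 1 \<in> carrier (verma n mu)" by (auto simp: carrier_verma[OF n])
  then have "\<Phi> (vcls n mu 1) \<in> carrier ?R" using maps by blast
  then obtain v where v: "v \<in> words_over (lie_g (n + 1))" "\<Phi> (vcls n mu 1) = vcls (n + 1) lam v"
    by (auto simp: restrict_scalars_def carrier_verma1)
  have val: "\<Phi> (vcls n mu p) = vcls (n + 1) lam (free_map (pad n) p * v)" if p: "p \<in> words_over (lie_g n)" for p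
  proof -
    have "\<Phi> (vcls n mu p) = \<Phi> (ucls (lie_g n) p \<odot>\<^bsub>verma n mu\<^esub> vcls n mu 1)"
      using p by (simp add: verma_smult[OF n])
    also have "\<dots> = ucls (lie_g (n + 1)) (free_map (pad n) p) \<odot>\<^bsub>verma (n + 1) lam\<^esub> vcls (n + 1) lam v"
      using p one by (subst smult) (auto simp: carrier_UEA incl_ucls v)
    also have "\<dots> = vcls (n + 1) lam (free_map (pad n) p * v)"
      using p v by (intro verma_smult[OF n_plus_one] free_map_pad)
    finally show ?thesis .
  qed
  have "singular n mu lam v"
    unfolding singular_def
  proof (intro conjI ballI)
    fix X assume X: "X \<in> parabolic n"
    let ?p = "gen X - scal (complex_of_real (X $$ (0, 3)) * mu)"
    have p: "?p \<in> words_over (lie_g n)" using parabolic_lie_g[OF n X] by auto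
    have "vcls n mu ?p = vcls n mu 0"
      using verma_ideal_generator[OF n X] p by (subst vcls_eq_iff[OF n]) auto
    then have "vcls (n + 1) lam (free_map (pad n) ?p * v) = vcls (n + 1) lam 0"
      using val[OF p] val[of 0] by (simp add: free_map_hom)
    then have "free_map (pad n) ?p * v - 0 \<in> verma_ideal (n + 1) lam"
      using p v free_map_pad[OF p] by (subst (asm) vcls_eq_iff[OF n_plus_one]) auto
    then show "(gen (pad n X) - scal (complex_of_real (X $$ (0, 3)) * mu)) * v \<in> verma_ideal (n + 1) lam"
      by (simp add: free_map_hom free_map_gen free_map_scal)
  qed (use v in simp)
  moreover have "\<Phi> = hom_of n mu lam v"
  proof
    fix c show "\<Phi> c = hom_of n mu lam v c"
    proof (cases "c \<in> carrier (verma n mu)")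
      case True
      then show ?thesis using val hom_of_vcls[OF \<open>singular n mu lam v\<close>] by (auto simp: carrier_verma[OF n])
    next
      case False
      then show ?thesis using maps by (auto simp: hom_of_def PiE_def extensional_def)
    qed
  qed
  ultimately show ?thesis by blast
qed

lemma hom_of_cong:
  assumes v: "singular n mu lam v" and w: "singular n mu lam w" and "v - w \<in> verma_ideal (n + 1) lam"
  shows "hom_of n mu lam v = hom_of n mu lam w"
proof
  fix c show "hom_of n mu lam v c = hom_of n mu lam w c"
  proof (cases "c \<in> carrier (verma n mu)")
    case True
    then obtain p where p: "p \<in> words_over (lie_g n)" "c = vcls n mu p" by (auto simp: carrier_verma[OF n])
    have "free_map (pad n) p * (v - w) \<in> verma_ideal (n + 1) lam"
      using assms(3) left_idealD(4)[OF left_ideal_verma_ideal[OF n_plus_one] free_map_pad[OF p(1)]] by blast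
    then have "vcls (n + 1) lam (free_map (pad n) p * v) = vcls (n + 1) lam (free_map (pad n) p * w)"
      using v w free_map_pad[OF p(1)]
      by (subst vcls_eq_iff[OF n_plus_one]) (auto simp: singular_def right_diff_distrib)
    then show ?thesis by (simp only: p(2) hom_of_vcls[OF v p(1)] hom_of_vcls[OF w p(1)])
  qed (simp add: hom_of_def)
qed

lemma singular_scale:
  assumes v: "singular n mu lam v"
  shows "singular n mu lam (scal c * v)" "hom_of n mu lam (scal c * v) = hom_scale n mu lam c (hom_of n mu lam v)"
proof -
  have vw: "v \<in> words_over (lie_g (n + 1))" using v by (simp add: singular_def)
  have comm: "p * (scal c * v) = scal c * (p * v)" for p
    by (simp add: scal_commute[of c p, symmetric] flip: mult.assoc)
  show s: "singular n mu lam (scal c * v)"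
    using v left_idealD(4)[OF left_ideal_verma_ideal[OF n_plus_one, of lam] words_over_closed(3)]
    by (auto simp: singular_def comm)
  show "hom_of n mu lam (scal c * v) = hom_scale n mu lam c (hom_of n mu lam v)"
  proof
    fix e show "hom_of n mu lam (scal c * v) e = hom_scale n mu lam c (hom_of n mu lam v) e"
    proof (cases "e \<in> carrier (verma n mu)")
      case True
      then obtain p where p: "p \<in> words_over (lie_g n)" "e = vcls n mu p" by (auto simp: carrier_verma[OF n])
      have "U_scalar (lie_g (n + 1)) c \<odot>\<^bsub>verma (n + 1) lam\<^esub> hom_of n mu lam v e
          = vcls (n + 1) lam (scal c * (free_map (pad n) p * v))"
        unfolding U_scalar_ucls[OF lie_closed_lie_g] p(2) hom_of_vcls[OF v p(1)]
        using free_map_pad[OF p(1)] vw by (intro verma_smult[OF n_plus_one]) auto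
      then show ?thesis using True p by (simp add: hom_scale_def hom_of_vcls[OF s] comm)
    qed (simp add: hom_of_def hom_scale_def)
  qed
qed

text \<open>The map \<open>hom_of\<close> depends only on the class of the singular vector and is compatible with scalars, so
  a line of singular vectors gives a line of homomorphisms.\<close>

lemma verma_homs_spanned:
  assumes v: "singular n mu lam v"
    and span: "\<And>w. singular n mu lam w \<Longrightarrow> \<exists>c. w - scal c * v \<in> verma_ideal (n + 1) lam"
  shows "verma_homs n mu lam = {hom_scale n mu lam c (hom_of n mu lam v) | c. True}"
proof (intro equalityI subsetI)
  fix \<Phi> assume "\<Phi> \<in> verma_homs n mu lam"
  then obtain w where w: "singular n mu lam w" "\<Phi> = hom_of n mu lam w" using verma_hom_is_hom_of by blast
  then obtain c where "w - scal c * v \<in> verma_ideal (n + 1) lam" using span by blast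
  then have "\<Phi> = hom_scale n mu lam c (hom_of n mu lam v)"
    using hom_of_cong[OF w(1) singular_scale(1)[OF v]] singular_scale(2)[OF v] w(2) by simp
  then show "\<Phi> \<in> {hom_scale n mu lam c (hom_of n mu lam v) | c. True}" by blast
next
  fix \<Phi> assume "\<Phi> \<in> {hom_scale n mu lam c (hom_of n mu lam v) | c. True}"
  then show "\<Phi> \<in> verma_homs n mu lam"
    using hom_of_in_verma_homs[OF singular_scale(1)[OF v]] singular_scale(2)[OF v] by auto
qed

end

section \<open>Linear operators on power series\<close>

text \<open>A function on finite multisets is the coefficient function of a formal power series in variables
  \<open>\<xi>\<^sub>a\<close>, a multiset standing for a monomial. The operators of the Weyl algebra act on all power series, so
  no finiteness condition has to be carried along. A separate type for the linear operators gives
  access to the type class \<^class>\<open>ring_1\<close>.\<close>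

type_synonym series = "nat multiset \<Rightarrow> complex"

typedef weyl_op = "{f :: series \<Rightarrow> series.
    (\<forall>u v. f (\<lambda>A. u A + v A) = (\<lambda>A. f u A + f v A)) \<and> (\<forall>c u. f (\<lambda>A. c * u A) = (\<lambda>A. c * f u A))}"
  morphisms app Op
  by (rule exI[of _ "\<lambda>u. u"]) simp

setup_lifting type_definition_weyl_op

lemma app_add: "app f (\<lambda>A. u A + v A) = (\<lambda>A. app f u A + app f v A)"
  and app_scale: "app f (\<lambda>A. c * u A) = (\<lambda>A. c * app f u A)"
  using app[of f] by auto

lemma app_zero: "app f (\<lambda>A. 0) = (\<lambda>A. 0)"
  using app_scale[of f 0 "\<lambda>A. 0"] by simp

instantiation weyl_op :: ring_1
begin

lift_definition zero_weyl_op :: weyl_op is "\<lambda>u A. 0" by simp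
lift_definition one_weyl_op :: weyl_op is "\<lambda>u. u" by simp
lift_definition plus_weyl_op :: "weyl_op \<Rightarrow> weyl_op \<Rightarrow> weyl_op" is "\<lambda>f g u A. f u A + g u A"
  by (auto simp: fun_eq_iff algebra_simps)
lift_definition minus_weyl_op :: "weyl_op \<Rightarrow> weyl_op \<Rightarrow> weyl_op" is "\<lambda>f g u A. f u A - g u A"
  by (auto simp: fun_eq_iff algebra_simps)
lift_definition uminus_weyl_op :: "weyl_op \<Rightarrow> weyl_op" is "\<lambda>f u A. - f u A"
  by (auto simp: fun_eq_iff algebra_simps)
lift_definition times_weyl_op :: "weyl_op \<Rightarrow> weyl_op \<Rightarrow> weyl_op" is "\<lambda>f g u. f (g u)"
  by simp

instance
proof
  fix a b c :: weyl_op
  show "a * b * c = a * (b * c)" by transfer simp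
  show "1 * a = a" "a * 1 = a" by (transfer; simp)+
  show "a + b + c = a + (b + c)" by transfer (simp add: fun_eq_iff algebra_simps)
  show "a + b = b + a" by transfer (simp add: fun_eq_iff algebra_simps)
  show "0 + a = a" "- a + a = 0" "a - b = a + - b" by (transfer; simp add: fun_eq_iff)+
  show "(a + b) * c = a * c + b * c" by transfer (simp add: fun_eq_iff)
  show "a * (b + c) = a * b + a * c" by transfer (simp add: fun_eq_iff)
  show "(0::weyl_op) \<noteq> 1"
    by transfer (auto simp: fun_eq_iff intro!: exI[of _ "\<lambda>A. 1"])
qed

end

lemma app_simps:
  "app 0 u = (\<lambda>A. 0)" "app 1 u = u" "app (f + g) u = (\<lambda>A. app f u A + app g u A)"
  "app (f - g) u = (\<lambda>A. app f u A - app g u A)" "app (- f) u = (\<lambda>A. - app f u A)"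
  "app (f * g) u = app f (app g u)"
  by (transfer; simp)+

lemma app_sum: "app (sum f I) u = (\<lambda>A. \<Sum>i\<in>I. app (f i) u A)"
  by (induction I rule: infinite_finite_induct) (simp_all add: app_simps)

text \<open>Multiplication by \<open>\<xi>\<^sub>a\<close> shifts coefficients; differentiation brings down the exponent of the monomial
  that it came from.\<close>

lift_definition sc :: "complex \<Rightarrow> weyl_op" is "\<lambda>c u A. c * u A"
  by (auto simp: fun_eq_iff algebra_simps)

lift_definition xop :: "nat \<Rightarrow> weyl_op" is "\<lambda>a u A. if a \<in># A then u (A - {#a#}) else 0"
  by (auto simp: fun_eq_iff)

lift_definition dop :: "nat \<Rightarrow> weyl_op" is "\<lambda>a u A. of_nat (count A a + 1) * u (add_mset a A)"
  by (auto simp: fun_eq_iff algebra_simps)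

lemma app_sc: "app (sc c) u = (\<lambda>A. c * u A)" by transfer simp
lemma app_xop: "app (xop a) u A = (if a \<in># A then u (A - {#a#}) else 0)" by transfer simp
lemma app_dop: "app (dop a) u A = of_nat (count A a + 1) * u (add_mset a A)" by transfer simp

lemma op_eqI: "(\<And>u A. app f u A = app g u A) \<Longrightarrow> f = g"
  by transfer (simp add: fun_eq_iff)


section \<open>Relations in the Weyl algebra\<close>

text \<open>The relations are derived in an arbitrary ring from the canonical commutation relations. The signs
  \<open>e\<close> are those of the form, and \<open>h0\<close> is the scalar \<open>\<lambda>\<close>.\<close>

locale weyl =
  fixes sc :: "complex \<Rightarrow> 'r::ring_1" and x d :: "nat \<Rightarrow> 'r" and I :: "nat set"
    and e :: "nat \<Rightarrow> 'r" and h0 :: 'r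
  assumes finI: "finite I"
    and xx: "x a * x b = x b * x a" and dd: "d a * d b = d b * d a"
    and dx: "d a * x b = x b * d a + (if a = b then 1 else 0)"
    and sc_one: "sc 1 = 1" and sc_add: "sc (p + q) = sc p + sc q" and sc_mult: "sc (p * q) = sc p * sc q"
    and sc_x: "sc c * x a = x a * sc c" and sc_d: "sc c * d a = d a * sc c"
    and e: "e a = 1 \<or> e a = - 1"
    and h0: "\<exists>c. h0 = sc c"
begin

lemma xx': "x a * (x b * z) = x b * (x a * z)"
  by (simp add: xx flip: mult.assoc)

lemma dd': "d a * (d b * z) = d b * (d a * z)"
  by (simp add: dd flip: mult.assoc)

lemma dx': "d a * (x b * z) = x b * (d a * z) + (if a = b then z else 0)"
proof -
  have "d a * (x b * z) = (d a * x b) * z" by (simp add: mult.assoc)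
  also have "\<dots> = x b * (d a * z) + (if a = b then z else 0)"
    by (simp add: dx distrib_right mult.assoc)
  finally show ?thesis .
qed

definition Eu where "Eu = (\<Sum>a\<in>I. x a * d a)"
definition Lap where "Lap = (\<Sum>a\<in>I. e a * (d a * d a))"

lemma e_square: "e a * e a = 1" "e a * (e a * z) = z"
  using e[of a] by auto

lemma h0_x: "h0 * x a = x a * h0" and h0_d: "h0 * d a = d a * h0"
  using h0 sc_x sc_d by auto

lemma Eu_x: "b \<in> I \<Longrightarrow> Eu * x b = x b * Eu + x b"
proof -
  assume b: "b \<in> I"
  have "Eu * x b = (\<Sum>a\<in>I. x b * (x a * d a) + (if a = b then x b else 0))"
    unfolding Eu_def sum_distrib_right
    by (intro sum.cong refl) (simp add: mult.assoc dx distrib_left xx')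
  then show ?thesis using b finI by (simp add: Eu_def sum.distrib sum_distrib_left)
qed

lemma d_Eu: "b \<in> I \<Longrightarrow> d b * Eu = Eu * d b + d b"
proof -
  assume b: "b \<in> I"
  have "d b * Eu = (\<Sum>a\<in>I. x a * (d a * d b) + (if a = b then d b else 0))"
    unfolding Eu_def sum_distrib_left
    by (intro sum.cong refl) (simp add: dx' dd)
  then show ?thesis using b finI by (simp add: Eu_def sum.distrib sum_distrib_right mult.assoc)
qed

lemma Lap_d: "Lap * d b = d b * Lap"
proof -
  have "e a * (d a * d a) * d b = d b * (e a * (d a * d a))" for a
    using e[of a] by (auto simp: mult.assoc dd dd')
  then show ?thesis unfolding Lap_def sum_distrib_left sum_distrib_right by simp
qed

lemma Lap_x: "b \<in> I \<Longrightarrow> Lap * x b = x b * Lap + 2 * e b * d b"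
proof -
  assume b: "b \<in> I"
  have "e a * (d a * d a) * x b = x b * (e a * (d a * d a)) + (if a = b then 2 * e b * d b else 0)" for a
  proof -
    have "d a * (d a * x b) = x b * (d a * d a) + (if a = b then 2 * d a else 0)"
      by (simp add: dx dx' distrib_left mult_2)
    then show ?thesis using e[of a] by (auto simp: mult.assoc algebra_simps)
  qed
  then have "Lap * x b = (\<Sum>a\<in>I. x b * (e a * (d a * d a)) + (if a = b then 2 * e b * d b else 0))"
    unfolding Lap_def sum_distrib_right by (intro sum.cong refl)
  then show ?thesis using b finI by (simp add: Lap_def sum.distrib sum_distrib_left)
qed

lemma Lap_Eu: "Lap * Eu = Eu * Lap + 2 * Lap"
proof -
  have "e a * (d a * d a) * Eu = Eu * (e a * (d a * d a)) + 2 * (e a * (d a * d a))" if "a \<in> I" for a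
  proof -
    have "d a * (d a * Eu) = Eu * (d a * d a) + 2 * (d a * d a)"
      using d_Eu[OF that] by (simp add: distrib_left mult_2) (simp flip: mult.assoc add: distrib_right d_Eu[OF that])
    then show ?thesis using e[of a] by (auto simp: mult.assoc algebra_simps)
  qed
  then have "Lap * Eu = (\<Sum>a\<in>I. Eu * (e a * (d a * d a)) + 2 * (e a * (d a * d a)))"
    unfolding Lap_def sum_distrib_right by (intro sum.cong refl) blast
  then show ?thesis by (simp add: Lap_def sum.distrib sum_distrib_left)
qed

lemma h0_Eu: "h0 * Eu = Eu * h0"
  unfolding Eu_def sum_distrib_left sum_distrib_right
  by (intro sum.cong refl) (metis h0_d h0_x mult.assoc)

lemma h0_Lap: "h0 * Lap = Lap * h0"
proof -
  have "h0 * (d a * d a) = d a * d a * h0" for a by (metis h0_d mult.assoc)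
  then have "h0 * (e a * (d a * d a)) = e a * (d a * d a) * h0" for a
    using e[of a] by auto
  then show ?thesis unfolding Lap_def sum_distrib_left sum_distrib_right by simp
qed

text \<open>Rewriting with these rules moves \<open>h0\<close> and the variables to the left and the Laplacian to the right.
  Together with distributivity this is a normal form, in which the commutators of the operators below
  can be compared.\<close>

lemmas ordering_base = Eu_x d_Eu Lap_d Lap_x Lap_Eu h0_x[symmetric] h0_d[symmetric] h0_Eu[symmetric] h0_Lap[symmetric] dx

lemma ordering_ext:
  "b \<in> I \<Longrightarrow> Eu * (x b * z) = x b * (Eu * z) + x b * z"
  "b \<in> I \<Longrightarrow> d b * (Eu * z) = Eu * (d b * z) + d b * z"
  "Lap * (d b * z) = d b * (Lap * z)"
  "b \<in> I \<Longrightarrow> Lap * (x b * z) = x b * (Lap * z) + 2 * e b * (d b * z)"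
  "Lap * (Eu * z) = Eu * (Lap * z) + 2 * (Lap * z)"
  "x b * (h0 * z) = h0 * (x b * z)" "d b * (h0 * z) = h0 * (d b * z)"
  "Eu * (h0 * z) = h0 * (Eu * z)" "Lap * (h0 * z) = h0 * (Lap * z)"
  using Eu_x[of b] d_Eu[of b] Lap_d[of b] Lap_x[of b] Lap_Eu h0_x[of b] h0_d[of b] h0_Eu h0_Lap
  by (simp_all add: distrib_right flip: mult.assoc)

lemmas ordering = ordering_base ordering_ext xx xx' dd dd' dx'

text \<open>The operators for \<open>H\<close>, \<open>L\<^sub>a\<^sub>b\<close> and \<open>P\<^sub>a\<close>. As \<open>N\<^sub>a\<close> acts by multiplication with the variable, the
  commutators with \<open>N\<^sub>b\<close> prescribed by the Lie algebra determine the operators up to terms that commute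
  with all variables; for \<open>P\<^sub>a\<close> the prescribed commutator is \<open>2 (L\<^sub>a\<^sub>b + \<eta>\<^sub>a\<^sub>b H)\<close>.\<close>

definition hh where "hh = h0 - Eu"
definition ll where "ll a b = e b * (x a * d b) - e a * (x b * d a)"
definition pp where "pp a = x a * Lap - 2 * (e a * (Eu * d a)) + 2 * (e a * (h0 * d a))"
definition gg where "gg a b = (if a = b then e a else 0)"

lemma ll_anti: "ll b a = - ll a b"
  by (simp add: ll_def)

lemma hh_x: "a \<in> I \<Longrightarrow> hh * x a - x a * hh = - x a"
  by (simp add: hh_def algebra_simps ordering mult_2 mult_2_right)

lemma hh_p: "a \<in> I \<Longrightarrow> hh * pp a - pp a * hh = pp a"
  using e[of a] by (auto simp: hh_def pp_def algebra_simps ordering mult_2 mult_2_right)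

lemma hh_l: "a \<in> I \<Longrightarrow> b \<in> I \<Longrightarrow> hh * ll a b - ll a b * hh = 0"
  using e[of a] e[of b] by (auto simp: hh_def ll_def algebra_simps ordering mult_2 mult_2_right)

lemma pp_x: "a \<in> I \<Longrightarrow> b \<in> I \<Longrightarrow> pp a * x b - x b * pp a = 2 * (ll a b + gg a b * hh)"
  using e[of a] e[of b]
  by (cases "a = b") (auto simp: hh_def ll_def pp_def gg_def algebra_simps ordering mult_2 mult_2_right)

lemma ll_x: "a \<in> I \<Longrightarrow> b \<in> I \<Longrightarrow> c \<in> I \<Longrightarrow> ll a b * x c - x c * ll a b = gg b c * x a - gg a c * x b"
  using e[of a] e[of b] e[of c]
  by (cases "b = c"; cases "a = c") (auto simp: ll_def gg_def algebra_simps ordering mult_2 mult_2_right)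

lemma ll_p: "a \<in> I \<Longrightarrow> b \<in> I \<Longrightarrow> c \<in> I \<Longrightarrow> ll a b * pp c - pp c * ll a b = gg b c * pp a - gg a c * pp b"
  using e[of a] e[of b] e[of c]
  by (cases "b = c"; cases "a = c") (auto simp: ll_def pp_def gg_def algebra_simps ordering mult_2 mult_2_right)

lemma ll_l: "a \<in> I \<Longrightarrow> b \<in> I \<Longrightarrow> c \<in> I \<Longrightarrow> f \<in> I \<Longrightarrow> ll a b * ll c f - ll c f * ll a b
   = gg b c * ll a f - gg b f * ll a c - gg a c * ll b f + gg a f * ll b c"
  using e[of a] e[of b] e[of c] e[of f]
  by (cases "b = c"; cases "a = c"; cases "b = f"; cases "a = f")
    (auto simp: ll_def gg_def algebra_simps ordering mult_2 mult_2_right)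

lemma pp_p: "a \<in> I \<Longrightarrow> b \<in> I \<Longrightarrow> pp a * pp b - pp b * pp a = 0"
  using e[of a] e[of b]
  by (cases "a = b") (auto simp: pp_def algebra_simps ordering mult_2 mult_2_right)

end

section \<open>The Lie algebra acts by differential operators\<close>

locale conformal = weyl sc x d "vidx m" "\<lambda>a. sc (complex_of_real (eta a))" "sc lam"
  for sc :: "complex \<Rightarrow> 'r::ring_1" and x d m lam
begin

abbreviation "hf \<equiv> sc (1/2)"

lemma sc_zero [simp]: "sc 0 = 0"
  using sc_add[of 0 0] by simp

lemma sc_uminus: "sc (- c) = - sc c"
  using sc_add[of c "- c"] by (simp add: eq_neg_iff_add_eq_0 add.commute)

lemma sc_diff: "sc (a - b) = sc a - sc b"
  using sc_add[of a "- b"] by (simp add: sc_uminus)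

lemma sc_sum: "sc (sum f A) = (\<Sum>i\<in>A. sc (f i))"
  by (induction A rule: infinite_finite_induct) (simp_all add: sc_add)

lemma sc_sc: "sc a * sc b = sc b * sc a"
  by (simp add: mult.commute flip: sc_mult)

lemma sc_prod: "sc c * u = u * sc c \<Longrightarrow> sc c * v = v * sc c \<Longrightarrow> sc c * (u * v) = u * v * sc c"
  by (metis mult.assoc)

lemma sc_plus: "sc c * u = u * sc c \<Longrightarrow> sc c * v = v * sc c \<Longrightarrow> sc c * (u + v) = (u + v) * sc c"
  and sc_minus: "sc c * u = u * sc c \<Longrightarrow> sc c * v = v * sc c \<Longrightarrow> sc c * (u - v) = (u - v) * sc c"
  by (simp_all add: algebra_simps)

lemma sc_Eu: "sc c * Eu = Eu * sc c"
  unfolding Eu_def sum_distrib_left sum_distrib_right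
  by (intro sum.cong refl sc_prod sc_x sc_d)

lemma sc_Lap: "sc c * Lap = Lap * sc c"
  unfolding Lap_def sum_distrib_left sum_distrib_right
  by (intro sum.cong refl sc_prod sc_d sc_sc)

lemma sc_two: "sc c * 2 = 2 * sc c"
  by (simp add: mult_2 mult_2_right)

lemma sc_hh: "sc c * hh = hh * sc c"
  unfolding hh_def by (intro sc_minus sc_sc sc_Eu)

lemma sc_ll: "sc c * ll a b = ll a b * sc c"
  unfolding ll_def by (intro sc_minus sc_prod sc_sc sc_x sc_d)

lemma sc_pp: "sc c * pp a = pp a * sc c"
  unfolding pp_def by (intro sc_plus sc_minus sc_prod sc_sc sc_x sc_d sc_Eu sc_Lap sc_two)

text \<open>The operator for \<open>L\<^sub>A\<^sub>B\<close>. The halves come from \<open>L\<^sub>0\<^sub>a = (N\<^sub>a + P\<^sub>a) / 2\<close> and \<open>L\<^sub>a\<^sub>3 = (N\<^sub>a - P\<^sub>a) / 2\<close>.\<close>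

definition Lam :: "nat \<Rightarrow> nat \<Rightarrow> 'r" where
  "Lam A B = (if A = B then 0 else if A = 0 \<and> B = 3 then hh else if A = 3 \<and> B = 0 then - hh
     else if A = 0 then hf * (x B + pp B) else if B = 0 then - (hf * (x A + pp A))
     else if B = 3 then hf * (x A - pp A) else if A = 3 then - (hf * (x B - pp B))
     else ll A B)"

lemma Lam_anti: "Lam B A = - Lam A B"
  by (auto simp: Lam_def ll_anti[of B A])

lemma sc_Lam: "sc c * Lam A B = Lam A B * sc c"
proof -
  have 1: "sc c * (hf * (x A + pp A)) = hf * (x A + pp A) * sc c" for A
    by (intro sc_plus sc_prod sc_sc sc_x sc_pp)
  have 2: "sc c * (hf * (x A - pp A)) = hf * (x A - pp A) * sc c" for A
    by (intro sc_minus sc_prod sc_sc sc_x sc_pp)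
  show ?thesis unfolding Lam_def using 1 2 sc_hh[of c] sc_ll[of c] by auto
qed

definition comm :: "'r \<Rightarrow> 'r \<Rightarrow> 'r" where "comm u v = u * v - v * u"

lemma comm_add: "comm (u + v) w = comm u w + comm v w" "comm w (u + v) = comm w u + comm w v"
  and comm_diff: "comm (u - v) w = comm u w - comm v w" "comm w (u - v) = comm w u - comm w v"
  and comm_uminus: "comm (- u) w = - comm u w" "comm w (- u) = - comm w u"
  and comm_zero: "comm 0 w = 0" "comm w 0 = 0" "comm u u = 0"
  by (simp_all add: comm_def algebra_simps)

lemma comm_sum: "comm (sum f S) w = (\<Sum>i\<in>S. comm (f i) w)" "comm w (sum f S) = (\<Sum>i\<in>S. comm w (f i))"
  by (simp_all add: comm_def sum_distrib_left sum_distrib_right sum_subtractf)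

lemma comm_anti: "comm v u = - comm u v"
  by (simp add: comm_def)

lemma comm_sc:
  assumes "sc c * w = w * sc c"
  shows "comm (sc c * u) w = sc c * comm u w" "comm w (sc c * u) = sc c * comm w u"
  using assms by (simp_all add: comm_def right_diff_distrib mult.assoc) (simp_all flip: mult.assoc)

lemma hf_double: "hf * (z + z) = z" "hf * z + hf * z = z"
proof -
  have "hf + hf = 1" using sc_add[of "1/2" "1/2"] sc_one by simp
  then show "hf * (z + z) = z" "hf * z + hf * z = z"
    by (simp_all add: distrib_left flip: distrib_right)
qed

definition gm :: "nat \<Rightarrow> nat \<Rightarrow> 'r" where
  "gm A B = (if A = B then sc (complex_of_real (eta A)) else 0)"

text \<open>The commutation relations of the matrices \<open>L\<^sub>A\<^sub>B\<close>, asked of the operators. They are symmetric enough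
  to be checked for one order of the indices in each of ten types.\<close>

definition Rel :: "nat \<Rightarrow> nat \<Rightarrow> nat \<Rightarrow> nat \<Rightarrow> bool" where
  "Rel A B C D \<longleftrightarrow> comm (Lam A B) (Lam C D) =
     gm B C * Lam A D - gm B D * Lam A C - gm A C * Lam B D + gm A D * Lam B C"

lemma Rel_flip1: "Rel A B C D \<Longrightarrow> Rel B A C D"
  unfolding Rel_def Lam_anti[of B A] comm_uminus by simp

lemma Rel_flip2: "Rel A B C D \<Longrightarrow> Rel A B D C"
  unfolding Rel_def Lam_anti[of D C] comm_uminus by simp

lemma gm_sym: "gm B A = gm A B"
  by (simp add: gm_def)

lemma Rel_swap: "Rel A B C D \<Longrightarrow> Rel C D A B"
proof -
  assume R: "Rel A B C D"
  have "comm (Lam C D) (Lam A B) = - comm (Lam A B) (Lam C D)" by (rule comm_anti)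
  then show ?thesis
    using R unfolding Rel_def
    by (simp add: Lam_anti[of C A] Lam_anti[of C B] Lam_anti[of D A] Lam_anti[of D B]
        gm_sym[of C A] gm_sym[of C B] gm_sym[of D A] gm_sym[of D B] algebra_simps)
qed

lemma Rel_same: "Rel A A C D" "Rel C D A A"
proof -
  show "Rel A A C D" unfolding Rel_def by (simp add: Lam_def[of A A] comm_zero algebra_simps)
  then show "Rel C D A A" by (rule Rel_swap)
qed

lemma Lam_values:
  "Lam 0 3 = hh" "a \<in> vidx m \<Longrightarrow> Lam 0 a = hf * (x a + pp a)"
  "a \<in> vidx m \<Longrightarrow> Lam a 3 = hf * (x a - pp a)"
  "a \<in> vidx m \<Longrightarrow> b \<in> vidx m \<Longrightarrow> Lam a b = ll a b" "Lam A A = 0"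
  by (auto simp: Lam_def ll_def dest: vidx_props)

lemma gm_values:
  "gm 0 0 = - 1" "gm 3 3 = 1" "gm 0 3 = 0" "gm 3 0 = 0"
  "a \<in> vidx m \<Longrightarrow> gm 0 a = 0" "a \<in> vidx m \<Longrightarrow> gm a 0 = 0"
  "a \<in> vidx m \<Longrightarrow> gm 3 a = 0" "a \<in> vidx m \<Longrightarrow> gm a 3 = 0" "gm a b = gg a b"
proof -
  show "gm a b = gg a b" by (simp add: gm_def gg_def)
qed (use sc_uminus[of 1] sc_one in \<open>auto simp: gm_def eta_def vidx_def\<close>)

lemma gg_sym: "gg b a = gg a b"
  by (simp add: gg_def)

lemma comm_values:
  "comm (x a) (x b) = 0"
  "a \<in> vidx m \<Longrightarrow> comm hh (x a) = - x a" "a \<in> vidx m \<Longrightarrow> comm hh (pp a) = pp a"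
  "a \<in> vidx m \<Longrightarrow> b \<in> vidx m \<Longrightarrow> comm hh (ll a b) = 0"
  "a \<in> vidx m \<Longrightarrow> b \<in> vidx m \<Longrightarrow> comm (pp a) (x b) = 2 * (ll a b + gg a b * hh)"
  "a \<in> vidx m \<Longrightarrow> b \<in> vidx m \<Longrightarrow> comm (x a) (pp b) = 2 * (ll a b - gg a b * hh)"
  "a \<in> vidx m \<Longrightarrow> b \<in> vidx m \<Longrightarrow> comm (pp a) (pp b) = 0"
  "a \<in> vidx m \<Longrightarrow> b \<in> vidx m \<Longrightarrow> c \<in> vidx m \<Longrightarrow> comm (ll a b) (x c) = gg b c * x a - gg a c * x b"
  "a \<in> vidx m \<Longrightarrow> b \<in> vidx m \<Longrightarrow> c \<in> vidx m \<Longrightarrow> comm (ll a b) (pp c) = gg b c * pp a - gg a c * pp b"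
  "a \<in> vidx m \<Longrightarrow> b \<in> vidx m \<Longrightarrow> c \<in> vidx m \<Longrightarrow> f \<in> vidx m \<Longrightarrow> comm (ll a b) (ll c f) =
    gg b c * ll a f - gg b f * ll a c - gg a c * ll b f + gg a f * ll b c"
proof -
  show 5: "comm (pp a) (x b) = 2 * (ll a b + gg a b * hh)" if "a \<in> vidx m" "b \<in> vidx m" for a b
    using pp_x[OF that] by (simp add: comm_def)
  show "comm (x a) (pp b) = 2 * (ll a b - gg a b * hh)" if "a \<in> vidx m" "b \<in> vidx m"
    unfolding comm_anti[of "x a"] 5[OF that(2,1)] ll_anti[of b a] gg_sym[of b a] by (simp add: algebra_simps)
qed (simp_all add: comm_def xx hh_x hh_p hh_l pp_p ll_x ll_p ll_l)

lemma comm_hf: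
  "comm (hf * u) (hf * v) = hf * (hf * comm u v)" if "hf * u = u * hf" "hf * v = v * hf"
  using comm_sc(1)[of "1/2" "hf * v" u] comm_sc(2)[of "1/2" u v] that sc_prod[of "1/2" hf v] by auto

lemma hf_x_pp: "hf * (x a + pp a) = (x a + pp a) * hf" "hf * (x a - pp a) = (x a - pp a) * hf"
  by (intro sc_plus sc_minus sc_x sc_pp)+

lemma comm_Lam_hf: "comm (Lam A B) (hf * u) = hf * comm (Lam A B) u"
  by (rule comm_sc) (rule sc_Lam)

lemma hf_gg: "hf * (gg a b * z) = gg a b * (hf * z)"
  using sc_sc by (simp add: gg_def flip: mult.assoc)

context
  fixes a b assumes a: "a \<in> vidx m" and b: "b \<in> vidx m"
begin

lemma Rel_03_0a: "Rel 0 3 0 a" and Rel_03_a3: "Rel 0 3 a 3" and Rel_03_ab: "Rel 0 3 a b"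
proof -
  have "comm hh (hf * u) = hf * comm hh u" for u
    using comm_Lam_hf[of 0 3 u] by (simp add: Lam_values)
  then show "Rel 0 3 0 a" "Rel 0 3 a 3" "Rel 0 3 a b"
    using a b unfolding Rel_def Lam_anti[of 3 a] Lam_anti[of 3 b]
    by (simp_all add: Lam_values gm_values(1-8) comm_add comm_diff comm_values algebra_simps)
qed

lemma Rel_0a_0b: "Rel 0 a 0 b"
proof -
  have "comm (Lam 0 a) (Lam 0 b) = hf * (hf * (2 * (ll a b - gg a b * hh) + 2 * (ll a b + gg a b * hh)))"
    using a b by (simp add: Lam_values comm_hf[OF hf_x_pp(1) hf_x_pp(1)] comm_add comm_values)
  also have "2 * (ll a b - gg a b * hh) + 2 * (ll a b + gg a b * hh) = (ll a b + ll a b) + (ll a b + ll a b)"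
    by (simp add: algebra_simps mult_2)
  finally show ?thesis using a b by (simp add: Rel_def hf_double Lam_values gm_values(1-8))
qed

lemma Rel_a3_b3: "Rel a 3 b 3"
proof -
  have "comm (Lam a 3) (Lam b 3) = hf * (hf * (- (2 * (ll a b - gg a b * hh)) - 2 * (ll a b + gg a b * hh)))"
    using a b by (simp add: Lam_values comm_hf[OF hf_x_pp(2) hf_x_pp(2)] comm_diff comm_values)
  also have "- (2 * (ll a b - gg a b * hh)) - 2 * (ll a b + gg a b * hh)
      = (- ll a b + - ll a b) + (- ll a b + - ll a b)"
    by (simp add: algebra_simps mult_2)
  finally show ?thesis using a b by (simp only: hf_double) (simp add: Rel_def Lam_values gm_values(1-8))
qed

lemma Rel_0a_b3: "Rel 0 a b 3"
proof -
  have "comm (Lam 0 a) (Lam b 3) = hf * (hf * (2 * (ll a b + gg a b * hh) - 2 * (ll a b - gg a b * hh)))"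
    using a b by (simp add: Lam_values comm_hf[OF hf_x_pp(1) hf_x_pp(2)] comm_diff comm_add comm_values)
  also have "2 * (ll a b + gg a b * hh) - 2 * (ll a b - gg a b * hh)
      = (gg a b * hh + gg a b * hh) + (gg a b * hh + gg a b * hh)"
    by (simp add: algebra_simps mult_2)
  finally show ?thesis using a b gm_values(9)[of a b]
    by (simp only: hf_double) (simp add: Rel_def Lam_values gm_values(1-8))
qed

lemma Rel_ab_0c: "Rel a b 0 c" and Rel_ab_c3: "Rel a b c 3" if c: "c \<in> vidx m"
proof -
  have "comm (ll a b) (hf * u) = hf * comm (ll a b) u" for u
    using comm_Lam_hf[of a b u] a b by (simp add: Lam_values)
  then show "Rel a b 0 c" "Rel a b c 3"
    using a b c gm_values(9)[of b c] gm_values(9)[of a c] unfolding Rel_def Lam_anti[of a 0] Lam_anti[of b 0]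
    by (simp_all add: Lam_values gm_values(1-8) comm_add comm_diff comm_values hf_gg algebra_simps)
qed

lemma Rel_ab_cd: "Rel a b c f" if "c \<in> vidx m" "f \<in> vidx m"
  using a b that comm_values(10)[OF a b that] by (simp add: Rel_def Lam_values gm_values(9))

end

lemma Rel_0303: "Rel 0 3 0 3"
  by (simp add: Rel_def comm_zero Lam_values gm_values(1-4))

text \<open>Up to antisymmetry every pair of distinct indices is one of \<open>(0, 3)\<close>, \<open>(0, a)\<close>, \<open>(a, 3)\<close> and \<open>(a, b)\<close>.\<close>

lemma Rel_all:
  assumes "A \<le> m" "B \<le> m" "C \<le> m" "D \<le> m"
  shows "Rel A B C D"
proof -
  \<comment> \<open>the order of indices in which the ten relations above are stated\<close>
  define K where "K A B \<longleftrightarrow> A = 0 \<and> B = 3 \<or> A = 0 \<and> B \<in> vidx m \<or> A \<in> vidx m \<and> B = 3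
    \<or> A \<in> vidx m \<and> B \<in> vidx m" for A B
  have K: "A = B \<or> K A B \<or> K B A" if "A \<le> m" "B \<le> m" for A B
    using index_cases[OF that(1)] index_cases[OF that(2)] unfolding K_def by blast
  have base: "Rel A B C D" if "K A B" "K C D" for A B C D
    using that unfolding K_def
    by (elim disjE conjE)
      (simp_all add: Rel_same Rel_03_0a Rel_03_a3 Rel_03_ab Rel_swap[OF Rel_03_0a] Rel_swap[OF Rel_03_a3]
        Rel_swap[OF Rel_03_ab] Rel_0a_0b Rel_a3_b3 Rel_0a_b3 Rel_swap[OF Rel_0a_b3] Rel_ab_0c
        Rel_ab_c3 Rel_swap[OF Rel_ab_0c] Rel_swap[OF Rel_ab_c3] Rel_ab_cd Rel_0303)
  show ?thesis
    using K[OF assms(1,2)] K[OF assms(3,4)] base Rel_same Rel_flip1 Rel_flip2 by meson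
qed

text \<open>Each \<open>L\<^sub>A\<^sub>B\<close> occurs twice in the sum over ordered pairs, hence the factor one half.\<close>

definition rho :: "real mat \<Rightarrow> 'r" where
  "rho X = (\<Sum>A\<le>m. \<Sum>B\<le>m. sc (complex_of_real (eta B * X $$ (A, B) / 2)) * Lam A B)"

lemma rho_add:
  assumes "X \<in> carrier_mat (m + 1) (m + 1)" "Y \<in> carrier_mat (m + 1) (m + 1)"
  shows "rho (X + Y) = rho X + rho Y"
proof -
  have "sc (complex_of_real (eta B * (X + Y) $$ (A, B) / 2)) = sc (complex_of_real (eta B * X $$ (A, B) / 2))
      + sc (complex_of_real (eta B * Y $$ (A, B) / 2))" if "A \<le> m" "B \<le> m" for A B
  proof -
    have "eta B * (X + Y) $$ (A, B) / 2 = eta B * X $$ (A, B) / 2 + eta B * Y $$ (A, B) / 2"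
      using assms that by (simp add: field_simps)
    then show ?thesis by (simp only: of_real_add sc_add)
  qed
  then show ?thesis by (simp add: rho_def distrib_right sum.distrib)
qed

lemma rho_smult:
  assumes "X \<in> carrier_mat (m + 1) (m + 1)"
  shows "rho (c \<cdot>\<^sub>m X) = sc (complex_of_real c) * rho X"
proof -
  have "sc (complex_of_real (eta B * (c \<cdot>\<^sub>m X) $$ (A, B) / 2))
      = sc (complex_of_real c) * sc (complex_of_real (eta B * X $$ (A, B) / 2))" if "A \<le> m" "B \<le> m" for A B
  proof -
    have "eta B * (c \<cdot>\<^sub>m X) $$ (A, B) / 2 = c * (eta B * X $$ (A, B) / 2)"
      using assms that by simp
    then show ?thesis by (simp only: of_real_mult sc_mult)
  qed
  then show ?thesis by (simp add: rho_def sum_distrib_left mult.assoc)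
qed

lemma rho_Lmat:
  assumes "A \<le> m" "B \<le> m"
  shows "rho (Lmat m A B) = Lam A B"
proof -
  have coef: "sc (complex_of_real (eta j * Lmat m A B $$ (i, j) / 2)) * Lam i j
     = (if A = i then if B = j then hf * Lam A B else 0 else 0)
       - (if B = i then if A = j then hf * Lam B A else 0 else 0)" if "i \<le> m" "j \<le> m" for i j
  proof -
    have "eta j * Lmat m A B $$ (i, j) / 2
      = (if A = i \<and> B = j then 1/2 else 0) - (if B = i \<and> A = j then 1/2 else 0)"
      unfolding Lmat_entry[OF that] right_diff_distrib diff_divide_distrib
      by (rule arg_cong2[where f = "(-)"]) auto
    then have e: "sc (complex_of_real (eta j * Lmat m A B $$ (i, j) / 2))
      = sc (complex_of_real ((if A = i \<and> B = j then 1/2 else 0) - (if B = i \<and> A = j then 1/2 else 0)))"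
      by (simp only:)
    have half: "complex_of_real (if Q then 1/2 else 0) = (if Q then 1/2 else 0)" for Q
      by simp
    show ?thesis
      unfolding e of_real_diff half sc_diff left_diff_distrib
      by (rule arg_cong2[where f = "(-)"]) auto
  qed
  have delta: "(\<Sum>i\<le>m. \<Sum>j\<le>m. if C = i then if D = j then z else 0 else 0) = z"
    if "C \<le> m" "D \<le> m" for C D and z :: 'r
  proof -
    have "(\<Sum>i\<le>m. \<Sum>j\<le>m. if C = i then if D = j then z else 0 else 0)
      = (\<Sum>i\<le>m. if C = i then \<Sum>j\<le>m. if D = j then z else 0 else 0)"
      by (intro sum.cong refl) auto
    then show ?thesis using that by simp
  qed
  have "rho (Lmat m A B) = hf * Lam A B - hf * Lam B A"
  proof -
    have "rho (Lmat m A B) = (\<Sum>i\<le>m. \<Sum>j\<le>m.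
        (if A = i then if B = j then hf * Lam A B else 0 else 0)
       - (if B = i then if A = j then hf * Lam B A else 0 else 0))"
      unfolding rho_def by (intro sum.cong refl, rule coef) auto
    then show ?thesis using assms by (simp only: sum_subtractf delta)
  qed
  then show ?thesis by (simp add: Lam_anti[of B A] hf_double)
qed

lemma sum_sum_delta_left:
  assumes "B \<le> m"
  shows "(\<Sum>C\<le>m. \<Sum>D\<le>m. V C D * (gm B C * F D)) = (\<Sum>D\<le>m. V B D * (gm B B * F D))"
proof -
  have "(\<Sum>C\<le>m. \<Sum>D\<le>m. V C D * (gm B C * F D)) = (\<Sum>C\<le>m. if B = C then \<Sum>D\<le>m. V B D * (gm B B * F D) else 0)"
    by (intro sum.cong refl) (auto simp: gm_def)
  then show ?thesis using assms by simp
qed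

lemma sum_sum_delta_right:
  assumes "B \<le> m"
  shows "(\<Sum>C\<le>m. \<Sum>D\<le>m. V C D * (gm B D * F C)) = (\<Sum>C\<le>m. V C B * (gm B B * F C))"
proof -
  have "(\<Sum>D\<le>m. V C D * (gm B D * F C)) = (\<Sum>D\<le>m. if B = D then V C B * (gm B B * F C) else 0)" for C
    by (intro sum.cong refl) (auto simp: gm_def)
  then show ?thesis using assms by simp
qed

text \<open>Each of the four terms of the commutation relation contributes the same double sum, a quarter of
  \<open>\<Sum> \<eta>\<^sub>D (X Y)\<^sub>A\<^sub>D L\<^sub>A\<^sub>D\<close>, by antisymmetry of the coefficients. The sum over \<open>X Y - Y X\<close> gives the same
  because \<open>\<eta>\<^sub>D (Y X)\<^sub>A\<^sub>D = \<eta>\<^sub>A (X Y)\<^sub>D\<^sub>A\<close>.\<close>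

lemma rho_bracket:
  assumes X: "X \<in> lie_g m" and Y: "Y \<in> lie_g m"
  shows "rho (X * Y - Y * X) = rho X * rho Y - rho Y * rho X"
proof -
  note Xc = lie_g_carrier[OF X] and Yc = lie_g_carrier[OF Y]
  define u where "u A B = eta B * X $$ (A, B) / 2" for A B
  define v where "v A B = eta B * Y $$ (A, B) / 2" for A B
  let ?s = "\<lambda>r. sc (complex_of_real r)"
  have anti: "eta A * Z $$ (B, A) / 2 = - (eta B * Z $$ (A, B) / 2)"
    if "Z \<in> lie_g m" "A \<le> m" "B \<le> m" for Z A B
  proof -
    have "eta A * Z $$ (B, A) = eta A * eta B * (eta B * Z $$ (B, A))" by (simp add: mult.assoc)
    also have "\<dots> = eta A * eta B * (- (eta A * Z $$ (A, B)))"
      using lie_g_flip[OF that(1,3,2)] by simp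
    finally show ?thesis by (simp add: mult.left_commute[of "eta B"])
  qed
  have su: "?s (u B A) = - ?s (u A B)" if "A \<le> m" "B \<le> m" for A B
    using anti[OF X that] by (simp add: u_def sc_uminus)
  have sv: "?s (v B A) = - ?s (v A B)" if "A \<le> m" "B \<le> m" for A B
    using anti[OF Y that] by (simp add: v_def sc_uminus)
  have inner: "comm (Lam A B) (rho Y) =
      2 * (\<Sum>D\<le>m. ?s (v B D) * (gm B B * Lam A D)) - 2 * (\<Sum>D\<le>m. ?s (v A D) * (gm A A * Lam B D))"
    if AB: "A \<le> m" "B \<le> m" for A B
  proof -
    have "comm (Lam A B) (rho Y) = (\<Sum>C\<le>m. \<Sum>D\<le>m. ?s (v C D) *
        (gm B C * Lam A D - gm B D * Lam A C - gm A C * Lam B D + gm A D * Lam B C))"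
      unfolding rho_def comm_sum v_def
      using Rel_all[OF AB] by (intro sum.cong refl) (simp add: comm_sc(2)[OF sc_Lam] Rel_def)
    also have "\<dots> = (\<Sum>C\<le>m. \<Sum>D\<le>m. ?s (v C D) * (gm B C * Lam A D))
      - (\<Sum>C\<le>m. \<Sum>D\<le>m. ?s (v C D) * (gm B D * Lam A C))
      - (\<Sum>C\<le>m. \<Sum>D\<le>m. ?s (v C D) * (gm A C * Lam B D))
      + (\<Sum>C\<le>m. \<Sum>D\<le>m. ?s (v C D) * (gm A D * Lam B C))"
      by (simp only: distrib_left right_diff_distrib sum.distrib sum_subtractf)
    also have "\<dots> = (\<Sum>D\<le>m. ?s (v B D) * (gm B B * Lam A D)) - (\<Sum>D\<le>m. ?s (v D B) * (gm B B * Lam A D))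
      - (\<Sum>D\<le>m. ?s (v A D) * (gm A A * Lam B D)) + (\<Sum>D\<le>m. ?s (v D A) * (gm A A * Lam B D))"
      using AB by (simp only: sum_sum_delta_left sum_sum_delta_right)
    also have "(\<Sum>D\<le>m. ?s (v D B) * (gm B B * Lam A D)) = - (\<Sum>D\<le>m. ?s (v B D) * (gm B B * Lam A D))"
      unfolding sum_negf[symmetric] using AB by (intro sum.cong refl) (simp add: sv[OF AB(2)])
    also have "(\<Sum>D\<le>m. ?s (v D A) * (gm A A * Lam B D)) = - (\<Sum>D\<le>m. ?s (v A D) * (gm A A * Lam B D))"
      unfolding sum_negf[symmetric] using AB by (intro sum.cong refl) (simp add: sv[OF AB(1)])
    finally show ?thesis by (simp add: mult_2)
  qed
  define T where "T = (\<Sum>A\<le>m. \<Sum>B\<le>m. ?s (u A B) * (\<Sum>D\<le>m. ?s (v B D) * (gm B B * Lam A D)))"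
  have T': "(\<Sum>A\<le>m. \<Sum>B\<le>m. ?s (u A B) * (\<Sum>D\<le>m. ?s (v A D) * (gm A A * Lam B D))) = - T"
    unfolding T_def sum_negf[symmetric]
    by (subst sum.swap) (intro sum.cong refl, subst su, auto)
  have "rho X * rho Y - rho Y * rho X = comm (rho X) (rho Y)" by (simp add: comm_def)
  also have "\<dots> = (\<Sum>A\<le>m. \<Sum>B\<le>m. ?s (u A B) * comm (Lam A B) (rho Y))"
  proof -
    have "sc c * rho Y = rho Y * sc c" for c
      unfolding rho_def sum_distrib_left sum_distrib_right
      by (intro sum.cong refl sc_prod sc_sc sc_Lam)
    then show ?thesis
      unfolding rho_def[of X] comm_sum u_def by (simp add: comm_sc)
  qed
  also have "\<dots> = 2 * T - 2 * (\<Sum>A\<le>m. \<Sum>B\<le>m. ?s (u A B) * (\<Sum>D\<le>m. ?s (v A D) * (gm A A * Lam B D)))"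
  proof -
    have "(\<Sum>A\<le>m. \<Sum>B\<le>m. ?s (u A B) * comm (Lam A B) (rho Y))
      = (\<Sum>A\<le>m. \<Sum>B\<le>m. ?s (u A B) * (2 * (\<Sum>D\<le>m. ?s (v B D) * (gm B B * Lam A D))
          - 2 * (\<Sum>D\<le>m. ?s (v A D) * (gm A A * Lam B D))))"
      by (intro sum.cong refl) (simp only: inner atMost_iff)
    then show ?thesis
      by (simp add: T_def right_diff_distrib sum_subtractf mult_2 distrib_left sum.distrib)
  qed
  also have "\<dots> = 2 * T + 2 * T" unfolding T' by simp
  finally have c1: "rho X * rho Y - rho Y * rho X = 2 * T + 2 * T" .
  \<comment> \<open>the common value of both sides is the sum for \<open>c = 1\<close>; the factors 1/2 and 1/4 come from the halves in
    the coefficients of one matrix and of two matrices\<close>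
  define S where "S c = (\<Sum>A\<le>m. \<Sum>D\<le>m. ?s (eta D * (X * Y) $$ (A, D) / c) * Lam A D)" for c
  have T: "T = S 4"
  proof -
    have "(\<Sum>B\<le>m. ?s (u A B) * (?s (v B D) * (gm B B * Lam A D)))
        = ?s (eta D * (X * Y) $$ (A, D) / 4) * Lam A D" if "A \<le> m" "D \<le> m" for A D
    proof -
      have "(X * Y) $$ (A, D) = (\<Sum>B<m + 1. X $$ (A, B) * Y $$ (B, D))"
        using Xc Yc that by (intro mat_mult_entry) auto
      then have "eta D * (X * Y) $$ (A, D) / 4 = (\<Sum>B<m + 1. u A B * (v B D * eta B))"
        unfolding sum_distrib_left sum_divide_distrib
      proof (simp only: sum_distrib_left sum_divide_distrib, intro sum.cong refl)
        fix B
        have "p * s / 2 * (q * t / 2 * p) = p * p * (q * (s * t) / 4)" for p q s t :: real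
          by (simp only: times_divide_eq_left times_divide_eq_right divide_divide_eq_left mult_ac)
        from this[of "eta B" "X $$ (A, B)" "eta D" "Y $$ (B, D)"]
        show "eta D * (X $$ (A, B) * Y $$ (B, D)) / 4 = u A B * (v B D * eta B)"
          by (simp add: u_def v_def)
      qed
      also have "\<dots> = (\<Sum>B\<le>m. u A B * (v B D * eta B))" by (simp add: lessThan_Suc_atMost)
      finally have "?s (eta D * (X * Y) $$ (A, D) / 4) = (\<Sum>B\<le>m. ?s (u A B) * (?s (v B D) * ?s (eta B)))"
        by (simp only: of_real_sum of_real_mult sc_sum sc_mult)
      then show ?thesis
        by (simp only: sum_distrib_right) (simp add: gm_def mult.assoc)
    qed
    note entry = this
    have "(\<Sum>B\<le>m. \<Sum>D\<le>m. ?s (u A B) * (?s (v B D) * (gm B B * Lam A D)))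
        = (\<Sum>D\<le>m. ?s (eta D * (X * Y) $$ (A, D) / 4) * Lam A D)" if "A \<le> m" for A
      by (subst sum.swap, rule sum.cong[OF refl]) (use that entry in auto)
    then show ?thesis
      unfolding T_def S_def sum_distrib_left by simp
  qed
  have S24: "S 2 = S 4 + S 4"
  proof -
    have "?s (r / 2) = ?s (r / 4) + ?s (r / 4)" for r
      unfolding sc_add[symmetric] of_real_add[symmetric] by (rule arg_cong[of _ _ ?s]) simp
    then show ?thesis by (simp only: S_def distrib_right sum.distrib)
  qed
  have P: "X * Y \<in> carrier_mat (m + 1) (m + 1)" "Y * X \<in> carrier_mat (m + 1) (m + 1)"
    using Xc Yc by auto
  have "rho (X * Y - Y * X)
    = (\<Sum>A\<le>m. \<Sum>D\<le>m. (?s (eta D * (X * Y) $$ (A, D) / 2) - ?s (eta A * (X * Y) $$ (D, A) / 2)) * Lam A D)"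
    unfolding rho_def
  proof (intro sum.cong refl)
    fix A D assume "A \<in> {..m}" "D \<in> {..m}"
    then have AD: "A \<le> m" "D \<le> m" by auto
    have "eta D * (Y * X) $$ (A, D) = eta A * eta D * (eta A * (Y * X) $$ (A, D))"
      by (simp add: mult.left_commute[of _ "eta D"])
    also have "\<dots> = eta A * (X * Y) $$ (D, A)"
      unfolding lie_g_product_flip[OF Y X AD] by (simp add: mult.assoc)
    finally have flip: "eta D * (Y * X) $$ (A, D) = eta A * (X * Y) $$ (D, A)" .
    have "eta D * (X * Y - Y * X) $$ (A, D) / 2
        = eta D * (X * Y) $$ (A, D) / 2 - eta A * (X * Y) $$ (D, A) / 2"
    proof -
      have "(X * Y - Y * X) $$ (A, D) = (X * Y) $$ (A, D) - (Y * X) $$ (A, D)"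
        using carrier_matD[OF P(2)] AD by (intro index_minus_mat(1)) simp_all
      then show ?thesis
        using flip
        by (simp add: right_diff_distrib diff_divide_distrib del: index_mult_mat(1))
    qed
    then show "?s (eta D * (X * Y - Y * X) $$ (A, D) / 2) * Lam A D
        = (?s (eta D * (X * Y) $$ (A, D) / 2) - ?s (eta A * (X * Y) $$ (D, A) / 2)) * Lam A D"
      by (simp only: of_real_diff sc_diff)
  qed
  also have "\<dots> = S 2 - (\<Sum>A\<le>m. \<Sum>D\<le>m. ?s (eta A * (X * Y) $$ (D, A) / 2) * Lam A D)"
    by (simp only: S_def left_diff_distrib sum_subtractf)
  also have "(\<Sum>A\<le>m. \<Sum>D\<le>m. ?s (eta A * (X * Y) $$ (D, A) / 2) * Lam A D) = - S 2"
    unfolding S_def sum_negf[symmetric]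
    by (subst sum.swap) (intro sum.cong refl, subst Lam_anti, simp only: mult_minus_right)
  finally show ?thesis unfolding c1 T S24 by (simp add: mult_2)
qed

end

section \<open>The polynomial model of the Verma module\<close>

lemma conformal_op: "conformal sc xop dop m lam"
proof
  fix a b :: nat and p q c :: complex
  have remove: "a \<noteq> b \<Longrightarrow> b \<in># A - {#a#} \<longleftrightarrow> b \<in># A" for a b :: nat and A
    by (simp flip: count_greater_zero_iff)
  show "xop a * xop b = xop b * xop a"
    by (cases "a = b", simp, rule op_eqI)
      (auto simp: app_simps app_xop add_mset_commute remove)
  show "dop a * dop b = dop b * dop a"
    by (rule op_eqI) (auto simp: app_simps app_dop add_mset_commute)
  show "dop a * xop b = xop b * dop a + (if a = b then 1 else 0)"
  proof (rule op_eqI)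
    fix u A
    show "app (dop a * xop b) u A = app (xop b * dop a + (if a = b then 1 else 0)) u A"
    proof (cases "a = b")
      case True
      then show ?thesis
        by (cases "b \<in># A") (auto simp: app_simps app_xop app_dop insert_DiffM algebra_simps of_nat_diff
            not_in_iff count_greater_zero_iff[symmetric] simp del: count_greater_zero_iff)
    next
      case False
      then show ?thesis
        by (cases "b \<in># A") (auto simp: app_simps app_xop app_dop diff_add_mset_swap)
    qed
  qed
  show "sc 1 = 1" "sc (p + q) = sc p + sc q" "sc (p * q) = sc p * sc q"
    by (rule op_eqI; simp add: app_simps app_sc algebra_simps)+
  show "sc c * xop a = xop a * sc c" "sc c * dop a = dop a * sc c"
    by (rule op_eqI; simp add: app_simps app_sc app_xop app_dop)+
  show "sc (complex_of_real (eta a)) = 1 \<or> sc (complex_of_real (eta a)) = - 1"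
  proof (cases "a < 2")
    case True
    have "sc (- 1) = - 1" by (rule op_eqI) (simp add: app_simps app_sc)
    then show ?thesis using True by (simp add: eta_def)
  next
    case False
    have "sc 1 = 1" by (rule op_eqI) (simp add: app_simps app_sc)
    then show ?thesis using False by (simp add: eta_def)
  qed
qed auto

definition vac :: "nat multiset \<Rightarrow> complex" where
  "vac A = (if A = {#} then 1 else 0)"

lemma app_dop_vac: "app (dop a) vac = (\<lambda>A. 0)"
  by (rule ext) (simp add: app_dop vac_def)

abbreviation Rho :: "nat \<Rightarrow> complex \<Rightarrow> real mat \<Rightarrow> weyl_op" where
  "Rho m lam \<equiv> conformal.rho sc xop dop m lam"

text \<open>The action of the free algebra, and the value \<open>ev\<close> on the constant polynomial 1: the image of an
  element in the polynomial model.\<close>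

definition act :: "nat \<Rightarrow> complex \<Rightarrow> free_algebra \<Rightarrow> weyl_op" where
  "act m lam = lin_ext sc (\<lambda>w. prod_list (map (Rho m lam) (letters w)))"

definition ev :: "nat \<Rightarrow> complex \<Rightarrow> free_algebra \<Rightarrow> nat multiset \<Rightarrow> complex" where
  "ev m lam p = app (act m lam p) vac"

definition nmon :: "nat \<Rightarrow> nat list \<Rightarrow> free_algebra" where
  "nmon m as = prod_list (map (\<lambda>a. gen (Nmat m a)) as)"

text \<open>Linear combinations of ordered monomials in the \<open>N\<^sub>a\<close>. Multisets index the monomials on both sides,
  so such a combination is recovered from its image in the model.\<close>

definition comb :: "nat \<Rightarrow> nat multiset set \<Rightarrow> (nat multiset \<Rightarrow> complex) \<Rightarrow> free_algebra" where
  "comb m S c = (\<Sum>A\<in>S. scal (c A) * nmon m (sorted_list_of_multiset A))"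

context
  fixes m :: nat and lam :: complex
  assumes m: "m \<ge> 4"
begin

interpretation conformal sc xop dop m lam by (rule conformal_op)

lemma sc_rho: "sc c * rho X = rho X * sc c"
  unfolding rho_def sum_distrib_left sum_distrib_right
  by (intro sum.cong refl sc_prod sc_sc sc_Lam)

lemma word_representation_act:
  "word_representation sc (\<lambda>w. prod_list (map (Rho m lam) (letters w)))"
proof
  fix a b :: complex and v w :: "real mat word"
  show "sc 1 = 1" "sc (a + b) = sc a + sc b" "sc (a * b) = sc a * sc b"
    by (fact sc_one sc_add sc_mult)+
  show "prod_list (map rho (letters 0)) = 1" by (simp add: zero_word_def)
  show "prod_list (map rho (letters (v + w))) = prod_list (map rho (letters v)) * prod_list (map rho (letters w))"
    by (simp add: plus_word_def)
  have "sc a * prod_list (map rho xs) = prod_list (map rho xs) * sc a" for xs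
  proof (induction xs)
    case (Cons X xs)
    then show ?case using sc_prod[OF sc_rho Cons] by simp
  qed simp
  then show "sc a * prod_list (map rho (letters w)) = prod_list (map rho (letters w)) * sc a" .
qed

lemma act_simps:
  "act m lam 0 = 0" "act m lam 1 = 1" "act m lam (p + q) = act m lam p + act m lam q"
  "act m lam (p - q) = act m lam p - act m lam q" "act m lam (p * q) = act m lam p * act m lam q"
  "act m lam (scal c) = sc c" "act m lam (gen X) = Rho m lam X" "act m lam (p ^ k) = act m lam p ^ k"
  "act m lam (sum f S) = (\<Sum>i\<in>S. act m lam (f i))"
proof -
  interpret W: word_representation sc "\<lambda>w. prod_list (map (Rho m lam) (letters w))"
    by (rule word_representation_act)
  show "act m lam 0 = 0" "act m lam 1 = 1" "act m lam (p + q) = act m lam p + act m lam q"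
    "act m lam (p - q) = act m lam p - act m lam q" "act m lam (p * q) = act m lam p * act m lam q"
    "act m lam (scal c) = sc c" "act m lam (gen X) = Rho m lam X" "act m lam (p ^ k) = act m lam p ^ k"
    "act m lam (sum f S) = (\<Sum>i\<in>S. act m lam (f i))"
    by (simp_all add: act_def W.lin_ext_add W.lin_ext_diff W.lin_ext_mult W.lin_ext_power W.lin_ext_sum
        scal_def gen_def W.\<psi>_zero W.s_one)
qed

lemma act_env_ideal: "p \<in> env_ideal (lie_g m) \<Longrightarrow> act m lam p = 0"
proof -
  have "env_ideal (lie_g m) \<subseteq> {p \<in> words_over (lie_g m). act m lam p = 0}"
  proof (rule env_ideal_least)
    show "env_relations (lie_g m) \<subseteq> {p \<in> words_over (lie_g m). act m lam p = 0}"
      using lie_g_carrier[of _ m] rho_add rho_smult rho_bracket lie_g_add[of _ m] lie_g_smult[of _ m]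
        lie_g_bracket[of _ m]
      by (auto simp: env_relations_def act_simps)
  qed (auto simp: act_simps)
  then show "p \<in> env_ideal (lie_g m) \<Longrightarrow> act m lam p = 0" by blast
qed

lemma rho_Nmat: "a \<in> vidx m \<Longrightarrow> rho (Nmat m a) = xop a"
  and rho_Pmat: "a \<in> vidx m \<Longrightarrow> rho (Pmat m a) = pp a"
proof -
  assume a: "a \<in> vidx m"
  have L: "rho (Lmat m 0 a) = hf * (xop a + pp a)" "rho (Lmat m a 3) = hf * (xop a - pp a)"
    using a m vidx_le[OF m a] by (simp_all add: rho_Lmat Lam_values)
  have "rho (Nmat m a) = hf * (xop a + pp a) + hf * (xop a - pp a)"
    unfolding Nmat_def by (subst rho_add) (auto simp: L)
  also have "\<dots> = hf * (xop a + xop a)" by (simp add: algebra_simps)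
  finally show "rho (Nmat m a) = xop a" by (simp only: hf_double)
  have "Pmat m a = Lmat m 0 a + (- 1) \<cdot>\<^sub>m Lmat m a 3"
    unfolding Pmat_def by (rule eq_matI) auto
  then have "rho (Pmat m a) = hf * (xop a + pp a) - hf * (xop a - pp a)"
    by (simp only:) (subst rho_add, auto simp: rho_smult L sc_uminus sc_one)
  also have "\<dots> = hf * (pp a + pp a)" by (simp add: algebra_simps)
  finally show "rho (Pmat m a) = pp a" by (simp only: hf_double)
qed

lemma vacuum:
  "app Eu vac = (\<lambda>A. 0)" "app Lap vac = (\<lambda>A. 0)" "app hh vac = (\<lambda>A. lam * vac A)"
  "app (pp a) vac = (\<lambda>A. 0)" "app (ll a b) vac = (\<lambda>A. 0)"
  by (simp_all add: Eu_def Lap_def hh_def pp_def ll_def app_sum app_simps app_dop_vac app_zero app_sc fun_eq_iff)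

text \<open>The constant polynomial satisfies the relations that define the Verma module, so the Verma
  module maps to the model.\<close>

lemma parabolic_vacuum:
  "X \<in> parabolic m \<Longrightarrow> X \<in> carrier_mat (m + 1) (m + 1) \<and>
    app (rho X) vac = (\<lambda>A. complex_of_real (X $$ (0, 3)) * lam * vac A)"
proof (induction rule: parabolic_induct[OF m, consumes 1])
  case 1
  have "rho (0\<^sub>m (m + 1) (m + 1)) = 0" by (simp add: rho_def)
  then show ?case using m by (simp add: app_simps)
next
  case (2 X Y)
  moreover have "(X + Y) $$ (0, 3) = X $$ (0, 3) + Y $$ (0, 3)"
    using 2 m by (intro index_add_mat(1)) auto
  ultimately show ?case by (simp add: rho_add app_simps algebra_simps)
next
  case (3 c X)
  moreover have "(c \<cdot>\<^sub>m X) $$ (0, 3) = c * X $$ (0, 3)"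
    using 3 m by (intro index_smult_mat(1)) auto
  ultimately show ?case by (simp add: rho_smult app_simps app_sc algebra_simps)
next
  case (4 a b)
  then show ?case using m vidx_le[OF m] vidx_props[of a m] vidx_props[of b m]
    by (simp add: rho_Lmat Lam_values vacuum Lmat_entry)
next
  case 5
  then show ?case using m by (simp add: rho_Lmat Lam_values vacuum Lmat_entry eta_def)
next
  case (6 a)
  then have "Pmat m a $$ (0, 3) = 0"
    using m vidx_props[of a m] by (simp add: Pmat_def Lmat_entry)
  then show ?case using 6 by (simp add: rho_Pmat vacuum)
qed

lemma ev_simps:
  "ev m lam (p + q) = (\<lambda>A. ev m lam p A + ev m lam q A)"
  "ev m lam (p - q) = (\<lambda>A. ev m lam p A - ev m lam q A)"
  "ev m lam (p * q) = app (act m lam p) (ev m lam q)"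
  "ev m lam 0 = (\<lambda>A. 0)" "ev m lam 1 = vac"
  by (simp_all add: ev_def act_simps app_simps)

lemma ev_verma_ideal: "p \<in> verma_ideal m lam \<Longrightarrow> ev m lam p = (\<lambda>A. 0)"
proof -
  have "verma_ideal m lam \<subseteq> {p \<in> words_over (lie_g m). ev m lam p = (\<lambda>A. 0)}" (is "_ \<subseteq> ?K")
  proof (rule verma_ideal_least[OF m])
    show "left_ideal (lie_g m) ?K"
      unfolding left_ideal_def using env_ideal_subset[OF lie_closed_lie_g]
      by (auto simp: ev_simps app_zero) (auto simp: ev_def act_env_ideal app_simps)
    fix X assume X: "X \<in> parabolic m"
    then show "gen X - scal (complex_of_real (X $$ (0, 3)) * lam) \<in> ?K"
      using parabolic_vacuum[OF X] parabolic_lie_g[OF m X]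
      by (auto simp: ev_def act_simps app_simps app_sc)
  qed
  then show "p \<in> verma_ideal m lam \<Longrightarrow> ev m lam p = (\<lambda>A. 0)" by blast
qed

lemma nmon_in_words: "set as \<subseteq> vidx m \<Longrightarrow> nmon m as \<in> words_over (lie_g m)"
  by (induction as) (auto simp: nmon_def Nmat_lie_g[OF m])

lemma ev_nmon: "set as \<subseteq> vidx m \<Longrightarrow> ev m lam (nmon m as) = (\<lambda>A. if A = mset as then 1 else 0)"
proof (induction as)
  case Nil
  then show ?case by (simp add: nmon_def ev_simps) (simp add: vac_def fun_eq_iff)
next
  case (Cons a as)
  have "ev m lam (nmon m (a # as)) = app (xop a) (\<lambda>A. if A = mset as then 1 else 0)"
    using Cons by (simp add: nmon_def ev_simps act_simps rho_Nmat)
  also have "\<dots> = (\<lambda>A. if A = mset (a # as) then 1 else 0)"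
    by (rule ext) (auto simp: app_xop, metis insert_DiffM)
  finally show ?case .
qed

text \<open>Generators of \<open>n\<^sup>-\<close> commute modulo the defining ideal, so a new factor can be moved to its place in
  the ordered monomial.\<close>

lemma nmon_insort:
  assumes "a \<in> vidx m" "set as \<subseteq> vidx m"
  shows "gen (Nmat m a) * nmon m as - nmon m (insort a as) \<in> env_ideal (lie_g m)"
  using assms(2)
proof (induction as)
  case Nil
  then show ?case using env_ideal_closed(1)[OF lie_closed_lie_g] by (simp add: nmon_def)
next
  case (Cons b as)
  note L = lie_closed_lie_g[of m]
  let ?I = "env_ideal (lie_g m)" and ?g = "\<lambda>a. gen (Nmat m a)"
  show ?case
  proof (cases "a \<le> b")
    case True
    then show ?thesis using env_ideal_closed(1)[OF L] by (simp add: nmon_def)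
  next
    case False
    have w: "nmon m as \<in> words_over (lie_g m)" using Cons by (intro nmon_in_words) auto
    have zero: "gen (0\<^sub>m (m + 1) (m + 1)) \<in> ?I"
    proof -
      have "(0::real) \<cdot>\<^sub>m 0\<^sub>m (m + 1) (m + 1) = 0\<^sub>m (m + 1) (m + 1)" by auto
      then show ?thesis
        using env_ideal_relations(2)[OF L zero_lie_g, of 0] by (simp add: scal_simps)
    qed
    have "Nmat m a * Nmat m b - Nmat m b * Nmat m a = 0\<^sub>m (m + 1) (m + 1)"
      using Nmat_commute[OF m assms(1), of b] Cons(2)
        minus_r_inv_mat[of "Nmat m b * Nmat m a" "m + 1" "m + 1"] by auto
    then have "?g a * ?g b - ?g b * ?g a - gen (0\<^sub>m (m + 1) (m + 1)) \<in> ?I"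
      using env_ideal_relations(3)[OF L Nmat_lie_g[OF m] Nmat_lie_g[OF m], of a b] by simp
    from env_ideal_closed(2)[OF L this zero]
    have c: "?g a * ?g b - ?g b * ?g a \<in> ?I" by simp
    have "(?g a * ?g b - ?g b * ?g a) * nmon m as \<in> ?I"
      by (rule env_ideal_closed(4)[OF L w c])
    moreover have "?g b * (?g a * nmon m as - nmon m (insort a as)) \<in> ?I"
      using Cons Nmat_lie_g[OF m] by (intro env_ideal_closed(3)[OF L]) auto
    ultimately have "(?g a * ?g b - ?g b * ?g a) * nmon m as
        + ?g b * (?g a * nmon m as - nmon m (insort a as)) \<in> ?I"
      by (rule env_ideal_closed(2)[OF L])
    moreover have "(?g a * ?g b - ?g b * ?g a) * nmon m as
        + ?g b * (?g a * nmon m as - nmon m (insort a as))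
      = ?g a * nmon m (b # as) - nmon m (insort a (b # as))"
      using False by (simp add: nmon_def algebra_simps)
    ultimately show ?thesis by simp
  qed
qed

abbreviation (input) "over A \<equiv> set_mset A \<subseteq> vidx m"

lemma ev_comb:
  assumes "finite S" "\<And>A. A \<in> S \<Longrightarrow> over A"
  shows "ev m lam (comb m S c) = (\<lambda>A. if A \<in> S then c A else 0)"
proof
  fix B
  have "ev m lam (comb m S c) B = (\<Sum>A\<in>S. ev m lam (scal (c A) * nmon m (sorted_list_of_multiset A)) B)"
    by (simp add: comb_def ev_def act_simps app_sum)
  also have "\<dots> = (\<Sum>A\<in>S. if B = A then c A else 0)"
    using assms(2) by (intro sum.cong refl) (simp add: ev_simps act_simps app_sc ev_nmon)
  finally show "ev m lam (comb m S c) B = (if B \<in> S then c B else 0)" using assms(1) by simp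
qed

text \<open>Elements congruent to a combination of ordered monomials. The aim is to show that all elements are,
  which makes the polynomial model faithful.\<close>

definition reducible :: "free_algebra set" where
  "reducible = {p \<in> words_over (lie_g m). \<exists>S c. finite S \<and> (\<forall>A\<in>S. over A) \<and> p - comb m S c \<in> verma_ideal m lam}"

lemma verma_left: "left_ideal (lie_g m) (verma_ideal m lam)"
  by (rule left_ideal_verma_ideal[OF m])

lemma comb_extend:
  assumes "finite S'" "S \<subseteq> S'"
  shows "comb m S c = comb m S' (\<lambda>A. if A \<in> S then c A else 0)"
  unfolding comb_def using assms
  by (intro sum.mono_neutral_cong_left) (auto simp: scal_simps)

lemma reducible_add: "p \<in> reducible \<Longrightarrow> q \<in> reducible \<Longrightarrow> p + q \<in> reducible"
proof -
  assume "p \<in> reducible" "q \<in> reducible"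
  then obtain S c S' c' where
    1: "p \<in> words_over (lie_g m)" "finite S" "\<forall>A\<in>S. over A" "p - comb m S c \<in> verma_ideal m lam" and
    2: "q \<in> words_over (lie_g m)" "finite S'" "\<forall>A\<in>S'. over A" "q - comb m S' c' \<in> verma_ideal m lam"
    unfolding reducible_def by blast
  let ?S = "S \<union> S'"
  let ?c = "\<lambda>A. (if A \<in> S then c A else 0) + (if A \<in> S' then c' A else 0)"
  have "comb m ?S ?c = comb m S c + comb m S' c'"
    using comb_extend[of ?S S c] comb_extend[of ?S S' c'] 1 2
    by (simp add: comb_def scal_simps(3) distrib_right sum.distrib)
  then have e: "p + q - comb m ?S ?c = (p - comb m S c) + (q - comb m S' c')"
    by (simp only:) (simp add: algebra_simps)
  have "p + q - comb m ?S ?c \<in> verma_ideal m lam"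
    unfolding e by (rule left_idealD(3)[OF verma_left 1(4) 2(4)])
  moreover have "finite ?S" "\<forall>A\<in>?S. over A" using 1 2 by auto
  ultimately show ?thesis using 1 2 unfolding reducible_def by blast
qed

lemma reducible_ideal: "p \<in> verma_ideal m lam \<Longrightarrow> p \<in> reducible"
  unfolding reducible_def using left_idealD(1)[OF verma_left]
  by (auto intro!: exI[of _ "{}"] simp: comb_def)

lemma reducible_env: "p \<in> env_ideal (lie_g m) \<Longrightarrow> p \<in> reducible"
  using reducible_ideal left_idealD(2)[OF verma_left] by blast

lemma reducible_scal: "p \<in> reducible \<Longrightarrow> scal d * p \<in> reducible"
proof -
  assume "p \<in> reducible"
  then obtain S c where
    1: "p \<in> words_over (lie_g m)" "finite S" "\<forall>A\<in>S. over A" "p - comb m S c \<in> verma_ideal m lam"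
    unfolding reducible_def by blast
  have "scal d * p - comb m S (\<lambda>A. d * c A) = scal d * (p - comb m S c)"
    by (simp add: comb_def scal_simps(4) right_diff_distrib sum_distrib_left mult.assoc)
  then have "scal d * p - comb m S (\<lambda>A. d * c A) \<in> verma_ideal m lam"
    using left_idealD(4)[OF verma_left words_over_closed(3) 1(4)] by simp
  then show ?thesis using 1 unfolding reducible_def by blast
qed

lemma reducible_sum: "(\<And>i. i \<in> S \<Longrightarrow> f i \<in> reducible) \<Longrightarrow> sum f S \<in> reducible"
  by (induction S rule: infinite_finite_induct)
    (auto intro: reducible_add reducible_ideal left_idealD(2)[OF verma_left] env_ideal_closed(1)[OF lie_closed_lie_g])

lemma reducible_one: "1 \<in> reducible"
  unfolding reducible_def
  using left_idealD(2)[OF verma_left] env_ideal_closed(1)[OF lie_closed_lie_g[of m]]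
  by (auto intro!: exI[of _ "{{#}}"] exI[of _ "\<lambda>_. 1"] simp: comb_def nmon_def scal_simps)

lemma reducible_diff: "p - q \<in> reducible \<Longrightarrow> q \<in> reducible \<Longrightarrow> p \<in> reducible"
  using reducible_add[of "p - q" q] by simp

lemma reducible_words: "p \<in> reducible \<Longrightarrow> p \<in> words_over (lie_g m)"
  by (simp add: reducible_def)

lemma reducible_N:
  assumes a: "a \<in> vidx m" and p: "p \<in> reducible"
  shows "gen (Nmat m a) * p \<in> reducible"
proof -
  note L = lie_closed_lie_g[of m]
  let ?g = "gen (Nmat m a)"
  have g: "?g \<in> words_over (lie_g m)" using Nmat_lie_g[OF m] by auto
  obtain S c where
    1: "p \<in> words_over (lie_g m)" "finite S" "\<forall>A\<in>S. over A" "p - comb m S c \<in> verma_ideal m lam"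
    using p unfolding reducible_def by blast
  let ?s = "sorted_list_of_multiset"
  have "?g * comb m S c - comb m (add_mset a ` S) (\<lambda>B. c (B - {#a#}))
      = (\<Sum>A\<in>S. scal (c A) * (?g * nmon m (?s A) - nmon m (?s (add_mset a A))))"
  proof -
    have "comb m (add_mset a ` S) (\<lambda>B. c (B - {#a#})) = (\<Sum>A\<in>S. scal (c A) * nmon m (?s (add_mset a A)))"
      unfolding comb_def by (subst sum.reindex) (auto simp: inj_on_def)
    moreover have "?g * (scal (c A) * q) = scal (c A) * (?g * q)" for A q
      by (simp add: scal_commute[of "c A" ?g, symmetric] flip: mult.assoc)
    ultimately show ?thesis
      by (simp add: comb_def sum_distrib_left right_diff_distrib sum_subtractf)
  qed
  also have "\<dots> \<in> env_ideal (lie_g m)"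
  proof -
    have "scal (c A) * (?g * nmon m (?s A) - nmon m (?s (add_mset a A))) \<in> env_ideal (lie_g m)" if "A \<in> S" for A
      using nmon_insort[OF a, of "?s A"] 1(3) that env_ideal_closed(3)[OF L words_over_closed(3)]
      by simp
    then show ?thesis
      using env_ideal_closed[OF L] by (induction S rule: infinite_finite_induct) auto
  qed
  finally have "?g * comb m S c - comb m (add_mset a ` S) (\<lambda>B. c (B - {#a#})) \<in> verma_ideal m lam"
    using left_idealD(2)[OF verma_left] by blast
  from left_idealD(3)[OF verma_left this left_idealD(4)[OF verma_left g 1(4)]]
  have "?g * p - comb m (add_mset a ` S) (\<lambda>B. c (B - {#a#})) \<in> verma_ideal m lam"
    by (simp add: algebra_simps)
  moreover have "finite (add_mset a ` S)" "\<forall>A\<in>add_mset a ` S. over A" using 1 a by auto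
  ultimately show ?thesis using 1 g unfolding reducible_def by blast
qed

lemma reducible_gen_linear:
  assumes p: "p \<in> reducible"
  shows "gen (0\<^sub>m (m + 1) (m + 1)) * p \<in> reducible"
    "X \<in> lie_g m \<Longrightarrow> Y \<in> lie_g m \<Longrightarrow> gen X * p \<in> reducible \<Longrightarrow> gen Y * p \<in> reducible \<Longrightarrow>
      gen (X + Y) * p \<in> reducible"
    "X \<in> lie_g m \<Longrightarrow> gen X * p \<in> reducible \<Longrightarrow> gen (r \<cdot>\<^sub>m X) * p \<in> reducible"
proof -
  note L = lie_closed_lie_g[of m]
  note pw = reducible_words[OF p]
  note I = reducible_env[OF env_ideal_closed(4)[OF L pw]]
  show "gen (0\<^sub>m (m + 1) (m + 1)) * p \<in> reducible"
  proof -
    have "(0::real) \<cdot>\<^sub>m 0\<^sub>m (m + 1) (m + 1) = 0\<^sub>m (m + 1) (m + 1)" by auto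
    then show ?thesis
      using I[OF env_ideal_relations(2)[OF L zero_lie_g, of 0]] by (simp add: scal_simps)
  qed
  show "gen (X + Y) * p \<in> reducible"
    if "X \<in> lie_g m" "Y \<in> lie_g m" "gen X * p \<in> reducible" "gen Y * p \<in> reducible"
    using reducible_add[OF I[OF env_ideal_relations(1)[OF L that(1,2)]] reducible_add[OF that(3,4)]]
    by (simp add: algebra_simps)
  show "gen (r \<cdot>\<^sub>m X) * p \<in> reducible" if "X \<in> lie_g m" "gen X * p \<in> reducible"
    using reducible_add[OF I[OF env_ideal_relations(2)[OF L that(1), of r]]
        reducible_scal[OF that(2), of "complex_of_real r"]]
    by (simp add: algebra_simps)
qed

lemma reducible_n_minus:
  assumes "C \<in> n_minus m" and p: "p \<in> reducible"
  shows "gen C * p \<in> reducible"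
proof -
  have "C \<in> lie_g m \<and> gen C * p \<in> reducible"
    using assms(1)[unfolded n_minus_N[OF m]]
  proof (rule real_span_induct_closed)
    show "0\<^sub>m (m + 1) (m + 1) \<in> lie_g m \<and> gen (0\<^sub>m (m + 1) (m + 1)) * p \<in> reducible"
      using zero_lie_g reducible_gen_linear(1)[OF p] by blast
    fix X Y c
    assume X: "X \<in> lie_g m \<and> gen X * p \<in> reducible"
    then show "c \<cdot>\<^sub>m X \<in> lie_g m \<and> gen (c \<cdot>\<^sub>m X) * p \<in> reducible"
      using lie_g_smult reducible_gen_linear(3)[OF p] by blast
    assume "Y \<in> lie_g m \<and> gen Y * p \<in> reducible"
    then show "X + Y \<in> lie_g m \<and> gen (X + Y) * p \<in> reducible"
      using X lie_g_add reducible_gen_linear(2)[OF p] by blast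
  next
    fix X assume "X \<in> Nmat m ` vidx m"
    then show "X \<in> lie_g m \<and> gen X * p \<in> reducible"
      using Nmat_lie_g[OF m] reducible_N[OF _ p] by auto
  qed
  then show ?thesis by blast
qed

lemma reducible_nmon: "set as \<subseteq> vidx m \<Longrightarrow> nmon m as \<in> reducible"
  by (induction as) (auto simp: nmon_def reducible_one intro: reducible_N)

text \<open>Induction on the length of the monomial: the part of \<open>X\<close> in \<open>n\<^sup>-\<close> lengthens the monomial, and the
  part \<open>p\<close> in the parabolic subalgebra is moved past the first factor \<open>N\<close>, where the commutator
  \<open>[p, N]\<close> meets a shorter monomial. The statement has to cover all \<open>X\<close>, since the commutator can be
  any element of the Lie algebra.\<close>

lemma reducible_gen_nmon: "set as \<subseteq> vidx m \<Longrightarrow> X \<in> lie_g m \<Longrightarrow> gen X * nmon m as \<in> reducible"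
proof (induction as arbitrary: X)
  case Nil
  obtain C p where 1: "C \<in> n_minus m" "p \<in> parabolic m" "X = C + p"
    using lie_g_decomposition[OF m Nil(2)] by blast
  have "gen p - scal (complex_of_real (p $$ (0, 3)) * lam) \<in> reducible"
    by (rule reducible_ideal[OF verma_ideal_generator[OF m 1(2)]])
  then have "gen p \<in> reducible"
    using reducible_diff reducible_scal[OF reducible_one] by fastforce
  moreover have "gen C * 1 \<in> reducible" by (rule reducible_n_minus[OF 1(1) reducible_one])
  ultimately show ?case
    using reducible_gen_linear(2)[OF reducible_one n_minus_lie_g[OF m 1(1)] parabolic_lie_g[OF m 1(2)]]
    by (simp add: nmon_def 1(3))
next
  case (Cons a as)
  note L = lie_closed_lie_g[of m]
  obtain C p where 1: "C \<in> n_minus m" "p \<in> parabolic m" "X = C + p"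
    using lie_g_decomposition[OF m Cons(3)] by blast
  have a: "a \<in> vidx m" and as: "set as \<subseteq> vidx m" using Cons by auto
  let ?N = "Nmat m a"
  note pg = parabolic_lie_g[OF m 1(2)]
  let ?B = "p * ?N - ?N * p"
  have "(gen p * gen ?N - gen ?N * gen p - gen ?B) * nmon m as \<in> reducible"
    by (intro reducible_env env_ideal_closed(4)[OF L nmon_in_words[OF as]] env_ideal_relations(3)[OF L] pg Nmat_lie_g[OF m])
  moreover have "gen ?N * (gen p * nmon m as) \<in> reducible"
    using Cons.IH[OF as pg] a by (intro reducible_N)
  moreover have "gen ?B * nmon m as \<in> reducible"
    by (intro Cons.IH[OF as] lie_g_bracket pg Nmat_lie_g[OF m])
  ultimately have "(gen p * gen ?N - gen ?N * gen p - gen ?B) * nmon m as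
      + (gen ?N * (gen p * nmon m as) + gen ?B * nmon m as) \<in> reducible"
    by (intro reducible_add)
  then have "gen p * nmon m (a # as) \<in> reducible"
    by (simp add: nmon_def algebra_simps)
  moreover have "gen C * nmon m (a # as) \<in> reducible"
    using Cons by (intro reducible_n_minus[OF 1(1)] reducible_nmon)
  ultimately show ?case
    unfolding 1(3) using Cons
    by (intro reducible_gen_linear(2) n_minus_lie_g[OF m 1(1)] pg reducible_nmon)
qed

lemma reducible_gen: "X \<in> lie_g m \<Longrightarrow> p \<in> reducible \<Longrightarrow> gen X * p \<in> reducible"
proof -
  assume X: "X \<in> lie_g m" and p: "p \<in> reducible"
  obtain S c where
    1: "p \<in> words_over (lie_g m)" "finite S" "\<forall>A\<in>S. over A" "p - comb m S c \<in> verma_ideal m lam"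
    using p unfolding reducible_def by blast
  \<comment> \<open>scalars are central, so it suffices to reduce \<open>gen X\<close> times each monomial\<close>
  have "gen X * (scal (c A) * q) = scal (c A) * (gen X * q)" for A q
    by (simp add: scal_commute[of "c A" "gen X", symmetric] flip: mult.assoc)
  then have "gen X * comb m S c = (\<Sum>A\<in>S. scal (c A) * (gen X * nmon m (sorted_list_of_multiset A)))"
    by (simp add: comb_def sum_distrib_left)
  also have "\<dots> \<in> reducible"
    using 1(3) X by (intro reducible_sum reducible_scal reducible_gen_nmon) auto
  finally have "gen X * comb m S c \<in> reducible" .
  moreover have "gen X * (p - comb m S c) \<in> reducible"
    using X by (intro reducible_ideal left_idealD(4)[OF verma_left _ 1(4)]) auto
  ultimately show ?thesis
    using reducible_add[of "gen X * (p - comb m S c)" "gen X * comb m S c"] by (simp add: algebra_simps)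
qed

lemma words_reducible: "p \<in> words_over (lie_g m) \<Longrightarrow> p \<in> reducible"
proof (induction rule: words_over_induct)
  case zero
  then show ?case using reducible_env env_ideal_closed(1)[OF lie_closed_lie_g] by blast
qed (auto intro: reducible_one reducible_scal reducible_gen reducible_add)

text \<open>Modulo the ideal an element is a combination of ordered monomials, and the coefficients of that
  combination are the coefficients of its image.\<close>

lemma verma_ideal_iff:
  assumes p: "p \<in> words_over (lie_g m)"
  shows "p \<in> verma_ideal m lam \<longleftrightarrow> ev m lam p = (\<lambda>A. 0)"
proof
  assume z: "ev m lam p = (\<lambda>A. 0)"
  obtain S c where 1: "finite S" "\<forall>A\<in>S. over A" "p - comb m S c \<in> verma_ideal m lam"
    using words_reducible[OF p] unfolding reducible_def by blast
  have "ev m lam (comb m S c) = (\<lambda>A. 0)"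
    using ev_verma_ideal[OF 1(3)] z by (simp add: ev_simps fun_eq_iff)
  then have "c A = 0" if "A \<in> S" for A
    using that ev_comb[OF 1(1), of c] 1(2) by (metis (no_types, lifting))
  then have "comb m S c = 0" by (simp add: comb_def scal_simps)
  then show "p \<in> verma_ideal m lam" using 1(3) by simp
qed (rule ev_verma_ideal)

lemma ev_support:
  assumes p: "p \<in> words_over (lie_g m)" and "ev m lam p A \<noteq> 0"
  shows "over A"
proof -
  obtain S c where 1: "finite S" "\<forall>A\<in>S. over A" "p - comb m S c \<in> verma_ideal m lam"
    using words_reducible[OF p] unfolding reducible_def by blast
  have "ev m lam p A = ev m lam (comb m S c) A"
    using ev_verma_ideal[OF 1(3)] by (simp add: ev_simps fun_eq_iff)
  then show ?thesis using ev_comb[OF 1(1), of c] 1(2) assms(2) by (auto split: if_splits)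
qed

end

section \<open>Singular vectors in the polynomial model: uniqueness\<close>

lemma sc_central: "f * sc c = sc c * f" "f * (sc c * g) = sc c * (f * g)"
proof -
  show 1: "f * sc c = sc c * f" for f
    by (rule op_eqI) (simp add: app_simps app_sc app_scale)
  show "f * (sc c * g) = sc c * (f * g)" using 1[of f] by (simp flip: mult.assoc)
qed

lemma vidx_Suc: "n \<ge> 4 \<Longrightarrow> vidx (Suc n) = insert (Suc n) (vidx n)" "n \<ge> 4 \<Longrightarrow> Suc n \<notin> vidx n"
  by (auto simp: vidx_def)

lemma app_euler: "app (xop a) (app (dop a) f) A = of_nat (count A a) * f A"
  by (cases "a \<in># A") (auto simp: app_xop app_dop not_in_iff of_nat_diff
      count_greater_zero_iff[symmetric] algebra_simps simp del: count_greater_zero_iff)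

text \<open>The conditions for a singular vector of weight \<open>\<lambda> - N\<close>, for the generators of the parabolic
  subalgebra of the smaller Lie algebra.\<close>

definition singular_poly :: "nat \<Rightarrow> complex \<Rightarrow> nat \<Rightarrow> (nat multiset \<Rightarrow> complex) \<Rightarrow> bool" where
  "singular_poly n lam N f \<longleftrightarrow>
    (\<forall>a\<in>vidx n. \<forall>b\<in>vidx n. app (weyl.ll xop dop (\<lambda>a. sc (complex_of_real (eta a))) a b) f = (\<lambda>A. 0)) \<and>
    (\<forall>a\<in>vidx n. app (weyl.pp xop dop (vidx (Suc n)) (\<lambda>a. sc (complex_of_real (eta a))) (sc lam) a) f = (\<lambda>A. 0)) \<and>
    app (weyl.hh xop dop (vidx (Suc n)) (sc lam)) f = (\<lambda>A. (lam - of_nat N) * f A)"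

text \<open>The monomial \<open>\<xi>\<^sub>2\<^sup>2\<^sup>j t\<^sup>N\<^sup>-\<^sup>2\<^sup>j\<close>, where \<open>t\<close> is the last variable. In \<open>\<Sum>\<^sub>j a\<^sub>j r\<^sup>j t\<^sup>N\<^sup>-\<^sup>2\<^sup>j\<close> its coefficient is
  \<open>a\<^sub>j\<close>, as \<open>\<eta>\<^sub>2 = 1\<close>. These coefficients play the role of the \<open>a\<^sub>j\<close> without the theorem that invariants are
  polynomials in \<open>r\<close>.\<close>

definition lead :: "nat \<Rightarrow> nat \<Rightarrow> nat \<Rightarrow> nat multiset" where
  "lead n N j = replicate_mset (2 * j) 2 + replicate_mset (N - 2 * j) (Suc n)"

text \<open>The product solves the two term recursion for the coefficients downwards from the value 1 at
  \<open>N div 2\<close>; only integers that do not vanish occur in denominators.\<close>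

definition sv_coeff :: "nat \<Rightarrow> nat \<Rightarrow> nat \<Rightarrow> complex poly" where
  "sv_coeff n N j = (\<Prod>i\<in>{j..<N div 2}.
     Polynomial.smult (- (of_nat (2 * Suc i) / of_nat ((N - 2 * i) * (N - 2 * i - 1))))
       [: of_nat n - 1 - of_nat (2 * Suc i + 2 * (N - 2 * Suc i)), 2 :])"

lemma sv_coeff_rec:
  assumes "j < N div 2"
  shows "poly (sv_coeff n N (Suc j)) lam * (of_nat (2 * Suc j) * (of_nat n - 1 + 2 * lam - of_nat (2 * Suc j + 2 * (N - 2 * Suc j))))
    + poly (sv_coeff n N j) lam * of_nat ((N - 2 * j) * (N - 2 * j - 1)) = 0"
proof -
  define d :: complex where "d = of_nat ((N - 2 * j) * (N - 2 * j - 1))"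
  have "N - 2 * j \<noteq> 0" "N - 2 * j - 1 \<noteq> 0" using assms by auto
  then have d: "d \<noteq> 0" unfolding d_def of_nat_eq_0_iff by simp
  define g :: complex where "g = of_nat n - 1 - of_nat (2 * Suc j + 2 * (N - 2 * Suc j))"
  define k :: complex where "k = of_nat (2 * Suc j)"
  have "{j..<N div 2} = insert j {Suc j..<N div 2}" using assms by auto
  then have e: "sv_coeff n N j = Polynomial.smult (- (k / d)) [: g, 2 :] * sv_coeff n N (Suc j)"
    unfolding sv_coeff_def d_def g_def k_def by simp
  have pe: "poly (sv_coeff n N j) lam = - (k / d) * (g + 2 * lam) * poly (sv_coeff n N (Suc j)) lam"
    unfolding e by (simp add: algebra_simps)
  have gl: "of_nat n - 1 + 2 * lam - of_nat (2 * Suc j + 2 * (N - 2 * Suc j)) = g + 2 * lam"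
    by (simp add: g_def)
  show ?thesis
    unfolding gl d_def[symmetric] k_def[symmetric] pe using d by (simp add: field_simps)
qed

context
  fixes n N :: nat and lam :: complex
  assumes n: "n \<ge> 4"
begin

interpretation conformal sc xop dop "Suc n" lam by (rule conformal_op)

context
  fixes f :: "nat multiset \<Rightarrow> complex"
  assumes sing: "singular_poly n lam N f"
    and supp: "\<And>A. f A \<noteq> 0 \<Longrightarrow> set_mset A \<subseteq> vidx (Suc n)"
begin

lemma ll_coefficient:
  assumes "a \<in> vidx n" "b \<in> vidx n" "a \<noteq> b"
  shows "complex_of_real (eta b) * (of_nat (count A b + 1) * f (add_mset b A)) =
    (if b \<in># A then complex_of_real (eta a) * (of_nat (count A a + 2) * f (add_mset a (add_mset a (A - {#b#})))) else 0)"
proof -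
  \<comment> \<open>at a monomial divisible by \<open>\<xi>\<^sub>a\<close> the first summand of the rotation is not cut off\<close>
  have "app (ll a b) f (add_mset a A) = 0"
    using sing assms unfolding singular_poly_def by simp
  moreover have "add_mset a A - {#b#} = add_mset a (A - {#b#})"
    using assms(3) by simp
  ultimately show ?thesis
    using assms(3) by (simp add: ll_def app_simps app_sc app_xop app_dop split: if_splits)
qed

lemma eta_nonzero [simp]: "eta a \<noteq> 0"
  by (simp add: eta_def)

text \<open>Invariance under the rotation in the plane of \<open>a\<close> and \<open>b\<close> exchanges a pair \<open>b, b\<close> for a pair \<open>a, a\<close>, and
  a single \<open>b\<close> has nothing to be exchanged for.\<close>

lemma odd_zero:
  assumes b: "b \<in> vidx n" and "odd (count A b)"
  shows "f A = 0"
  using assms(2)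
proof (induction "count A b" arbitrary: A rule: less_induct)
  case less
  \<comment> \<open>some other index of the smaller Lie algebra\<close>
  define a :: nat where "a = (if b = 1 then 2 else 1)"
  have a: "a \<in> vidx n" "a \<noteq> b" by (auto simp: a_def vidx_def)
  have "b \<in># A" using less(2) by (metis count_inI even_zero)
  then obtain B where B: "A = add_mset b B" by (metis insert_DiffM)
  note c = ll_coefficient[OF a(1) b a(2), of B]
  have nz: "complex_of_real (eta b) * of_nat (count B b + 1) \<noteq> 0"
    by (simp del: of_nat_Suc of_nat_add)
  show ?case
  proof (cases "b \<in># B")
    case False
    then show ?thesis using c nz unfolding B by (simp del: of_nat_Suc of_nat_add)
  next
    case True
    let ?C = "add_mset a (add_mset a (B - {#b#}))"
    have "count B b > 0" using True by simp
    then have "count ?C b < count A b" "odd (count ?C b)"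
      using a(2) less(2) unfolding B by auto
    then have "f ?C = 0" using less(1) by blast
    then show ?thesis using c nz True unfolding B by (simp del: of_nat_Suc of_nat_add)
  qed
qed

lemma move_pair:
  assumes "a \<in> vidx n" "b \<in> vidx n" "f (add_mset a (add_mset a B)) = 0"
  shows "f (add_mset b (add_mset b B)) = 0"
proof (cases "a = b")
  case False
  then show ?thesis
    using ll_coefficient[OF assms(1,2), of "add_mset b B"] assms(3)
    by (simp del: of_nat_Suc of_nat_add)
qed (use assms in simp)

lemma Eu_coefficient: "app Eu u A = of_nat (\<Sum>a\<in>vidx (Suc n). count A a) * u A" for u
  by (simp add: Eu_def app_sum app_simps app_euler sum_distrib_right)

text \<open>The weight fixes the eigenvalue of the Euler operator, which is the degree.\<close>

lemma homogeneous:
  assumes "f A \<noteq> 0"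
  shows "size A = N" "set_mset A \<subseteq> vidx (Suc n)"
proof -
  show s: "set_mset A \<subseteq> vidx (Suc n)" using supp assms .
  have "size A = (\<Sum>a\<in>vidx (Suc n). count A a)"
    unfolding size_multiset_overloaded_eq
    using s by (intro sum.mono_neutral_left) (auto simp: not_in_iff)
  then have "app hh f A = (lam - of_nat (size A)) * f A"
    by (simp add: hh_def app_simps app_sc Eu_coefficient algebra_simps)
  moreover have "app hh f A = (lam - of_nat N) * f A"
    using sing unfolding singular_poly_def by simp
  ultimately have "(of_nat (size A) :: complex) = of_nat N" using assms by simp
  then show "size A = N" by (simp only: of_nat_eq_iff)
qed

text \<open>Pairs of variables coming from the smaller Lie algebra can be traded for pairs of \<open>\<xi>\<^sub>2\<close> one after the
  other, until a monomial of the form \<open>lead\<close> is reached.\<close>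

lemma vanishes_if_lead_vanish:
  assumes lead: "\<And>j. 2 * j \<le> N \<Longrightarrow> f (lead n N j) = 0"
  shows "f A = 0"
proof (induction "size (filter_mset (\<lambda>b. b \<noteq> 2 \<and> b \<noteq> Suc n) A)" arbitrary: A rule: less_induct)
  case less
  have two: "2 \<in> vidx n" by (simp add: vidx_def)
  show ?case
  proof (rule ccontr)
    assume nz: "f A \<noteq> 0"
    note hom = homogeneous[OF nz]
    show False
    proof (cases "\<exists>b\<in>#A. b \<noteq> 2 \<and> b \<noteq> Suc n")
      case True
      then obtain b where b: "b \<in># A" "b \<noteq> 2" "b \<noteq> Suc n" by blast
      then have bv: "b \<in> vidx n" using hom(2) vidx_Suc(1)[OF n] by blast
      have "even (count A b)" using odd_zero[OF bv] nz by blast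
      moreover obtain B where B: "A = add_mset b B" using b(1) by (metis insert_DiffM)
      ultimately have "b \<in># B" by (metis count_add_mset count_inI even_Suc even_zero)
      then obtain C where C: "B = add_mset b C" by (metis insert_DiffM)
      have "f (add_mset 2 (add_mset 2 C)) = 0"
        using b by (intro less) (simp add: B C)
      then show False using move_pair[OF two bv] nz by (simp add: B C)
    next
      case False
      define j where "j = count A 2 div 2"
      have "even (count A 2)" using odd_zero[OF two] nz by blast
      then have j: "count A 2 = 2 * j" by (simp add: j_def)
      have A: "A = replicate_mset (count A 2) 2 + replicate_mset (count A (Suc n)) (Suc n)"
      proof (rule multiset_eqI)
        fix x show "count A x = count (replicate_mset (count A 2) 2 + replicate_mset (count A (Suc n)) (Suc n)) x"
          using False n by (cases "x = 2"; cases "x = Suc n") (auto simp: not_in_iff)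
      qed
      have "N = 2 * j + count A (Suc n)"
        using hom(1) arg_cong[OF A, of size] j by simp
      then have "A = lead n N j" "2 * j \<le> N" using A j by (simp_all add: lead_def)
      then show False using lead nz by blast
    qed
  qed
qed

text \<open>The coefficient of \<open>P\<^sub>2 f\<close> at \<open>\<xi>\<^sub>2 B\<close>. Its first order part and all terms of the Laplacian except the
  one for \<open>t\<close> are multiples of the coefficient at \<open>lead n N (Suc j)\<close>; the remaining term is a positive
  multiple of the coefficient at \<open>lead n N j\<close>.\<close>

lemma lead_step:
  assumes "2 * Suc j \<le> N" "f (lead n N (Suc j)) = 0"
  shows "f (lead n N j) = 0"
proof -
  define k where "k = N - 2 * Suc j"
  define B where "B = replicate_mset (2 * j) 2 + replicate_mset k (Suc n)"
  have two: "2 \<in> vidx n" by (simp add: vidx_def)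
  have L1: "lead n N (Suc j) = add_mset 2 (add_mset 2 B)"
    by (simp add: lead_def B_def k_def)
  have "N - 2 * j = Suc (Suc k)" using assms(1) by (simp add: k_def)
  then have L0: "lead n N j = add_mset (Suc n) (add_mset (Suc n) B)"
    by (simp add: lead_def B_def)
  have pairs: "f (add_mset b (add_mset b B)) = 0" if "b \<in> vidx n" for b
    using move_pair[OF two that] assms(2) L1 by simp
  have d0: "app (dop 2) f (add_mset 2 B) = 0"
    using pairs[OF two] by (simp add: app_dop)
  have "app (pp 2) f (add_mset 2 B) = 0"
    using sing two unfolding singular_poly_def by simp
  moreover have "app (pp 2) f (add_mset 2 B) = app Lap f B"
  proof -
    have E: "app Eu (app (dop 2) f) (add_mset 2 B) = 0"
      unfolding Eu_coefficient d0 by simp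
    have "app (1 + 1) v A = 2 * v A" for v A
      by (simp only: app_simps) simp
    then have "app 2 v A = 2 * v A" for v A by simp
    then have "app (pp 2) f (add_mset 2 B) = app (xop 2) (app Lap f) (add_mset 2 B)"
      unfolding pp_def by (simp only: app_simps E d0 app_sc) simp
    then show ?thesis by (simp add: app_xop)
  qed
  ultimately have "app Lap f B = 0" by simp
  moreover have "app Lap f B
    = (\<Sum>b\<in>vidx (Suc n). complex_of_real (eta b) * (of_nat (count B b + 1) * (of_nat (count B b + 2) * f (add_mset b (add_mset b B)))))"
    by (simp add: Lap_def app_sum app_simps app_sc app_dop)
  moreover have "\<dots> = complex_of_real (eta (Suc n)) * (of_nat (count B (Suc n) + 1) * (of_nat (count B (Suc n) + 2)
      * f (add_mset (Suc n) (add_mset (Suc n) B))))"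
    unfolding vidx_Suc(1)[OF n] using vidx_Suc(2)[OF n] pairs by simp
  ultimately have "complex_of_real (eta (Suc n)) * (of_nat (count B (Suc n) + 1) * (of_nat (count B (Suc n) + 2)
      * f (add_mset (Suc n) (add_mset (Suc n) B)))) = 0" by simp
  then show ?thesis unfolding L0 by (simp del: of_nat_Suc of_nat_add)
qed

lemma singular_poly_unique:
  assumes "f (lead n N (N div 2)) = 0"
  shows "f = (\<lambda>A. 0)"
proof -
  have "f (lead n N j) = 0" if "j \<le> N div 2" for j
    using that
  proof (induction rule: inc_induct)
    case base
    show ?case by (rule assms)
  next
    case (step j)
    have "2 * Suc j \<le> N" using step(2) by presburger
    then show ?case using lead_step step(3) by blast
  qed
  then show ?thesis using vanishes_if_lead_vanish by (intro ext) auto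
qed

end

section \<open>Singular vectors in the polynomial model: existence\<close>

text \<open>Equality of operators modulo the left ideal that annihilates the constant polynomial 1. It allows
  the action on explicit polynomials to be computed with operators alone.\<close>

definition eqv :: "weyl_op \<Rightarrow> weyl_op \<Rightarrow> bool" where
  "eqv u v \<longleftrightarrow> app u vac = app v vac"

lemma eqv_rules:
  "eqv u u" "eqv u v \<Longrightarrow> eqv v w \<Longrightarrow> eqv u w" "eqv u v \<Longrightarrow> eqv (g * u) (g * v)"
  "eqv u v \<Longrightarrow> eqv u' v' \<Longrightarrow> eqv (u + u') (v + v')"
  by (auto simp: eqv_def app_simps)

lemma eqv_sum: "(\<And>i. i \<in> S \<Longrightarrow> eqv (g i) (h i)) \<Longrightarrow> eqv (sum g S) (sum h S)"
  by (simp add: eqv_def app_sum cong: sum.cong)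

lemmas eqv_trans [trans] = eqv_rules(2)

lemma eqv_eq_trans [trans]: "u = v \<Longrightarrow> eqv v w \<Longrightarrow> eqv u w" "eqv u v \<Longrightarrow> v = w \<Longrightarrow> eqv u w"
  by auto

lemma eqv_zero_right: "eqv v 0 \<Longrightarrow> eqv (u + g * v) u"
  by (simp add: eqv_def app_simps app_zero)

lemma eqv_vac: "eqv (dop a) 0" "eqv hh (sc lam)" "eqv (ll a b) 0" "eqv Lap 0"
  by (simp_all add: eqv_def app_dop_vac app_simps ll_def hh_def Lap_def Eu_def app_zero app_sum)

abbreviation (input) "ee a \<equiv> sc (complex_of_real (eta a))"

text \<open>Multiplication by the quadratic form \<open>r\<close> in the variables of the smaller Lie algebra, and the Euler
  operator of these variables, which appears in the commutator of the Laplacian with \<open>r\<close>.\<close>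

definition Rop :: weyl_op where "Rop = (\<Sum>a\<in>vidx n. ee a * (xop a * xop a))"
definition Eop :: weyl_op where "Eop = (\<Sum>a\<in>vidx n. xop a * dop a)"
abbreviation (input) "Top \<equiv> xop (Suc n)"

lemma x_R: "xop b * Rop = Rop * xop b"
  unfolding Rop_def sum_distrib_left sum_distrib_right
  by (intro sum.cong refl) (simp add: sc_central(2)[of "xop b"] mult.assoc xx xx')

lemma d_R: "b \<in> vidx n \<Longrightarrow> dop b * Rop = Rop * dop b + sc 2 * (ee b * xop b)"
  and d_R_t: "dop (Suc n) * Rop = Rop * dop (Suc n)"
proof -
  have two: "sc 2 = 2" using sc_add[of 1 1] sc_one by simp
  have "dop b * (ee a * (xop a * xop a)) = ee a * (xop a * xop a) * dop b
      + (if b = a then sc 2 * (ee b * xop b) else 0)" for a b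
    by (simp add: sc_central(2)[of "dop b"] sc_central(2)[of "sc 2"] mult.assoc dx dx' distrib_left two mult_2)
  then have *: "dop b * Rop = (\<Sum>a\<in>vidx n. ee a * (xop a * xop a) * dop b + (if b = a then sc 2 * (ee b * xop b) else 0))" for b
    by (simp only: Rop_def sum_distrib_left)
  show "dop b * Rop = Rop * dop b + sc 2 * (ee b * xop b)" if "b \<in> vidx n"
    unfolding * using that by (simp add: Rop_def sum.distrib sum_distrib_right)
  show "dop (Suc n) * Rop = Rop * dop (Suc n)"
    unfolding * using vidx_Suc(2)[OF n] by (simp add: Rop_def sum.distrib sum_distrib_right)
qed

lemma E_R: "Eop * Rop = Rop * Eop + sc 2 * Rop"
proof -
  have "xop a * dop a * Rop = Rop * (xop a * dop a) + sc 2 * (ee a * (xop a * xop a))" if "a \<in> vidx n" for a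
  proof -
    have "xop a * dop a * Rop = xop a * (Rop * dop a + sc 2 * (ee a * xop a))"
      by (simp only: mult.assoc d_R[OF that])
    also have "\<dots> = (xop a * Rop) * dop a + sc 2 * (ee a * (xop a * xop a))"
      by (simp add: distrib_left sc_central(2)[of "xop a"] mult.assoc)
    finally show ?thesis by (simp only: x_R mult.assoc)
  qed
  then have "Eop * Rop = (\<Sum>a\<in>vidx n. Rop * (xop a * dop a) + sc 2 * (ee a * (xop a * xop a)))"
    unfolding Eop_def sum_distrib_right by (intro sum.cong refl)
  also have "\<dots> = Rop * Eop + sc 2 * Rop"
    by (simp only: sum.distrib Eop_def sum_distrib_left Rop_def[symmetric]) (simp add: Rop_def sum_distrib_left)
  finally show ?thesis .
qed

lemma E_T: "Eop * Top = Top * Eop"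
  unfolding Eop_def sum_distrib_left sum_distrib_right
  using vidx_Suc(2)[OF n] by (intro sum.cong refl) (auto simp: mult.assoc dx xx')

lemma card_vidx: "card (vidx n) = n - 1"
proof -
  have "card (vidx n) = card {1, 2::nat} + card {4..n}"
    unfolding vidx_def by (intro card_Un_disjoint) auto
  then show ?thesis using n by simp
qed

lemma Lap_R: "Lap * Rop = Rop * Lap + sc 4 * Eop + sc (of_nat (2 * (n - 1)))"
proof -
  have c: "ee b * ee b = 1" "ee b * (ee b * z) = z" for b z
    using e_square[of b] by auto
  have "ee b * (dop b * dop b) * Rop = Rop * (ee b * (dop b * dop b)) + (sc 4 * (xop b * dop b) + sc 2)"
    if b: "b \<in> vidx n" for b
  proof -
    have 1: "dop b * (dop b * Rop) = Rop * (dop b * dop b) + sc 2 * (ee b * (xop b * dop b))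
        + sc 2 * (ee b * (xop b * dop b + 1))"
    proof -
      have "dop b * (dop b * Rop) = dop b * (Rop * dop b) + sc 2 * (ee b * (dop b * xop b))"
        by (simp only: d_R[OF b] distrib_left sc_central(2)[of "dop b"])
      also have "dop b * (Rop * dop b) = (dop b * Rop) * dop b" by (simp only: mult.assoc)
      also have "(dop b * Rop) * dop b = Rop * (dop b * dop b) + sc 2 * (ee b * (xop b * dop b))"
        by (simp only: d_R[OF b] distrib_right mult.assoc)
      finally show ?thesis by (simp only: dx[of b b] refl if_True)
    qed
    have "ee b * (dop b * dop b) * Rop = ee b * (dop b * (dop b * Rop))" by (simp only: mult.assoc)
    also have "\<dots> = Rop * (ee b * (dop b * dop b)) + (sc 2 * (xop b * dop b) + sc 2 * (xop b * dop b + 1))"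
      unfolding 1 by (simp add: distrib_left sc_central(2)[of Rop] sc_central(2)[of "ee b" 2] c)
    also have "sc 2 * (xop b * dop b) + sc 2 * (xop b * dop b + 1) = sc 4 * (xop b * dop b) + sc 2"
      using sc_add[of 2 2] by (simp add: distrib_left distrib_right)
    finally show ?thesis .
  qed
  then have "(\<Sum>b\<in>vidx n. ee b * (dop b * dop b)) * Rop
    = Rop * (\<Sum>b\<in>vidx n. ee b * (dop b * dop b)) + (sc 4 * Eop + sc (of_nat (2 * (n - 1))))"
  proof -
    assume *: "\<And>b. b \<in> vidx n \<Longrightarrow> ee b * (dop b * dop b) * Rop = Rop * (ee b * (dop b * dop b)) + (sc 4 * (xop b * dop b) + sc 2)"
    have "(\<Sum>b\<in>vidx n. ee b * (dop b * dop b)) * Rop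
      = (\<Sum>b\<in>vidx n. Rop * (ee b * (dop b * dop b)) + (sc 4 * (xop b * dop b) + sc 2))"
      unfolding sum_distrib_right using * by (intro sum.cong refl)
    moreover have "(\<Sum>b\<in>vidx n. sc 2) = sc (of_nat (2 * (n - 1)))"
      using sc_sum[of "\<lambda>_. 2" "vidx n"] card_vidx by (simp add: mult.commute)
    ultimately show ?thesis by (simp only: sum.distrib Eop_def sum_distrib_left)
  qed
  moreover have "ee (Suc n) * (dop (Suc n) * dop (Suc n)) * Rop = Rop * (ee (Suc n) * (dop (Suc n) * dop (Suc n)))"
  proof -
    have "dop (Suc n) * (dop (Suc n) * Rop) = Rop * (dop (Suc n) * dop (Suc n))"
      by (simp only: d_R_t) (simp only: mult.assoc[symmetric] d_R_t)
    then show ?thesis by (simp only: mult.assoc sc_central(2)[of Rop])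
  qed
  moreover have Lap: "Lap = ee (Suc n) * (dop (Suc n) * dop (Suc n)) + (\<Sum>b\<in>vidx n. ee b * (dop b * dop b))"
  proof -
    have "Lap = (\<Sum>b\<in>vidx (Suc n). ee b * (dop b * dop b))" by (rule Lap_def)
    then show ?thesis unfolding vidx_Suc(1)[OF n] using vidx_Suc(2)[OF n] by simp
  qed
  ultimately show ?thesis
    unfolding Lap by (simp add: distrib_left distrib_right add_ac)
qed

lemma hh_R: "hh * Rop = Rop * hh + sc (- 2) * Rop"
proof -
  have hx: "hh * xop a = xop a * hh - xop a" if "a \<in> vidx n" for a
    using hh_x[of a] that vidx_Suc(1)[OF n] by (simp add: algebra_simps)
  have m2: "sc (- 2) = - 1 - 1" using sc_add[of "- 1" "- 1"] sc_uminus[of 1] sc_one by simp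
  have "hh * (ee a * (xop a * xop a)) = ee a * (xop a * xop a) * hh + sc (- 2) * (ee a * (xop a * xop a))"
    if "a \<in> vidx n" for a
  proof -
    have "hh * (xop a * xop a) = (hh * xop a) * xop a" by (simp add: mult.assoc)
    also have "\<dots> = xop a * (hh * xop a) - xop a * xop a" by (simp only: hx[OF that] left_diff_distrib mult.assoc)
    also have "\<dots> = xop a * xop a * hh + sc (- 2) * (xop a * xop a)"
      by (simp add: hx[OF that] m2 algebra_simps mult_2)
    finally show ?thesis
      by (simp add: sc_central(2)[of hh] distrib_left mult.assoc sc_central(2)[of "sc (- 2)"])
  qed
  then have "hh * Rop = (\<Sum>a\<in>vidx n. ee a * (xop a * xop a) * hh + sc (- 2) * (ee a * (xop a * xop a)))"
    unfolding Rop_def sum_distrib_left by (intro sum.cong refl)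
  then show ?thesis by (simp add: sum.distrib Rop_def sum_distrib_left sum_distrib_right)
qed

lemma ll_R: "a \<in> vidx n \<Longrightarrow> b \<in> vidx n \<Longrightarrow> ll a b * Rop = Rop * ll a b"
proof -
  assume a: "a \<in> vidx n" and b: "b \<in> vidx n"
  then have V: "a \<in> vidx (Suc n)" "b \<in> vidx (Suc n)" using vidx_Suc(1)[OF n] by auto
  have "ll a b = ee b * (xop a * dop b) - ee a * (xop b * dop a)" by (simp add: ll_def)
  moreover have "ee b * (xop a * dop b) * Rop = Rop * (ee b * (xop a * dop b)) + sc 2 * (xop a * xop b)"
    if "b \<in> vidx n" for a b
  proof -
    have "ee b * (xop a * dop b) * Rop = ee b * (xop a * (Rop * dop b + sc 2 * (ee b * xop b)))"
      by (simp only: mult.assoc d_R[OF that])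
    also have "\<dots> = ee b * ((xop a * Rop) * dop b) + sc 2 * (ee b * (ee b * (xop a * xop b)))"
      by (simp add: distrib_left sc_central(2)[of "xop a"] sc_central(2)[of "ee b" 2] mult.assoc)
    also have "\<dots> = Rop * (ee b * (xop a * dop b)) + sc 2 * (xop a * xop b)"
      using e_square[of b] by (simp add: x_R mult.assoc sc_central(2)[of Rop])
    finally show ?thesis .
  qed
  ultimately show ?thesis
    using a b xx[of a b] by (simp add: left_diff_distrib right_diff_distrib)
qed

lemma ll_T: "a \<in> vidx n \<Longrightarrow> b \<in> vidx n \<Longrightarrow> ll a b * Top = Top * ll a b"
  using vidx_Suc(2)[OF n]
  by (auto simp: ll_def left_diff_distrib right_diff_distrib mult.assoc dx xx' sc_central(2)[of Top])

lemma hh_T: "hh * Top = Top * hh + sc (- 1) * Top"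
  using hh_x[of "Suc n"] vidx_Suc(1)[OF n] sc_uminus[of 1] sc_one by (simp add: algebra_simps)

lemma Lap_T: "Lap * Top = Top * Lap + sc 2 * dop (Suc n)"
proof -
  have "ee (Suc n) = 1" using n sc_one by (simp add: eta_def)
  moreover have "sc 2 = 2" using sc_add[of 1 1] sc_one by simp
  ultimately show ?thesis using Lap_x[of "Suc n"] vidx_Suc(1)[OF n] by simp
qed

lemma commute_power: "u * v = v * u \<Longrightarrow> u * v ^ k = v ^ k * (u :: weyl_op)"
  by (induction k) (simp_all, metis mult.assoc)

abbreviation (input) "RT j k \<equiv> Rop ^ j * Top ^ k"

lemma shift_power:
  assumes "u * v = v * u + sc c * v"
  shows "u * v ^ k = v ^ k * u + sc (of_nat k * c) * (v ^ k :: weyl_op)"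
proof (induction k)
  case (Suc k)
  have "u * v ^ Suc k = (u * v) * v ^ k" by (simp add: mult.assoc)
  also have "\<dots> = v * (u * v ^ k) + sc c * v ^ Suc k" by (simp add: assms distrib_right mult.assoc)
  also have "\<dots> = v ^ Suc k * u + (sc (of_nat k * c) * v ^ Suc k + sc c * v ^ Suc k)"
    by (simp add: Suc distrib_left mult.assoc sc_central(2)[of v] add.assoc)
  also have "sc (of_nat k * c) * v ^ Suc k + sc c * v ^ Suc k = sc (of_nat (Suc k) * c) * v ^ Suc k"
    by (simp only: distrib_right[symmetric] sc_add[symmetric]) (simp add: algebra_simps)
  finally show ?case .
qed simp

lemma eqv_ll: "a \<in> vidx n \<Longrightarrow> b \<in> vidx n \<Longrightarrow> eqv (ll a b * RT j k) 0"
proof -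
  assume ab: "a \<in> vidx n" "b \<in> vidx n"
  have "ll a b * RT j k = (ll a b * Rop ^ j) * Top ^ k" by (simp only: mult.assoc)
  also have "\<dots> = Rop ^ j * (ll a b * Top ^ k)"
    by (simp only: commute_power[OF ll_R[OF ab]] mult.assoc)
  also have "\<dots> = RT j k * ll a b"
    by (simp only: commute_power[OF ll_T[OF ab]] mult.assoc)
  also have "eqv \<dots> (RT j k * 0)" by (intro eqv_rules(3) eqv_vac)
  finally show ?thesis by simp
qed

lemma eqv_hh: "eqv (hh * RT j k) (sc (lam - of_nat (2 * j + k)) * RT j k)"
proof -
  have "hh * RT j k = (hh * Rop ^ j) * Top ^ k" by (simp only: mult.assoc)
  also have "\<dots> = Rop ^ j * (hh * Top ^ k) + sc (of_nat j * - 2) * RT j k"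
    by (simp only: shift_power[OF hh_R] distrib_right mult.assoc)
  also have "\<dots> = RT j k * hh + (sc (of_nat k * - 1) * RT j k + sc (of_nat j * - 2) * RT j k)"
    by (simp only: shift_power[OF hh_T] distrib_left mult.assoc sc_central(2)[of "Rop ^ j"] add.assoc)
  also have "eqv \<dots> (RT j k * sc lam + (sc (of_nat k * - 1) * RT j k + sc (of_nat j * - 2) * RT j k))"
    by (intro eqv_rules(4) eqv_rules(3) eqv_rules(1) eqv_vac)
  also have "RT j k * sc lam + (sc (of_nat k * - 1) * RT j k + sc (of_nat j * - 2) * RT j k)
      = sc (lam - of_nat (2 * j + k)) * RT j k"
    by (simp only: sc_central(1)[of "RT j k"] distrib_right[symmetric] sc_add[symmetric])
      (simp add: algebra_simps)
  finally show ?thesis .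
qed

lemma eqv_E: "eqv (Eop * RT j k) (sc (of_nat (2 * j)) * RT j k)"
proof -
  have "Eop * RT j k = (Eop * Rop ^ j) * Top ^ k" by (simp only: mult.assoc)
  also have "\<dots> = Rop ^ j * (Eop * Top ^ k) + sc (of_nat j * 2) * RT j k"
    by (simp only: shift_power[OF E_R] distrib_right mult.assoc)
  also have "\<dots> = sc (of_nat j * 2) * RT j k + RT j k * Eop"
    by (simp only: commute_power[OF E_T] mult.assoc add.commute)
  also have "eqv \<dots> (sc (of_nat j * 2) * RT j k)"
    by (rule eqv_zero_right) (simp add: eqv_def Eop_def app_sum app_simps app_dop_vac app_zero)
  finally show ?thesis by (simp add: mult.commute)
qed

lemma d_T_power: "dop (Suc n) * Top ^ k = Top ^ k * dop (Suc n) + sc (of_nat k) * Top ^ (k - 1)"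
proof (induction k)
  case 0
  show ?case using sc_zero by simp
next
  case (Suc k)
  have "dop (Suc n) * Top ^ Suc k = (dop (Suc n) * Top) * Top ^ k" by (simp add: mult.assoc)
  also have "\<dots> = Top * (dop (Suc n) * Top ^ k) + Top ^ k" by (simp add: dx distrib_right mult.assoc)
  also have "\<dots> = Top ^ Suc k * dop (Suc n) + (sc (of_nat k) * (Top * Top ^ (k - 1)) + Top ^ k)"
    by (simp add: Suc distrib_left mult.assoc sc_central(2)[of Top] add.assoc)
  also have "sc (of_nat k) * (Top * Top ^ (k - 1)) = sc (of_nat k) * Top ^ k"
    using sc_zero by (cases k) simp_all
  also have "sc (of_nat k) * Top ^ k + Top ^ k = sc (of_nat (Suc k)) * Top ^ (Suc k - 1)"
    using sc_add[of "of_nat k" 1] sc_one by (simp add: distrib_right add.commute)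
  finally show ?case .
qed

lemma eqv_Lap_T: "eqv (Lap * Top ^ k) (sc (of_nat (k * (k - 1))) * Top ^ (k - 2))"
proof (induction k)
  case 0
  show ?case using sc_zero eqv_vac(4) by simp
next
  case (Suc k)
  have "Lap * Top ^ Suc k = (Lap * Top) * Top ^ k" by (simp add: mult.assoc)
  also have "\<dots> = Top * (Lap * Top ^ k) + (sc 2 * (sc (of_nat k) * Top ^ (k - 1)) + sc 2 * (Top ^ k * dop (Suc n)))"
    by (simp add: Lap_T distrib_right distrib_left mult.assoc d_T_power add_ac)
  also have "eqv \<dots> (Top * (sc (of_nat (k * (k - 1))) * Top ^ (k - 2)) + sc 2 * (sc (of_nat k) * Top ^ (k - 1)))"
    unfolding mult.assoc[symmetric, of "sc 2" "Top ^ k"]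
    by (intro eqv_rules(4) eqv_rules(3) Suc eqv_zero_right eqv_vac)
  also have "Top * (sc (of_nat (k * (k - 1))) * Top ^ (k - 2)) = sc (of_nat (k * (k - 1))) * Top ^ (k - 1)"
  proof (cases "k \<ge> 2")
    case True
    then have "k - 1 = Suc (k - 2)" by simp
    then show ?thesis by (simp add: sc_central(2)[of Top])
  next
    case False
    then have "k * (k - 1) = 0" by (cases k) auto
    then show ?thesis using sc_zero by (simp only: of_nat_0) simp
  qed
  also have "sc (of_nat (k * (k - 1))) * Top ^ (k - 1) + sc 2 * (sc (of_nat k) * Top ^ (k - 1))
      = sc (of_nat (k * (k - 1)) + 2 * of_nat k) * Top ^ (k - 1)"
    by (simp only: sc_add sc_mult distrib_right mult.assoc)
  also have "(of_nat (k * (k - 1)) + 2 * of_nat k :: complex) = of_nat (Suc k * (Suc k - 1))"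
    by (cases k) (simp_all add: algebra_simps)
  finally show ?case by simp
qed

text \<open>Induction on \<open>j\<close> with \<open>[\<Delta>, r] = 4 E + 2 (n - 1)\<close>, where the Euler operator \<open>E\<close> of the variables
  other than \<open>t\<close> has the eigenvalue \<open>2 j\<close> on \<open>r\<^sup>j t\<^sup>k\<close>. Where the truncated exponents \<open>j - 1\<close> and \<open>k - 2\<close> are wrong, the coefficient in front is 0.\<close>

lemma eqv_Lap: "eqv (Lap * RT j k)
    (sc (of_nat (2 * j) * (of_nat (2 * j + n) - 3)) * RT (j - 1) k + sc (of_nat (k * (k - 1))) * RT j (k - 2))"
proof (induction j)
  case 0
  show ?case using eqv_Lap_T[of k] sc_zero by simp
next
  case (Suc j)
  let ?c = "of_nat (2 * j) * (of_nat (2 * j + n) - 3) :: complex"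
  let ?b = "sc (of_nat (k * (k - 1)))"
  have "Lap * RT (Suc j) k = (Lap * Rop) * RT j k" by (simp add: mult.assoc)
  also have "\<dots> = Rop * (Lap * RT j k) + (sc 4 * (Eop * RT j k) + sc (of_nat (2 * (n - 1))) * RT j k)"
    by (simp add: Lap_R distrib_right mult.assoc add_ac)
  also have "eqv \<dots> (Rop * (sc ?c * RT (j - 1) k + ?b * RT j (k - 2))
      + (sc 4 * (sc (of_nat (2 * j)) * RT j k) + sc (of_nat (2 * (n - 1))) * RT j k))"
    by (intro eqv_rules(4) eqv_rules(3) Suc eqv_E eqv_rules(1))
  also have "Rop * (sc ?c * RT (j - 1) k + ?b * RT j (k - 2)) = sc ?c * RT j k + ?b * RT (Suc j) (k - 2)"
    using sc_zero by (cases j) (simp_all add: distrib_left sc_central(2)[of Rop] mult.assoc)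
  also have "sc ?c * RT j k + ?b * RT (Suc j) (k - 2)
      + (sc 4 * (sc (of_nat (2 * j)) * RT j k) + sc (of_nat (2 * (n - 1))) * RT j k)
      = sc (?c + 4 * of_nat (2 * j) + of_nat (2 * (n - 1))) * RT j k + ?b * RT (Suc j) (k - 2)"
    by (simp only: sc_add sc_mult distrib_right mult.assoc add_ac)
  also have "?c + 4 * of_nat (2 * j) + of_nat (2 * (n - 1)) = of_nat (2 * Suc j) * (of_nat (2 * Suc j + n) - 3)"
    using n by (simp add: of_nat_diff algebra_simps)
  finally show ?case by simp
qed

lemma d_R_power:
  assumes "a \<in> vidx n"
  shows "dop a * Rop ^ j = Rop ^ j * dop a + sc (of_nat (2 * j)) * (ee a * (xop a * Rop ^ (j - 1)))"
proof (induction j)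
  case 0
  show ?case using sc_zero by simp
next
  case (Suc j)
  let ?z = "ee a * (xop a * Rop ^ j)"
  have "dop a * Rop ^ Suc j = (dop a * Rop) * Rop ^ j" by (simp add: mult.assoc)
  also have "\<dots> = Rop * (dop a * Rop ^ j) + sc 2 * ?z"
    by (simp add: d_R[OF assms] distrib_right mult.assoc)
  also have "\<dots> = Rop ^ Suc j * dop a + (sc (of_nat (2 * j)) * (ee a * (Rop * (xop a * Rop ^ (j - 1)))) + sc 2 * ?z)"
    by (simp add: Suc distrib_left mult.assoc sc_central(2)[of Rop] add.assoc)
  also have "sc (of_nat (2 * j)) * (ee a * (Rop * (xop a * Rop ^ (j - 1)))) = sc (of_nat (2 * j)) * ?z"
  proof (cases j)
    case (Suc i)
    have "Rop * (xop a * Rop ^ i) = xop a * (Rop * Rop ^ i)" by (simp add: x_R flip: mult.assoc)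
    then show ?thesis by (simp add: Suc)
  qed (use sc_zero in simp)
  also have "sc (of_nat (2 * j)) * ?z + sc 2 * ?z = sc (of_nat (2 * Suc j)) * ?z"
    by (simp only: distrib_right[symmetric] sc_add[symmetric]) (simp add: algebra_simps)
  finally show ?case by simp
qed

lemma eqv_d:
  assumes a: "a \<in> vidx n"
  shows "eqv (dop a * RT j k) (sc (of_nat (2 * j)) * (ee a * (xop a * RT (j - 1) k)))"
proof -
  have T: "dop a * Top = Top * dop a" using a vidx_Suc(2)[OF n] by (auto simp: dx)
  have "dop a * RT j k = (dop a * Rop ^ j) * Top ^ k" by (simp only: mult.assoc)
  also have "\<dots> = sc (of_nat (2 * j)) * (ee a * (xop a * RT (j - 1) k)) + Rop ^ j * (dop a * Top ^ k)"
    by (simp only: d_R_power[OF a] distrib_right mult.assoc add.commute)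
  also have "\<dots> = sc (of_nat (2 * j)) * (ee a * (xop a * RT (j - 1) k)) + RT j k * dop a"
    by (simp only: commute_power[OF T] mult.assoc)
  also have "eqv \<dots> (sc (of_nat (2 * j)) * (ee a * (xop a * RT (j - 1) k)))"
    by (intro eqv_zero_right eqv_vac)
  finally show ?thesis .
qed

text \<open>The first order part \<open>2 \<eta>\<^sub>a (\<lambda> - E) \<partial>\<^sub>a\<close> of \<open>P\<^sub>a\<close> and the first term of the Laplacian produce the same
  polynomial \<open>\<xi>\<^sub>a r\<^sup>j\<^sup>-\<^sup>1 t\<^sup>k\<close>; their coefficients add up to \<open>2 j (n - 1 + 2 \<lambda> - 2 j - 2 k)\<close>.\<close>

lemma eqv_pp:
  assumes a: "a \<in> vidx n"
  shows "eqv (pp a * RT j k)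
    (sc (of_nat (2 * j) * (of_nat n - 1 + 2 * lam - of_nat (2 * j + 2 * k))) * (xop a * RT (j - 1) k)
     + sc (of_nat (k * (k - 1))) * (xop a * RT j (k - 2)))"
proof -
  let ?u = "xop a * RT (j - 1) k"
  have two: "sc 2 = 2" using sc_add[of 1 1] sc_one by simp
  have pp: "pp a = xop a * Lap + sc 2 * (ee a * (hh * dop a))"
    by (simp add: pp_def hh_def two mult_2 algebra_simps)
  have hx: "hh * xop a = xop a * hh + sc (- 1) * xop a"
    using hh_x[of a] a vidx_Suc(1)[OF n] sc_uminus[of 1] sc_one by (simp add: algebra_simps)
  have hu: "eqv (sc (of_nat (2 * j)) * (hh * ?u)) (sc (of_nat (2 * j)) * (sc (lam + 1 - of_nat (2 * j + k)) * ?u))"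
  proof (cases j)
    case 0
    then show ?thesis using sc_zero by (simp add: eqv_rules)
  next
    case (Suc i)
    have "hh * ?u = xop a * (hh * RT (j - 1) k) + sc (- 1) * ?u"
      by (simp add: hx distrib_right mult.assoc[symmetric])
    also have "eqv \<dots> (xop a * (sc (lam - of_nat (2 * (j - 1) + k)) * RT (j - 1) k) + sc (- 1) * ?u)"
      by (intro eqv_rules(4) eqv_rules(3) eqv_hh eqv_rules(1))
    also have "\<dots> = sc (lam - of_nat (2 * (j - 1) + k) + - 1) * ?u"
      by (simp only: sc_central(2)[of "xop a"] sc_add distrib_right)
    also have "lam - of_nat (2 * (j - 1) + k) + - 1 = lam + 1 - of_nat (2 * j + k)"
      by (simp add: Suc algebra_simps)
    finally show ?thesis by (rule eqv_rules(3))
  qed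
  have "pp a * RT j k = xop a * (Lap * RT j k) + sc 2 * (ee a * (hh * (dop a * RT j k)))"
    by (simp only: pp distrib_right mult.assoc)
  also have "eqv \<dots> (xop a * (sc (of_nat (2 * j) * (of_nat (2 * j + n) - 3)) * RT (j - 1) k + sc (of_nat (k * (k - 1))) * RT j (k - 2))
      + sc 2 * (ee a * (hh * (sc (of_nat (2 * j)) * (ee a * ?u)))))"
    by (intro eqv_rules(4) eqv_rules(3) eqv_Lap eqv_d[OF a])
  also have "sc 2 * (ee a * (hh * (sc (of_nat (2 * j)) * (ee a * ?u)))) = sc 2 * (sc (of_nat (2 * j)) * (hh * ?u))"
  proof -
    have "ee a * (hh * (sc (of_nat (2 * j)) * (ee a * ?u))) = sc (of_nat (2 * j)) * (ee a * (ee a * (hh * ?u)))"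
      by (simp only: sc_central(2)[of hh] sc_central(2)[of "ee a" "of_nat (2 * j)"])
    then show ?thesis using e_square[of a] by simp
  qed
  also have "eqv (xop a * (sc (of_nat (2 * j) * (of_nat (2 * j + n) - 3)) * RT (j - 1) k + sc (of_nat (k * (k - 1))) * RT j (k - 2))
      + sc 2 * (sc (of_nat (2 * j)) * (hh * ?u)))
     (xop a * (sc (of_nat (2 * j) * (of_nat (2 * j + n) - 3)) * RT (j - 1) k + sc (of_nat (k * (k - 1))) * RT j (k - 2))
      + sc 2 * (sc (of_nat (2 * j)) * (sc (lam + 1 - of_nat (2 * j + k)) * ?u)))"
    by (intro eqv_rules(4) eqv_rules(1) eqv_rules(3)[OF hu])
  also have "\<dots> = sc (of_nat (2 * j) * (of_nat (2 * j + n) - 3) + 2 * (of_nat (2 * j) * (lam + 1 - of_nat (2 * j + k)))) * ?u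
      + sc (of_nat (k * (k - 1))) * (xop a * RT j (k - 2))"
  proof -
    have "xop a * (sc \<alpha> * U + sc \<beta> * W) + sc 2 * (sc \<gamma> * (sc \<delta> * (xop a * U)))
        = sc (\<alpha> + 2 * (\<gamma> * \<delta>)) * (xop a * U) + sc \<beta> * (xop a * W)" for \<alpha> \<beta> \<gamma> \<delta> U W
      by (simp only: distrib_left distrib_right sc_add sc_mult sc_central(2)[of "xop a"] mult.assoc add_ac)
    then show ?thesis .
  qed
  also have "of_nat (2 * j) * (of_nat (2 * j + n) - 3) + 2 * (of_nat (2 * j) * (lam + 1 - of_nat (2 * j + k)))
      = of_nat (2 * j) * (of_nat n - 1 + 2 * lam - of_nat (2 * j + 2 * k))"
    by (simp add: algebra_simps)
  finally show ?thesis .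
qed

definition Pop :: weyl_op where
  "Pop = (\<Sum>j\<le>N div 2. sc (poly (sv_coeff n N j) lam) * RT j (N - 2 * j))"

lemma Pop_ll: "a \<in> vidx n \<Longrightarrow> b \<in> vidx n \<Longrightarrow> eqv (ll a b * Pop) 0"
proof -
  assume ab: "a \<in> vidx n" "b \<in> vidx n"
  have "ll a b * Pop = (\<Sum>j\<le>N div 2. sc (poly (sv_coeff n N j) lam) * (ll a b * RT j (N - 2 * j)))"
    by (simp only: Pop_def sum_distrib_left sc_central(2)[of "ll a b"])
  also have "eqv \<dots> (\<Sum>j\<le>N div 2. sc (poly (sv_coeff n N j) lam) * 0)"
    by (intro eqv_sum eqv_rules(3) eqv_ll ab)
  finally show ?thesis by simp
qed

lemma Pop_hh: "eqv (hh * Pop) (sc (lam - of_nat N) * Pop)"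
proof -
  have "hh * Pop = (\<Sum>j\<le>N div 2. sc (poly (sv_coeff n N j) lam) * (hh * RT j (N - 2 * j)))"
    by (simp only: Pop_def sum_distrib_left sc_central(2)[of hh])
  also have "eqv \<dots> (\<Sum>j\<le>N div 2. sc (poly (sv_coeff n N j) lam) * (sc (lam - of_nat (2 * j + (N - 2 * j))) * RT j (N - 2 * j)))"
    by (intro eqv_sum eqv_rules(3) eqv_hh)
  also have "\<dots> = (\<Sum>j\<le>N div 2. sc (lam - of_nat N) * (sc (poly (sv_coeff n N j) lam) * RT j (N - 2 * j)))"
  proof (intro sum.cong refl)
    fix j assume "j \<in> {..N div 2}"
    then have "2 * j + (N - 2 * j) = N" by auto
    then show "sc (poly (sv_coeff n N j) lam) * (sc (lam - of_nat (2 * j + (N - 2 * j))) * RT j (N - 2 * j))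
      = sc (lam - of_nat N) * (sc (poly (sv_coeff n N j) lam) * RT j (N - 2 * j))"
      by (simp only: sc_central(2)[of "sc (lam - of_nat N)"])
  qed
  also have "\<dots> = sc (lam - of_nat N) * Pop" by (simp only: Pop_def sum_distrib_left)
  finally show ?thesis .
qed

text \<open>The term of index \<open>j + 1\<close> contributes to \<open>\<xi>\<^sub>a r\<^sup>j t\<^sup>N\<^sup>-\<^sup>2\<^sup>j\<^sup>-\<^sup>2\<close> through the first summand of \<open>eqv_pp\<close>, the
  term of index \<open>j\<close> through the second; the recursion says that they cancel. At the two ends the
  coefficients 0 and \<open>(N - 2 j) (N - 2 j - 1)\<close> with \<open>N - 2 j \<le> 1\<close> vanish.\<close>

lemma Pop_pp:
  assumes a: "a \<in> vidx n"
  shows "eqv (pp a * Pop) 0"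
proof -
  define K where "K = N div 2"
  let ?c = "\<lambda>j. poly (sv_coeff n N j) lam"
  let ?g = "\<lambda>j. of_nat (2 * j) * (of_nat n - 1 + 2 * lam - of_nat (2 * j + 2 * (N - 2 * j)))"
  let ?b = "\<lambda>j. of_nat ((N - 2 * j) * (N - 2 * j - 1)) :: complex"
  let ?W = "\<lambda>j. xop a * RT j (N - 2 * j - 2)"
  have "pp a * Pop = (\<Sum>j\<le>K. sc (?c j) * (pp a * RT j (N - 2 * j)))"
    by (simp only: Pop_def K_def sum_distrib_left sc_central(2)[of "pp a"])
  also have "eqv \<dots> (\<Sum>j\<le>K. sc (?c j) * (sc (?g j) * (xop a * RT (j - 1) (N - 2 * j)) + sc (?b j) * ?W j))"
    by (intro eqv_sum eqv_rules(3) eqv_pp a)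
  also have "\<dots> = (\<Sum>j\<le>K. sc (?c j * ?g j) * (xop a * RT (j - 1) (N - 2 * j))) + (\<Sum>j\<le>K. sc (?c j * ?b j) * ?W j)"
    by (simp only: distrib_left sum.distrib sc_mult mult.assoc)
  also have "(\<Sum>j\<le>K. sc (?c j * ?g j) * (xop a * RT (j - 1) (N - 2 * j))) = (\<Sum>j<K. sc (?c (Suc j) * ?g (Suc j)) * ?W j)"
  proof -
    have "sc (?c 0 * ?g 0) * (xop a * RT (0 - 1) (N - 2 * 0)) = 0" using sc_zero by simp
    moreover have "sc (?c (Suc j) * ?g (Suc j)) * (xop a * RT (Suc j - 1) (N - 2 * Suc j)) = sc (?c (Suc j) * ?g (Suc j)) * ?W j" for j
    proof -
      have "N - 2 * Suc j = N - 2 * j - 2" by simp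
      then show ?thesis by (simp only: diff_Suc_1)
    qed
    ultimately show ?thesis by (simp only: sum.atMost_shift add_0_left)
  qed
  also have "(\<Sum>j\<le>K. sc (?c j * ?b j) * ?W j) = (\<Sum>j<K. sc (?c j * ?b j) * ?W j)"
  proof -
    have "N - 2 * K = 0 \<or> N - 2 * K = 1" unfolding K_def by presburger
    then have "(N - 2 * K) * (N - 2 * K - 1) = 0" by auto
    then have "sc (?c K * ?b K) * ?W K = 0" using sc_zero by (simp only: of_nat_0 mult_zero_right) simp
    then show ?thesis by (simp only: lessThan_Suc_atMost[symmetric] sum.lessThan_Suc add_0_right)
  qed
  also have "(\<Sum>j<K. sc (?c (Suc j) * ?g (Suc j)) * ?W j) + (\<Sum>j<K. sc (?c j * ?b j) * ?W j)
      = (\<Sum>j<K. sc (?c (Suc j) * ?g (Suc j) + ?c j * ?b j) * ?W j)"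
    by (simp only: sc_add distrib_right sum.distrib)
  also have "\<dots> = (\<Sum>j<K. 0)"
  proof (intro sum.cong refl)
    fix j assume "j \<in> {..<K}"
    then have "?c (Suc j) * ?g (Suc j) + ?c j * ?b j = 0"
      using sv_coeff_rec[of j N n lam] by (simp only: K_def lessThan_iff)
    then show "sc (?c (Suc j) * ?g (Suc j) + ?c j * ?b j) * ?W j = 0" using sc_zero by simp
  qed
  finally show ?thesis by simp
qed

lemma app_Top_power: "app (Top ^ k) vac = (\<lambda>A. if A = replicate_mset k (Suc n) then 1 else 0)"
proof (induction k)
  case 0
  show ?case by (simp add: app_simps) (simp add: vac_def fun_eq_iff)
next
  case (Suc k)
  show ?case
    by (rule ext) (auto simp: app_simps Suc app_xop, metis insert_DiffM)
qed

text \<open>A monomial with no variables besides \<open>\<xi>\<^sub>2\<close> and \<open>t\<close> can arise from multiplication by \<open>r\<close> only through the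
  term \<open>\<xi>\<^sub>2\<^sup>2\<close>.\<close>

lemma app_Rop_lead:
  "app Rop u (replicate_mset (2 * i) 2 + replicate_mset k (Suc n))
    = (if i > 0 then u (replicate_mset (2 * (i - 1)) 2 + replicate_mset k (Suc n)) else 0)"
proof -
  let ?A = "replicate_mset (2 * i) 2 + replicate_mset k (Suc n) :: nat multiset"
  have two: "2 \<in> vidx n" by (simp add: vidx_def)
  have "app Rop u ?A = (\<Sum>b\<in>vidx n. complex_of_real (eta b) * app (xop b) (app (xop b) u) ?A)"
    by (simp add: Rop_def app_sum app_simps app_sc)
  also have "\<dots> = (\<Sum>b\<in>vidx n. if b = 2 then complex_of_real (eta 2) * app (xop 2) (app (xop 2) u) ?A else 0)"
  proof (intro sum.cong refl)
    fix b assume "b \<in> vidx n"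
    then have "b \<noteq> Suc n" using vidx_Suc(2)[OF n] by auto
    then show "complex_of_real (eta b) * app (xop b) (app (xop b) u) ?A
      = (if b = 2 then complex_of_real (eta 2) * app (xop 2) (app (xop 2) u) ?A else 0)"
      by (auto simp: app_xop)
  qed
  also have "\<dots> = app (xop 2) (app (xop 2) u) ?A" using two by (simp add: eta_def)
  also have "\<dots> = (if i > 0 then u (replicate_mset (2 * (i - 1)) 2 + replicate_mset k (Suc n)) else 0)"
  proof (cases i)
    case 0
    then show ?thesis using n by (auto simp: app_xop)
  next
    case (Suc j)
    then have "?A = add_mset 2 (add_mset 2 (replicate_mset (2 * j) 2 + replicate_mset k (Suc n)))" by simp
    then show ?thesis using Suc by (simp only:) (simp add: app_xop)
  qed
  finally show ?thesis .
qed

lemma app_RT_lead: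
  "app (RT j k) vac (replicate_mset (2 * i) 2 + replicate_mset l (Suc n)) = (if i = j \<and> l = k then 1 else 0)"
proof (induction j arbitrary: i)
  case 0
  have "replicate_mset (2 * i) 2 + replicate_mset l (Suc n) = replicate_mset k (Suc n) \<longleftrightarrow> i = 0 \<and> l = k"
  proof
    assume *: "replicate_mset (2 * i) 2 + replicate_mset l (Suc n) = replicate_mset k (Suc n)"
    have "2 * i = 0" using arg_cong[OF *, of "\<lambda>A. count A 2"] n by (simp split: if_splits)
    then show "i = 0 \<and> l = k" using arg_cong[OF *, of size] by simp
  qed simp
  then show ?case by (simp add: app_Top_power)
next
  case (Suc j)
  have "app (RT (Suc j) k) vac = app Rop (app (RT j k) vac)" by (simp add: app_simps mult.assoc)
  then show ?case by (cases i) (simp_all only: app_Rop_lead Suc.IH, auto)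
qed

lemma Pop_lead: "app Pop vac (lead n N (N div 2)) = 1"
proof -
  have "app Pop vac (lead n N (N div 2))
    = (\<Sum>j\<le>N div 2. poly (sv_coeff n N j) lam * (if N div 2 = j \<and> N - 2 * (N div 2) = N - 2 * j then 1 else 0))"
    by (simp add: Pop_def app_sum lead_def app_RT_lead app_simps(6)[of "sc _"] app_sc)
  also have "\<dots> = (\<Sum>j\<le>N div 2. if N div 2 = j then poly (sv_coeff n N (N div 2)) lam else 0)"
    by (intro sum.cong refl) auto
  finally show ?thesis by (simp add: sv_coeff_def)
qed

lemma singular_poly_Pop: "singular_poly n lam N (app Pop vac)"
  using Pop_ll Pop_pp Pop_hh
  by (simp add: singular_poly_def eqv_def app_simps app_sc)

lemma singular_poly_diff:
  assumes "singular_poly n lam N f" "singular_poly n lam N g"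
  shows "singular_poly n lam N (\<lambda>A. f A - c * g A)"
proof -
  have d: "app u (\<lambda>A. f A - c * g A) = (\<lambda>A. app u f A - c * app u g A)" for u
    using app_add[of u f "\<lambda>A. - c * g A"] app_scale[of u "- c" g] by (simp add: fun_eq_iff)
  show ?thesis
    using assms unfolding singular_poly_def d by (simp add: right_diff_distrib mult.left_commute)
qed

text \<open>After subtraction of a multiple of the explicit solution, which has top coefficient 1, the top
  coefficient is 0 and \<open>singular_poly_unique\<close> applies.\<close>

lemma singular_poly_multiple:
  assumes f: "singular_poly n lam N f"
    and supp: "\<And>A. f A \<noteq> 0 \<Longrightarrow> set_mset A \<subseteq> vidx (Suc n)"
      "\<And>A. app Pop vac A \<noteq> 0 \<Longrightarrow> set_mset A \<subseteq> vidx (Suc n)"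
  shows "\<exists>c. f = (\<lambda>A. c * app Pop vac A)"
proof -
  let ?c = "f (lead n N (N div 2))"
  have z: "(\<lambda>A. f A - ?c * app Pop vac A) = (\<lambda>A. 0)"
  proof (rule singular_poly_unique)
    show "singular_poly n lam N (\<lambda>A. f A - ?c * app Pop vac A)"
      by (rule singular_poly_diff[OF f singular_poly_Pop])
    show "set_mset A \<subseteq> vidx (Suc n)" if "f A - ?c * app Pop vac A \<noteq> 0" for A
    proof -
      have "f A \<noteq> 0 \<or> app Pop vac A \<noteq> 0" using that by auto
      then show ?thesis using supp by blast
    qed
  qed (simp add: Pop_lead)
  have "f A = ?c * app Pop vac A" for A
    by (rule eq_iff_diff_eq_0[THEN iffD2]) (rule fun_cong[OF z])
  then show ?thesis by blast
qed

end

section \<open>The polynomial family of homomorphisms\<close>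

lemma pad_diff:
  "X \<in> carrier_mat (n + 1) (n + 1) \<Longrightarrow> Y \<in> carrier_mat (n + 1) (n + 1) \<Longrightarrow> pad n (X - Y) = pad n X - pad n Y"
  by (rule eq_matI) (auto simp: pad_def)

lemma pad_Lmat: "A \<le> n \<Longrightarrow> B \<le> n \<Longrightarrow> pad n (Lmat n A B) = Lmat (Suc n) A B"
proof (rule eq_matI)
  fix i j assume AB: "A \<le> n" "B \<le> n" and "i < dim_row (Lmat (Suc n) A B)" "j < dim_col (Lmat (Suc n) A B)"
  then have ij: "i \<le> n + 1" "j \<le> n + 1" by auto
  show "pad n (Lmat n A B) $$ (i, j) = Lmat (Suc n) A B $$ (i, j)"
    using AB ij by (cases "i = n + 1 \<or> j = n + 1") (auto simp: pad_entry Lmat_entry_of_bool)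
qed (auto simp: pad_def)

lemma pad_Pmat: "n \<ge> 4 \<Longrightarrow> a \<in> vidx n \<Longrightarrow> pad n (Pmat n a) = Pmat (Suc n) a"
  using vidx_le[of n a] by (simp add: Pmat_def pad_diff pad_Lmat)

lemma pad_zero: "pad n (0\<^sub>m (n + 1) (n + 1)) = 0\<^sub>m (Suc n + 1) (Suc n + 1)"
  by (rule eq_matI) (auto simp: pad_def)

text \<open>The explicit singular vector as an element of \<open>U(n\<^sup>-)\<close>, with \<open>\<xi>\<^sub>a\<close> replaced by \<open>N\<^sub>a\<close>. Only the coefficients
  of the terms \<open>r\<^sup>j t\<^sup>N\<^sup>-\<^sup>2\<^sup>j\<close> depend on \<open>\<lambda>\<close>.\<close>

definition quadric :: "nat \<Rightarrow> free_algebra" where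
  "quadric n = (\<Sum>a\<in>vidx n. scal (complex_of_real (eta a)) * (gen (Nmat (Suc n) a) * gen (Nmat (Suc n) a)))"

definition sv_term :: "nat \<Rightarrow> nat \<Rightarrow> nat \<Rightarrow> free_algebra" where
  "sv_term n N j = quadric n ^ j * gen (Nmat (Suc n) (Suc n)) ^ (N - 2 * j)"

definition sv :: "nat \<Rightarrow> nat \<Rightarrow> complex \<Rightarrow> free_algebra" where
  "sv n N lam = (\<Sum>j\<le>N div 2. scal (poly (sv_coeff n N j) lam) * sv_term n N j)"

context
  fixes n N :: nat and lam :: complex
  assumes n: "n \<ge> 4"
begin

interpretation conformal sc xop dop "Suc n" lam by (rule conformal_op)

lemma Suc_n: "Suc n \<ge> 4"
  using n by simp

lemma sv_term_words: "sv_term n N j \<in> words_over (n_minus (Suc n))"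
proof -
  have g: "gen (Nmat (Suc n) a) \<in> words_over (n_minus (Suc n))" if "a \<in> vidx (Suc n)" for a
    using n_minus_base[OF Suc_n that] by auto
  have q: "quadric n \<in> words_over (n_minus (Suc n))"
    unfolding quadric_def using g vidx_Suc(1)[OF n]
    by (intro sum_in_words_over words_over_closed) auto
  show ?thesis
    unfolding sv_term_def using q g[of "Suc n"] vidx_Suc(1)[OF n]
    by (intro words_over_closed power_in_words_over) auto
qed

lemma sv_words: "sv n N lam \<in> words_over (lie_g (Suc n))"
  unfolding sv_def
  using words_over_mono[OF _ sv_term_words, of "lie_g (Suc n)"] n_minus_lie_g[OF Suc_n]
  by (intro sum_in_words_over words_over_closed) auto

lemma ev_sv: "ev (Suc n) lam (sv n N lam) = app (Pop n N lam) vac"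
proof -
  have g: "act (Suc n) lam (gen (Nmat (Suc n) a)) = xop a" if "a \<in> vidx (Suc n)" for a
    using rho_Nmat[OF Suc_n that] by (simp add: act_simps[OF Suc_n])
  have "act (Suc n) lam (quadric n) = Rop n"
    unfolding quadric_def Rop_def[OF n]
    using g vidx_Suc(1)[OF n] by (simp add: act_simps[OF Suc_n])
  then have "act (Suc n) lam (sv_term n N j) = Rop n ^ j * xop (Suc n) ^ (N - 2 * j)" for j
    unfolding sv_term_def using g[of "Suc n"] vidx_Suc(1)[OF n] by (simp only: act_simps[OF Suc_n] insertI1)
  then have "act (Suc n) lam (sv n N lam) = Pop n N lam"
    by (simp add: sv_def Pop_def[OF n] act_simps[OF Suc_n])
  then show ?thesis by (simp add: ev_def)
qed

text \<open>The inclusion maps the basis of the smaller parabolic subalgebra to elements of the same name, whose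
  operators are known.\<close>

lemma singular_iff:
  assumes v: "v \<in> words_over (lie_g (Suc n))"
  shows "singular n (lam - of_nat N) lam v \<longleftrightarrow> singular_poly n lam N (ev (Suc n) lam v)"
proof -
  let ?f = "ev (Suc n) lam v" and ?mu = "lam - of_nat N"
  have mem: "(gen (pad n X) - scal c) * v \<in> verma_ideal (Suc n) lam \<longleftrightarrow> app (rho (pad n X)) ?f = (\<lambda>A. c * ?f A)"
    if X: "X \<in> parabolic n" for X c
  proof -
    have "(gen (pad n X) - scal c) * v \<in> words_over (lie_g (Suc n))"
      using v pad_lie_g[OF parabolic_lie_g[OF n X]] by auto
    then show ?thesis
      by (simp add: verma_ideal_iff[OF Suc_n] ev_simps[OF Suc_n] act_simps[OF Suc_n] app_simps app_sc fun_eq_iff)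
  qed
  have cond: "singular n ?mu lam v \<longleftrightarrow>
      (\<forall>X\<in>parabolic n. app (rho (pad n X)) ?f = (\<lambda>A. complex_of_real (X $$ (0, 3)) * ?mu * ?f A))"
    using v mem by (simp add: singular_def)
  have rho_L: "rho (pad n (Lmat n A B)) = Lam A B" if "A \<le> n" "B \<le> n" for A B
    using that by (simp add: pad_Lmat rho_Lmat)
  have rho_P: "rho (pad n (Pmat n a)) = pp a" if "a \<in> vidx n" for a
    using that vidx_Suc(1)[OF n] by (simp add: pad_Pmat[OF n] rho_Pmat[OF Suc_n])
  have V: "a \<in> vidx n \<Longrightarrow> a \<in> vidx (Suc n)" for a using vidx_Suc(1)[OF n] by simp
  have e: "Lmat n a b $$ (0, 3) = 0" "Pmat n a $$ (0, 3) = 0" if "a \<in> vidx n" "b \<in> vidx n" for a b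
    using n vidx_props[OF that(1)] vidx_props[OF that(2)] by (simp_all add: Pmat_def Lmat_entry)
  have eH: "Lmat n 0 3 $$ (0, 3) = 1" using n by (simp add: Lmat_entry eta_def)
  show ?thesis
  proof
    assume "singular n ?mu lam v"
    then have *: "app (rho (pad n X)) ?f = (\<lambda>A. complex_of_real (X $$ (0, 3)) * ?mu * ?f A)"
      if "X \<in> parabolic n" for X using cond that by blast
    show "singular_poly n lam N ?f"
      unfolding singular_poly_def
    proof (intro conjI ballI)
      fix a b assume ab: "a \<in> vidx n" "b \<in> vidx n"
      then show "app (ll a b) ?f = (\<lambda>A. 0)"
        using *[OF parabolic_closed(3)[OF n Lmat_lie_m[OF n ab]]] vidx_le[OF n]
        by (simp add: rho_L e V Lam_values)
    next
      fix a assume a: "a \<in> vidx n"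
      then show "app (pp a) ?f = (\<lambda>A. 0)"
        using *[OF parabolic_closed(4)[OF n Pmat_n_plus[OF n a]]] by (simp add: rho_P e)
    next
      show "app hh ?f = (\<lambda>A. ?mu * ?f A)"
        using *[OF parabolic_closed(5)[OF n]] n by (simp add: Hmat_L[OF n] rho_L eH Lam_values)
    qed
  next
    assume s: "singular_poly n lam N ?f"
    have "X \<in> carrier_mat (n + 1) (n + 1) \<and>
        app (rho (pad n X)) ?f = (\<lambda>A. complex_of_real (X $$ (0, 3)) * ?mu * ?f A)" if "X \<in> parabolic n" for X
      using that
    proof (induction rule: parabolic_induct[OF n, consumes 1])
      case 1
      have "rho (0\<^sub>m (Suc n + 1) (Suc n + 1)) = 0" by (simp add: rho_def)
      then show ?case unfolding pad_zero using n by (simp add: app_simps)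
    next
      case (2 X Y)
      have "rho (pad n (X + Y)) = rho (pad n X) + rho (pad n Y)"
        using 2 pad_carrier[of X n] pad_carrier[of Y n] by (simp add: pad_add rho_add)
      moreover have "(X + Y) $$ (0, 3) = X $$ (0, 3) + Y $$ (0, 3)"
        using 2 n by (intro index_add_mat(1)) auto
      ultimately show ?case using 2 by (simp add: app_simps algebra_simps)
    next
      case (3 c X)
      have "rho (pad n (c \<cdot>\<^sub>m X)) = sc (complex_of_real c) * rho (pad n X)"
        using 3 pad_carrier[of X n] by (simp add: pad_smult rho_smult)
      moreover have "(c \<cdot>\<^sub>m X) $$ (0, 3) = c * X $$ (0, 3)"
        using 3 n by (intro index_smult_mat(1)) auto
      ultimately show ?case using 3 by (simp add: app_simps app_sc algebra_simps)
    next
      case (4 a b)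
      then show ?case
        using s vidx_le[OF n] by (simp add: rho_L e V Lam_values singular_poly_def)
    next
      case 5
      then show ?case using s n by (simp add: rho_L eH Lam_values singular_poly_def)
    next
      case (6 a)
      then show ?case using s by (simp add: rho_P e singular_poly_def)
    qed
    then show "singular n ?mu lam v" unfolding cond by blast
  qed
qed

lemma singular_sv: "singular n (lam - of_nat N) lam (sv n N lam)"
  unfolding singular_iff[OF sv_words] ev_sv by (rule singular_poly_Pop[OF n])

lemma singular_multiple:
  assumes w: "singular n (lam - of_nat N) lam w"
  shows "\<exists>c. w - scal c * sv n N lam \<in> verma_ideal (n + 1) lam"
proof -
  have ww: "w \<in> words_over (lie_g (Suc n))" using w by (simp add: singular_def)
  have "\<exists>c. ev (Suc n) lam w = (\<lambda>A. c * app (Pop n N lam) vac A)"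
  proof (rule singular_poly_multiple[OF n])
    show "singular_poly n lam N (ev (Suc n) lam w)" using w singular_iff[OF ww] by simp
    show "set_mset A \<subseteq> vidx (Suc n)" if "ev (Suc n) lam w A \<noteq> 0" for A
      by (rule ev_support[OF Suc_n ww that])
    show "set_mset A \<subseteq> vidx (Suc n)" if "app (Pop n N lam) vac A \<noteq> 0" for A
      by (rule ev_support[OF Suc_n sv_words, where lam = lam]) (use that in \<open>simp add: ev_sv\<close>)
  qed
  then obtain c where c: "ev (Suc n) lam w = (\<lambda>A. c * ev (Suc n) lam (sv n N lam) A)"
    by (auto simp: ev_sv)
  have "w - scal c * sv n N lam \<in> words_over (lie_g (Suc n))" using ww sv_words by auto
  then have "w - scal c * sv n N lam \<in> verma_ideal (Suc n) lam"
    by (simp add: verma_ideal_iff[OF Suc_n] ev_simps[OF Suc_n] act_simps[OF Suc_n] app_sc c)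
  then show ?thesis by auto
qed

end

lemma n_minus_incl_ucls:
  assumes "m \<ge> 4" "p \<in> words_over (n_minus m)"
  shows "n_minus_incl m (ucls (n_minus m) p) = ucls (lie_g m) p"
proof -
  have "n_minus_incl m (ucls (n_minus m) p) = ucls (lie_g m) (free_map id p)"
    unfolding n_minus_incl_def
    by (rule U_map_ucls[OF lie_closed_n_minus[OF assms(1)] lie_closed_lie_g _ _ _ _ assms(2)])
      (auto intro: n_minus_lie_g[OF assms(1)])
  then show ?thesis by (simp only: free_map_id)
qed

lemma polynomial_family_sv:
  assumes n: "n \<ge> 4"
  shows "polynomial_family (n_minus (n + 1)) (\<lambda>lam. ucls (n_minus (n + 1)) (sv n N lam))"
  unfolding polynomial_family_def
proof (intro exI conjI allI impI)
  let ?L = "n_minus (n + 1)"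
  have m: "n + 1 \<ge> 4" using n by simp
  note L = lie_closed_n_minus[OF m]
  have w: "sv_term n N j \<in> words_over ?L" for j using sv_term_words[OF n] by simp
  show "ucls ?L (sv_term n N k) \<in> carrier (UEA ?L)" for k
    using w by (auto simp: carrier_UEA)
  fix lam
  have "(\<Oplus>\<^bsub>UEA ?L\<^esub>k\<in>{..<Suc (N div 2)}. U_scalar ?L (poly (sv_coeff n N k) lam) \<otimes>\<^bsub>UEA ?L\<^esub> ucls ?L (sv_term n N k))
    = (\<Oplus>\<^bsub>UEA ?L\<^esub>k\<in>{..<Suc (N div 2)}. ucls ?L (scal (poly (sv_coeff n N k) lam) * sv_term n N k))"
  proof -
    have "U_scalar ?L c \<otimes>\<^bsub>UEA ?L\<^esub> ucls ?L (sv_term n N k) = ucls ?L (scal c * sv_term n N k)" for c k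
      unfolding U_scalar_ucls[OF L] by (rule UEA_ops(2)[OF L words_over_closed(3) w])
    then show ?thesis by (simp only:)
  qed
  also have "\<dots> = ucls ?L (\<Sum>k\<in>{..<Suc (N div 2)}. scal (poly (sv_coeff n N k) lam) * sv_term n N k)"
    using w by (intro UEA_finsum[OF L]) auto
  finally show "ucls ?L (sv n N lam) = (\<Oplus>\<^bsub>UEA ?L\<^esub>k\<in>{..<Suc (N div 2)}.
      U_scalar ?L (poly (sv_coeff n N k) lam) \<otimes>\<^bsub>UEA ?L\<^esub> ucls ?L (sv_term n N k))"
    by (simp only: sv_def lessThan_Suc_atMost)
qed

theorem theorem1:
  fixes n N :: nat
  assumes "n \<ge> 4"
  shows "\<exists>D :: complex \<Rightarrow> env.
    polynomial_family (n_minus (n + 1)) D \<and>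
    (\<forall>lam :: complex.
      \<exists>\<Phi> \<in> verma_homs n (lam - of_nat N) lam.
        (\<forall>T \<in> carrier (UEA (lie_g n)).
          \<Phi> (verma_class n (lam - of_nat N) (tensor n T 1)) =
          verma_class (n + 1) lam
            (tensor (n + 1)
              (incl n T \<otimes>\<^bsub>UEA (lie_g (n + 1))\<^esub> n_minus_incl (n + 1) (D lam)) 1)) \<and>
        verma_homs n (lam - of_nat N) lam =
          {hom_scale n (lam - of_nat N) lam c \<Phi> | c. True})"
proof (rule exI[of _ "\<lambda>lam. ucls (n_minus (n + 1)) (sv n N lam)"], intro conjI allI)
  show "polynomial_family (n_minus (n + 1)) (\<lambda>lam. ucls (n_minus (n + 1)) (sv n N lam))"
    by (rule polynomial_family_sv[OF assms])
  fix lam :: complex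
  let ?mu = "lam - of_nat N"
  have m: "n + 1 \<ge> 4" using assms by simp
  note s = singular_sv[OF assms, where N = N and lam = lam]
  have one: "tensor k (ucls (lie_g k) p) 1 = ucls (lie_g k) p" if "p \<in> words_over (lie_g k)" for k p
    using that by (simp add: tensor_def U_scalar_ucls[OF lie_closed_lie_g] UEA_ops(2)[OF lie_closed_lie_g] scal_simps)
  have "sv n N lam \<in> words_over (n_minus (n + 1))"
    using sv_term_words[OF assms] by (auto simp: sv_def)
  note D = n_minus_incl_ucls[OF m this]
  show "\<exists>\<Phi>\<in>verma_homs n ?mu lam.
        (\<forall>T \<in> carrier (UEA (lie_g n)).
          \<Phi> (verma_class n ?mu (tensor n T 1)) =
          verma_class (n + 1) lam
            (tensor (n + 1)
              (incl n T \<otimes>\<^bsub>UEA (lie_g (n + 1))\<^esub> n_minus_incl (n + 1) (ucls (n_minus (n + 1)) (sv n N lam))) 1)) \<and>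
        verma_homs n ?mu lam = {hom_scale n ?mu lam c \<Phi> | c. True}"
  proof (rule bexI[OF _ hom_of_in_verma_homs[OF assms s]], intro conjI ballI)
    fix T assume "T \<in> carrier (UEA (lie_g n))"
    then obtain p where p: "p \<in> words_over (lie_g n)" "T = ucls (lie_g n) p" by (auto simp: carrier_UEA)
    have sw: "sv n N lam \<in> words_over (lie_g (n + 1))" using sv_words[OF assms] by simp
    note pw = free_map_pad[OF p(1)]
    show "hom_of n ?mu lam (sv n N lam) (verma_class n ?mu (tensor n T 1)) =
          verma_class (n + 1) lam
            (tensor (n + 1)
              (incl n T \<otimes>\<^bsub>UEA (lie_g (n + 1))\<^esub> n_minus_incl (n + 1) (ucls (n_minus (n + 1)) (sv n N lam))) 1)"
      unfolding p(2) one[OF p(1)] D incl_ucls[OF p(1)] UEA_ops(2)[OF lie_closed_lie_g pw sw]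
        one[OF words_over_closed(7)[OF pw sw]]
      using hom_of_vcls[OF assms s p(1)] by (simp only: vcls_def)
  next
    show "verma_homs n ?mu lam = {hom_scale n ?mu lam c (hom_of n ?mu lam (sv n N lam)) | c. True}"
      by (rule verma_homs_spanned[OF assms s singular_multiple[OF assms]])
  qed
qed

end
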